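(* Let $(X_n)_{n\ge0}$ be a Markov chain satisfying the minorization, drift and strong aperiodicity conditions stated in the context (the atomic case), with constants $b,\lambda,K$ and functions/sets $V,C$. Then $(X_n)$ is geometrically ergodic, i.e. there are $\varrho<1$ and $M<\infty$ with $\|P^ng-\int g\,d\pi\|_V\le M\varrho^n\|g\|_V$ for all $g\in B_V$ and $n\ge1$. Moreover, for each of the two pairs $(r_0,K_0(\cdot))$ defined in the context, $$\rho_V\le r_0^{-1},$$ and for every $1<r<r_0$ $$M_V(r)\le \frac{r\lambda}{1-r\lambda}+\frac{r\lambda(K-\lambda)}{(1-\lambda)^2}+\frac{r\lambda(K-1)}{(1-\lambda)(1-r\lambda)}+\frac{r(K-r\lambda)}{1-r\lambda}K_0(r).$$
   Context: Setting. $(X_n)_{n\ge0}$ is a time-homogeneous Markov chain on a measurable space $(\mathcal S,\mathcal B)$ with one-step transition probability $\mathbf P(x,\cdot)$ and a unique stationary probability measure $\pi$; $Pf(x)=\int f(y)\mathbf P(x,dy)$. Conditions (atomic case): (1) Minorization: there are $C\in\mathcal B$ and a probability measure $\nu$ on $(\mathcal S,\mathcal B)$ with $\mathbf P(x,A)=\nu(A)$ for all $x\in C$, $A\in\mathcal B$ (so $C$ is an atom). (2) Drift: there are a measurable $V:\mathcal S\to[1,\infty)$ and constants $0<\lambda<1$, $K<\infty$ with $PV(x)\le\lambda V(x)$ for $x\notin C$ and $PV(x)\le K$ for $x\in C$. (3) Strong aperiodicity: $\nu(C)\ge b>0$, where $b<1$. Norms. $\|f\|_V=\sup_{x}|f(x)|/V(x)$;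 $B_V$ is the Banach space of measurable $f$ with $\|f\|_V<\infty$. $\rho_V$ is the spectral radius of $P-1\otimes\pi$ on $B_V$, where $(1\otimes\pi)g=\int g\,d\pi$. For $r>1$, $M_V(r)$ is the smallest constant $M$ such that $\|P^ng-\int g\,d\pi\|_V\le M r^{-n}\|g\|_V$ for all $g\in B_V$ and all $n\ge1$. Pairs $(r_0,K_0)$. Put $R=\lambda^{-1}$, $L=\lambda^{-1}K$, $N=\frac{L-1}{R-1}$, and for $\alpha>0$ $$D(\alpha)=\frac{|1+\frac{b}{1-b}(1-e^{\frac{i\pi}{1+\alpha}})|-1}{|1-e^{\frac{i\pi}{1+\alpha}}|},\qquad \kappa(\alpha)=\frac{\log\frac{N-1}{(1-b)\alpha}}{\log R},\qquad \alpha_0=\frac{\log\frac{L-bR}{(1-b)R}}{\log R}.$$ First pair (using the value of $\pi(C)$, assumed $<1$): with $\alpha=(\pi(C)^{-1}-1)/(1-b)$, $$r_0=\min\Big\{R,\Big(1+\tfrac{D(\alpha)}{\alpha}\Big)^{1/\kappa(\alpha)}\Big\},\qquad K_0(r)=\frac{\pi(C)(r^{\kappa(\alpha)}-1)}{(r-1)(\alpha^{-1}D(\alpha)-r^{\kappa(\alpha)}+1)}.$$ Second pair (not using $\pi(C)$; it is assumed that $\alpha_0\ge1$ so that the range of $\alpha$ is non-empty): $$r_0=\min\Big\{R,\min_{1\le\alpha\le\alpha_0}\Big(1+\tfrac{D(\alpha)}{\alpha}\Big)^{1/\kappa(\alpha)}\Big\},\qquad K_0(r)=\max_{1\le\alpha\le\alpha_0}\frac{r^{\kappa(\alpha)}-1}{(r-1)(\alpha^{-1}D(\alpha)-r^{\kappa(\alpha)}+1)}.$$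 *)

theory Defs
  imports "HOL-Probability.Probability"
begin

section \<open>Markov kernels and their action on functions\<close>

text \<open>
  A Markov chain on the measurable space \<open>S\<close> enters only through its one-step transition
  probability, a measurable map \<open>P\<close> from \<open>S\<close> into the probability measures on \<open>S\<close>.
  Functions are complex-valued, so that the space \<open>B_V\<close> below is a complex Banach space and
  the spectral radius is literally the radius of a spectrum; real functions are included.
\<close>

definition kernel_op :: "('a \<Rightarrow> 'a measure) \<Rightarrow> ('a \<Rightarrow> complex) \<Rightarrow> 'a \<Rightarrow> complex" where
  "kernel_op P g = (\<lambda>x. \<integral>y. g y \<partial>P x)"

definition stationary :: "'a measure \<Rightarrow> ('a \<Rightarrow> 'a measure) \<Rightarrow> 'a measure \<Rightarrow> bool" where
  "stationary S P \<mu> \<longleftrightarrow> \<mu> \<in> space (prob_algebra S) \<and> \<mu> \<bind> P = \<mu>"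

definition unique_stationary :: "'a measure \<Rightarrow> ('a \<Rightarrow> 'a measure) \<Rightarrow> 'a measure \<Rightarrow> bool" where
  "unique_stationary S P \<mu> \<longleftrightarrow> stationary S P \<mu> \<and> (\<forall>\<mu>'. stationary S P \<mu>' \<longrightarrow> \<mu>' = \<mu>)"

definition minorization_atom ::
    "'a measure \<Rightarrow> ('a \<Rightarrow> 'a measure) \<Rightarrow> 'a set \<Rightarrow> 'a measure \<Rightarrow> bool" where
  "minorization_atom S P C \<nu> \<longleftrightarrow>
     C \<in> sets S \<and> \<nu> \<in> space (prob_algebra S) \<and>
     (\<forall>x\<in>C. \<forall>A\<in>sets S. emeasure (P x) A = emeasure \<nu> A)"

text \<open>\<open>PV\<close> is a nonnegative integral here, so the bounds include its finiteness.\<close>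

definition drift_condition ::
    "'a measure \<Rightarrow> ('a \<Rightarrow> 'a measure) \<Rightarrow> 'a set \<Rightarrow> ('a \<Rightarrow> real) \<Rightarrow> real \<Rightarrow> real \<Rightarrow> bool" where
  "drift_condition S P C V lam K \<longleftrightarrow>
     V \<in> borel_measurable S \<and> (\<forall>x\<in>space S. 1 \<le> V x) \<and> 0 < lam \<and> lam < 1 \<and>
     (\<forall>x\<in>space S - C. (\<integral>\<^sup>+y. ennreal (V y) \<partial>P x) \<le> ennreal (lam * V x)) \<and>
     (\<forall>x\<in>C. (\<integral>\<^sup>+y. ennreal (V y) \<partial>P x) \<le> ennreal K)"

definition strong_aperiodicity :: "'a measure \<Rightarrow> 'a set \<Rightarrow> real \<Rightarrow> bool" where
  "strong_aperiodicity \<nu> C b \<longleftrightarrow> 0 < b \<and> b < 1 \<and> b \<le> measure \<nu> C"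


section \<open>The weighted space \<open>B_V\<close>, spectral radius and optimal constants\<close>

definition V_norm :: "'a measure \<Rightarrow> ('a \<Rightarrow> real) \<Rightarrow> ('a \<Rightarrow> complex) \<Rightarrow> ereal" where
  "V_norm S V f = (SUP x\<in>space S. ereal (cmod (f x) / V x))"

definition B_V :: "'a measure \<Rightarrow> ('a \<Rightarrow> real) \<Rightarrow> ('a \<Rightarrow> complex) set" where
  "B_V S V = {f \<in> borel_measurable S. V_norm S V f < \<infinity>}"

text \<open>
  Elements of \<open>B_V\<close> are determined only up to their values outside \<open>space S\<close>; hence
  equality of functions is always equality on \<open>space S\<close>.
\<close>

definition bounded_operator ::
    "'a measure \<Rightarrow> ('a \<Rightarrow> real) \<Rightarrow> (('a \<Rightarrow> complex) \<Rightarrow> 'a \<Rightarrow> complex) \<Rightarrow> bool" where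
  "bounded_operator S V A \<longleftrightarrow>
     (\<forall>f\<in>B_V S V. A f \<in> B_V S V) \<and>
     (\<forall>f\<in>B_V S V. \<forall>g\<in>B_V S V. \<forall>c d. \<forall>x\<in>space S.
        A (\<lambda>y. c * f y + d * g y) x = c * A f x + d * A g x) \<and>
     (\<exists>B::real. \<forall>f\<in>B_V S V. V_norm S V (A f) \<le> ereal B * V_norm S V f)"

definition in_resolvent_set ::
    "'a measure \<Rightarrow> ('a \<Rightarrow> real) \<Rightarrow> (('a \<Rightarrow> complex) \<Rightarrow> 'a \<Rightarrow> complex) \<Rightarrow> complex \<Rightarrow> bool" where
  "in_resolvent_set S V T z \<longleftrightarrow>
     (\<exists>A. bounded_operator S V A \<and>
        (\<forall>f\<in>B_V S V. \<forall>x\<in>space S.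
           z * A f x - T (A f) x = f x \<and> A (\<lambda>y. z * f y - T f y) x = f x))"

definition spectral_radius ::
    "'a measure \<Rightarrow> ('a \<Rightarrow> real) \<Rightarrow> (('a \<Rightarrow> complex) \<Rightarrow> 'a \<Rightarrow> complex) \<Rightarrow> ereal" where
  "spectral_radius S V T = (SUP z\<in>{z. \<not> in_resolvent_set S V T z}. ereal (cmod z))"

definition rho_V ::
    "'a measure \<Rightarrow> ('a \<Rightarrow> 'a measure) \<Rightarrow> 'a measure \<Rightarrow> ('a \<Rightarrow> real) \<Rightarrow> ereal" where
  "rho_V S P \<mu> V = spectral_radius S V (\<lambda>g x. kernel_op P g x - (\<integral>y. g y \<partial>\<mu>))"

text \<open>\<open>M_V(r)\<close> is \<open>\<infinity>\<close> if no constant is admissible.\<close>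

definition M_V ::
    "'a measure \<Rightarrow> ('a \<Rightarrow> 'a measure) \<Rightarrow> 'a measure \<Rightarrow> ('a \<Rightarrow> real) \<Rightarrow> real \<Rightarrow> ereal" where
  "M_V S P \<mu> V r = Inf {ereal M | M::real.
     \<forall>g\<in>B_V S V. \<forall>n\<ge>1.
       V_norm S V (\<lambda>x. (kernel_op P ^^ n) g x - (\<integral>y. g y \<partial>\<mu>))
         \<le> ereal (M * r powi (- int n)) * V_norm S V g}"

definition geometrically_ergodic ::
    "'a measure \<Rightarrow> ('a \<Rightarrow> 'a measure) \<Rightarrow> 'a measure \<Rightarrow> ('a \<Rightarrow> real) \<Rightarrow> bool" where
  "geometrically_ergodic S P \<mu> V \<longleftrightarrow>
     (\<exists>rho M::real. 0 \<le> rho \<and> rho < 1 \<and>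
       (\<forall>g\<in>B_V S V. \<forall>n\<ge>1.
          V_norm S V (\<lambda>x. (kernel_op P ^^ n) g x - (\<integral>y. g y \<partial>\<mu>))
            \<le> ereal (M * rho ^ n) * V_norm S V g))"


section \<open>The pairs \<open>(r\<^sub>0, K\<^sub>0)\<close>\<close>

definition R_par :: "real \<Rightarrow> real" where
  "R_par lam = 1 / lam"

definition L_par :: "real \<Rightarrow> real \<Rightarrow> real" where
  "L_par lam K = K / lam"

definition N_par :: "real \<Rightarrow> real \<Rightarrow> real" where
  "N_par lam K = (L_par lam K - 1) / (R_par lam - 1)"

definition D_fun :: "real \<Rightarrow> real \<Rightarrow> real" where
  "D_fun b a =
     (let w = 1 - exp (\<i> * complex_of_real (pi / (1 + a)))
      in (cmod (1 + complex_of_real (b / (1 - b)) * w) - 1) / cmod w)"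

definition kappa :: "real \<Rightarrow> real \<Rightarrow> real \<Rightarrow> real \<Rightarrow> real" where
  "kappa b lam K a = ln ((N_par lam K - 1) / ((1 - b) * a)) / ln (R_par lam)"

definition alpha0 :: "real \<Rightarrow> real \<Rightarrow> real \<Rightarrow> real" where
  "alpha0 b lam K =
     ln ((L_par lam K - b * R_par lam) / ((1 - b) * R_par lam)) / ln (R_par lam)"

text \<open>The argument \<open>p\<close> stands for \<open>\<pi>(C)\<close>.\<close>

definition alpha_atom :: "real \<Rightarrow> real \<Rightarrow> real" where
  "alpha_atom b p = (1 / p - 1) / (1 - b)"

definition r0_atom :: "real \<Rightarrow> real \<Rightarrow> real \<Rightarrow> real \<Rightarrow> real" where
  "r0_atom b lam K p =
     (let a = alpha_atom b p
      in min (R_par lam) ((1 + D_fun b a / a) powr (1 / kappa b lam K a)))"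

definition K0_atom :: "real \<Rightarrow> real \<Rightarrow> real \<Rightarrow> real \<Rightarrow> real \<Rightarrow> real" where
  "K0_atom b lam K p r =
     (let a = alpha_atom b p; k = kappa b lam K a
      in p * (r powr k - 1) / ((r - 1) * (D_fun b a / a - r powr k + 1)))"

text \<open>
  The minimum and maximum over \<open>1 \<le> \<alpha> \<le> \<alpha>\<^sub>0\<close> are written as \<open>INF\<close> and \<open>SUP\<close>; they are
  attained, being those of continuous functions on a compact interval when \<open>1 < r < r\<^sub>0\<close>
  and \<open>\<alpha>\<^sub>0 \<ge> 1\<close> (one then has \<open>\<kappa>(\<alpha>) \<ge> 1\<close> throughout).
\<close>

definition r0_free :: "real \<Rightarrow> real \<Rightarrow> real \<Rightarrow> real" where
  "r0_free b lam K =
     min (R_par lam)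
       (INF a\<in>{1..alpha0 b lam K}. (1 + D_fun b a / a) powr (1 / kappa b lam K a))"

definition K0_free :: "real \<Rightarrow> real \<Rightarrow> real \<Rightarrow> real \<Rightarrow> real" where
  "K0_free b lam K r =
     (SUP a\<in>{1..alpha0 b lam K}.
        (r powr kappa b lam K a - 1) /
        ((r - 1) * (D_fun b a / a - r powr kappa b lam K a + 1)))"

definition M_bound :: "real \<Rightarrow> real \<Rightarrow> real \<Rightarrow> real \<Rightarrow> real" where
  "M_bound lam K K0 r =
     r * lam / (1 - r * lam)
     + r * lam * (K - lam) / (1 - lam)\<^sup>2
     + r * lam * (K - 1) / ((1 - lam) * (1 - r * lam))
     + r * (K - r * lam) / (1 - r * lam) * K0"

end

theory Submission
  imports Defs "HOL-Complex_Analysis.Complex_Analysis"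
begin

text \<open>
  The chain regenerates whenever it visits the atom \<open>C\<close>, so everything splits into what happens
  between visits, which the drift condition controls, and the times of the visits, which form a
  renewal process.

  \<^bold>\<open>Excursions.\<close> Let \<open>Q\<close> be the taboo operator, which is \<open>P\<close> off \<open>C\<close> and \<open>0\<close> on \<open>C\<close>. The drift
  condition says \<open>Q V \<le> \<lambda> (V - 1\<^sub>C)\<close>. Iterating and telescoping this single inequality bounds all
  generating functions of excursions up to the radius \<open>R = 1/\<lambda>\<close>: for the hitting time of \<open>C\<close>
  (\<open>hit_gen_partial\<close>), and for \<open>\<Sum> r\<^sup>n \<nu>(Q\<^sup>n V)\<close> (\<open>taboo_V_nu_gen\<close>). Cutting a path at its first and at
  its last visit to \<open>C\<close> (\<open>first_entrance\<close>, \<open>kernel_nu_eq\<close>) writes \<open>P\<^sup>n g\<close> as a double convolution of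
  excursion terms with the renewal sequence \<open>u\<close> of the return law, and stationarity gives
  \<open>\<pi>(g) = \<pi>(C) \<Sum> \<nu>(Q\<^sup>j g)\<close> (\<open>pi_sums\<close>). Hence a bound \<open>|u\<^sub>n - \<pi>(C)| r\<^sup>n \<le> K\<^sub>0\<close> for all \<open>n\<close> is all that
  \<open>kernel_rate\<close> needs to bound \<open>P\<^sup>n g - \<pi>(g)\<close>, and the resolvent is then a Neumann series
  (\<open>resolvent\<close>).

  \<^bold>\<open>Renewal theory.\<close> Let \<open>c\<^sub>n\<close> be the probability that a return takes more than \<open>n\<close> steps and \<open>c(z)\<close> its
  generating function. Then \<open>c(1) = 1/\<pi>(C)\<close>, and the deviations \<open>u\<^sub>n - 1/c(1)\<close> are the Taylor
  coefficients of \<open>e(z) / (c(1) c(z))\<close>, where \<open>e\<close> has the tails of \<open>c\<close> as coefficients. By Cauchy's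
  estimate it remains to keep \<open>c\<close> away from \<open>0\<close> on the disc of radius \<open>r\<close>. On the unit circle this
  is a geometric fact (\<open>circle_bound\<close>): among all laws on the positive integers with given mean
  \<open>1 + \<alpha>\<close>, the characteristic function at an angle \<open>t\<close> cannot come close to \<open>1 + s (1 - e\<^sup>i\<^sup>t)\<close>,
  where \<open>s = b/(1 - b)\<close>; for
  large \<open>t\<close> because that number has modulus larger than \<open>1\<close>, for small \<open>t\<close> because the mean is too small for
  much mass to have gone once around the circle. The two regimes meet at \<open>t = \<pi>/(1 + \<alpha>)\<close>, which
  is where \<open>D(\<alpha>)\<close> comes from. Between radius \<open>1\<close> and \<open>r\<close>, \<open>c\<close> moves by at most \<open>c(r) - c(1)\<close>, and
  log-convexity of \<open>c(r) - 1\<close> in \<open>log r\<close> between \<open>1\<close> and \<open>R\<close> (\<open>interpolation\<close>) bounds this by the term with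
  exponent \<open>\<kappa>(\<alpha>)\<close>.

  \<^bold>\<open>Without the value of \<open>\<pi>(C)\<close>.\<close> Jensen's inequality gives \<open>\<alpha> \<le> \<alpha>\<^sub>0\<close>. If \<open>\<alpha> \<ge> 1\<close>, the true \<open>\<alpha>\<close>
  is among the values over which minimum and maximum are taken. If \<open>\<alpha> < 1\<close>, the extremal value
  \<open>\<alpha> = 1\<close> still gives a valid bound, but for a different reason: then \<open>c(z) - 1\<close> is so small that \<open>1/c\<close> can
  be expanded around \<open>1\<close> (\<open>renewal_rate_perturbative\<close>).
\<close>

section \<open>Characteristic functions of laws with given mean\<close>

lemma cmod_one_minus_cis:
  assumes "0 \<le> t" "t \<le> 2 * pi"
  shows "cmod (1 - cis t) = 2 * sin (t/2)"
proof -
  have "(cmod (1 - cis t))\<^sup>2 = (1 - cos t)\<^sup>2 + (sin t)\<^sup>2"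
    by (simp add: cmod_power2)
  also have "\<dots> = 2 * (1 - cos t)"
    using sin_cos_squared_add[of t] by (simp add: power2_eq_square algebra_simps)
  also have "\<dots> = (2 * sin (t/2))\<^sup>2"
    using cos_double_sin[of "t/2"] by (simp add: power_mult_distrib)
  finally show ?thesis
    using assms by (subst (asm) power2_eq_iff_nonneg) (auto intro!: sin_ge_zero)
qed

lemma cmod_one_plus_smult_one_minus_cis:
  "cmod (1 + of_real s * (1 - cis t)) = sqrt (1 + s * (1 + s) * (2 * sin (t/2))\<^sup>2)"
proof -
  have "(2 * sin (t/2))\<^sup>2 = 2 * (1 - cos t)"
    using cos_double_sin[of "t/2"] by (simp add: power_mult_distrib)
  moreover have "(1 + s * (1 - cos t))\<^sup>2 + (s * sin t)\<^sup>2 = 1 + s * (1 + s) * (2 * (1 - cos t))"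
    using sin_cos_squared_add[of t] by algebra
  ultimately show ?thesis by (simp add: cmod_def)
qed

text \<open>
  Multiplying numerator and denominator by the conjugate gives
  \<open>s / (sqrt (1 / t\<^sup>2 + s) + 1 / t)\<close>, whose denominator decreases in \<open>t\<close>. With \<open>t\<close> the length of the chord
  \<open>1 - cis \<theta>\<close> this makes the bound at one angle valid at all larger ones, and makes \<open>D_fun\<close>
  monotone.
\<close>

lemma circle_quotient_mono:
  fixes s t t' :: real
  assumes s: "0 \<le> s" and t: "0 < t" "t \<le> t'"
  shows "(sqrt (1 + s * t\<^sup>2) - 1) / t \<le> (sqrt (1 + s * t'\<^sup>2) - 1) / t'"
proof -
  have eq: "(sqrt (1 + s * u\<^sup>2) - 1) / u = s / (sqrt (1 / u\<^sup>2 + s) + 1 / u)" if u: "0 < u" for u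
  proof -
    have "sqrt (1 / u\<^sup>2 + s) = sqrt (1 + s * u\<^sup>2) / u"
    proof -
      have "1 / u\<^sup>2 + s = (1 + s * u\<^sup>2) / u\<^sup>2" using u by (simp add: add_divide_distrib)
      then show ?thesis using u by (simp add: real_sqrt_divide)
    qed
    moreover have "(sqrt (1 + s * u\<^sup>2) - 1) * (sqrt (1 + s * u\<^sup>2) + 1) = s * u\<^sup>2"
      using s by (simp add: algebra_simps)
    moreover have "sqrt (1 + s * u\<^sup>2) + 1 > 0"
      using s by (simp add: add_nonneg_pos)
    ultimately show ?thesis using u
      by (simp add: field_simps power2_eq_square)
  qed
  have "sqrt (1 / t'\<^sup>2 + s) + 1 / t' \<le> sqrt (1 / t\<^sup>2 + s) + 1 / t"
    using t by (intro add_mono real_sqrt_le_mono divide_left_mono power_mono) auto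
  moreover have "0 < sqrt (1 / t'\<^sup>2 + s) + 1 / t'"
    using t s by (intro add_nonneg_pos) auto
  ultimately show ?thesis
    using eq t s by (simp add: divide_left_mono frac_le)
qed

lemma D_fun_eq:
  assumes "0 \<le> a"
  shows "D_fun b a = (let s = b / (1 - b); t = 2 * sin (pi / (1 + a) / 2)
                      in (sqrt (1 + s * (1 + s) * t\<^sup>2) - 1) / t)"
proof -
  have "0 \<le> pi / (1 + a)" "pi / (1 + a) \<le> 2 * pi"
    using assms by (auto simp: divide_le_eq)
  then show ?thesis
    unfolding D_fun_def Let_def cis_conv_exp[symmetric]
    by (simp only: cmod_one_minus_cis cmod_one_plus_smult_one_minus_cis)
qed

lemma angle_over_sin_mono:
  fixes x y :: real
  assumes "0 < x" "x \<le> y" "y < pi"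
  shows "x / sin x \<le> y / sin y"
proof (rule DERIV_nonneg_imp_nondecreasing[OF assms(2)])
  fix u assume u: "x \<le> u" "u \<le> y"
  have up: "0 < u" "u < pi" using u assms by auto
  have "sin 0 - 0 * cos 0 \<le> sin u - u * cos u"
  proof (rule DERIV_nonneg_imp_nondecreasing[of 0 u "\<lambda>u. sin u - u * cos u"])
    fix v assume "0 \<le> v" "v \<le> u"
    then have "0 \<le> v * sin v" using up by (intro mult_nonneg_nonneg sin_ge_zero) auto
    moreover have "((\<lambda>v. sin v - v * cos v) has_real_derivative v * sin v) (at v)"
      by (auto intro!: derivative_eq_intros)
    ultimately show "\<exists>d. ((\<lambda>v. sin v - v * cos v) has_real_derivative d) (at v) \<and> 0 \<le> d" by blast
  qed (use up in auto)
  moreover have "((\<lambda>v. v / sin v) has_real_derivative (sin u - u * cos u) / (sin u * sin u)) (at u)"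
    using sin_gt_zero[OF up] by (auto intro!: derivative_eq_intros)
  ultimately show "\<exists>d. ((\<lambda>v. v / sin v) has_real_derivative d) (at u) \<and> 0 \<le> d"
    by (intro exI[of _ "(sin u - u * cos u) / (sin u * sin u)"] conjI divide_nonneg_nonneg) auto
qed

text \<open>
  Up to \<open>2 * pi - d\<close> the cosine stays below \<open>cos d\<close>, and from there on the line is below zero. Being
  linear in \<open>v\<close>, the lower bound can be averaged over any random \<open>v \<ge> d\<close> of known mean.
\<close>

lemma one_minus_cos_above_line:
  fixes d v :: real
  assumes d: "0 \<le> d" "d < pi" and v: "d \<le> v"
  shows "(1 - cos d) * (1 - (v - d) / (2 * pi - 2 * d)) \<le> 1 - cos v"
proof (cases "v \<le> 2 * pi - d")
  case True
  have "cos v \<le> cos d"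
  proof (cases "v \<le> pi")
    case True then show ?thesis using d v by (intro cos_monotone_0_pi_le) auto
  next
    case False
    then have "cos (2 * pi - v) \<le> cos d" using d v True by (intro cos_monotone_0_pi_le) auto
    then show ?thesis by (simp add: cos_diff)
  qed
  moreover have "(1 - cos d) * (1 - (v - d) / (2 * pi - 2 * d)) \<le> (1 - cos d) * 1"
    using d v by (intro mult_left_mono) auto
  ultimately show ?thesis by simp
next
  case False
  then have "1 - (v - d) / (2 * pi - 2 * d) \<le> 0" using d by (simp add: field_simps)
  then have "(1 - cos d) * (1 - (v - d) / (2 * pi - 2 * d)) \<le> 0"
    by (intro mult_nonneg_nonpos) auto
  then show ?thesis using cos_le_one[of v] by linarith
qed

text \<open>
  The distance is bounded below by a real part after a rotation by \<open>y - t/2\<close>, where \<open>y\<close> is chosen as the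
  optimal direction at the limiting angle \<open>t\<^sub>0 = pi / (1 + a)\<close>. The rotated terms of the series
  have phases \<open>d + (n - 1) t\<close> with \<open>d = y + t/2\<close>, and since \<open>p 0 = 0\<close> no phase lies below \<open>d\<close>; so
  \<open>one_minus_cos_above_line\<close> and the mean of \<open>p\<close> control them. What remains is to compare the angles
  \<open>t\<close> and \<open>t\<^sub>0\<close>, and every factor involved is monotone in the angle.
\<close>

lemma circle_bound_small_angle:
  fixes p :: "nat \<Rightarrow> real" and s a t :: real
  assumes p0: "p 0 = 0" and p: "\<And>n. 0 \<le> p n" and p1: "p sums 1"
    and pm: "(\<lambda>n. real n * p n) sums (1 + a)"
    and a: "0 < a" and s: "0 < s" and t: "0 < t" "t \<le> pi / (1 + a)"
  defines "t0 \<equiv> pi / (1 + a)"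
  shows "(sqrt (1 + s * (1 + s) * (2 * sin (t0/2))\<^sup>2) - 1) / (2 * sin (t0/2)) * (2 * sin (t/2))
    \<le> cmod (1 + of_real s * (1 - cis t) - (\<Sum>n. of_real (p n) * cis t ^ n))"
proof -
  define Q where "Q = sqrt (1 + s * (1 + s) * (2 * sin (t0/2))\<^sup>2)"
  have t0: "0 < t0" "t0 < pi" "t \<le> t0" using a t by (auto simp: t0_def field_simps)
  have sin0: "0 < sin (t0/2)" "0 < cos (t0/2)" using t0 by (auto intro!: sin_gt_zero cos_gt_zero)
  have sint: "0 < sin (t/2)" using t0 t by (auto intro!: sin_gt_zero)
  have Q0: "0 < Q" unfolding Q_def using s by (intro real_sqrt_gt_zero add_pos_nonneg) auto
  have "Q\<^sup>2 = 1 + s * (1 + s) * (2 * sin (t0/2))\<^sup>2"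
    unfolding Q_def using s by (intro real_sqrt_pow2) auto
  also have "\<dots> = (cos (t0/2))\<^sup>2 + ((2 * s + 1) * sin (t0/2))\<^sup>2"
    using sin_cos_squared_add[of "t0/2"] by algebra
  finally have "(cos (t0/2))\<^sup>2 + ((2 * s + 1) * sin (t0/2))\<^sup>2 = Q\<^sup>2" ..
  then have "(cos (t0/2) / Q)\<^sup>2 + ((2 * s + 1) * sin (t0/2) / Q)\<^sup>2 = 1"
    using Q0 by (simp only: power_divide add_divide_distrib[symmetric]) simp
  with sincos_total_pi_half[of "cos (t0/2) / Q" "(2 * s + 1) * sin (t0/2) / Q"] sin0 Q0 s
  obtain y where y: "0 \<le> y" "y \<le> pi/2" and cy: "cos (t0/2) / Q = cos y"
    and sy: "(2 * s + 1) * sin (t0/2) / Q = sin y" by (auto simp: less_imp_le)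
  have cy0: "0 < cos y" using cy sin0 Q0 by (metis divide_pos_pos)
  with y have y2: "y < pi/2" by (metis cos_pi_half less_irrefl order_le_less)
  have sy0: "0 < sin y" using sy sin0 Q0 s by (metis divide_pos_pos mult_pos_pos add_pos_pos
    mult_2 zero_less_one)
  \<comment> \<open>At the limiting angle the number rotated by \<open>y - t0/2\<close> is real and equals its modulus \<open>Q\<close>.\<close>
  have Qy: "Q = cos (y - t0/2) + s * (2 * sin (t0/2)) * sin y"
  proof -
    have "cos (t0/2) = Q * cos y" "(2 * s + 1) * sin (t0/2) = Q * sin y"
      using cy sy Q0 by (auto simp: field_simps)
    then have "cos (y - t0/2) + s * (2 * sin (t0/2)) * sin y = Q * ((cos y)\<^sup>2 + (sin y)\<^sup>2)"
      unfolding cos_diff by algebra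
    then show ?thesis by simp
  qed
  define d where "d = y + t/2"
  have d: "0 \<le> d" "d < pi" using y y2 t0 t by (auto simp: d_def)
  define v where "v n = real n * t + y - t/2" for n
  define k where "k = t / (2 * pi - 2 * d)"
  have summ: "summable (\<lambda>n. of_real (p n) * cis t ^ n)"
    by (rule summable_norm_cancel) (use p p1 in \<open>simp add: norm_mult norm_power sums_iff\<close>)
  have sc: "(\<lambda>n. p n * cos (v n)) sums Re (cis (y - t/2) * (\<Sum>n. of_real (p n) * cis t ^ n))"
  proof -
    have "Re (cis (y - t/2) * (of_real (p n) * cis t ^ n)) = p n * cos (v n)" for n
    proof -
      have "cis (y - t/2) * (of_real (p n) * cis t ^ n) = of_real (p n) * cis (v n)"
        by (simp add: Complex.DeMoivre cis_mult v_def algebra_simps)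
      then show ?thesis by (simp only:) simp
    qed
    then show ?thesis
      using sums_Re[OF sums_mult[OF summable_sums[OF summ], of "cis (y - t/2)"]] by simp
  qed
  have line: "p n * ((1 - cos d) * (1 + k) - (1 - cos d) * k * real n) \<le> p n - p n * cos (v n)" for n
  proof (cases n)
    case 0 then show ?thesis using p0 by simp
  next
    case (Suc m)
    have vd: "v n - d = real m * t" by (simp add: v_def d_def Suc algebra_simps)
    then have "d \<le> v n" using t by (metis diff_ge_0_iff_ge mult_nonneg_nonneg of_nat_0_le_iff less_imp_le)
    from one_minus_cos_above_line[OF d this]
    have "(1 - cos d) * (1 - real m * k) \<le> 1 - cos (v n)" unfolding vd by (simp add: k_def)
    then have "p n * ((1 - cos d) * (1 - real m * k)) \<le> p n * (1 - cos (v n))"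
      using p by (intro mult_left_mono) auto
    then show ?thesis by (simp add: Suc algebra_simps)
  qed
  have "(1 - cos d) * (1 + k) - (1 - cos d) * k * (1 + a)
      \<le> 1 - Re (cis (y - t/2) * (\<Sum>n. of_real (p n) * cis t ^ n))"
  proof (rule sums_le[OF line])
    show "(\<lambda>n. p n * ((1 - cos d) * (1 + k) - (1 - cos d) * k * real n)) sums
            ((1 - cos d) * (1 + k) - (1 - cos d) * k * (1 + a))"
      using sums_diff[OF sums_mult2[OF p1, of "(1 - cos d) * (1 + k)"]
          sums_mult[OF pm, of "(1 - cos d) * k"]] by (simp add: algebra_simps)
    show "(\<lambda>n. p n - p n * cos (v n)) sums (1 - Re (cis (y - t/2) * (\<Sum>n. of_real (p n) * cis t ^ n)))"
      by (intro sums_diff p1 sc)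
  qed
  then have key: "Re (cis (y - t/2) * (\<Sum>n. of_real (p n) * cis t ^ n))
       \<le> cos d + (1 - cos d) * (k * a)" by (simp add: algebra_simps)
  \<comment> \<open>Here \<open>t \<le> t0\<close> enters; note that \<open>y < pi/2\<close> gives \<open>pi - t0 \<le> 2 * pi - 2 * d\<close>.\<close>
  have ka: "(1 - cos d) * (k * a) \<le> (1 - cos (y + t0/2)) / (2 * sin (t0/2)) * (2 * sin (t/2))"
  proof -
    have "t0 * (1 + a) = pi" using a by (simp add: t0_def)
    then have a_eq: "a = (pi - t0) / t0" using t0 by (simp add: field_simps)
    have 1: "1 - cos d \<le> 1 - cos (y + t0/2)"
      unfolding d_def using y y2 t t0 by (auto intro!: cos_monotone_0_pi_le)
    have 2: "t \<le> t0 / sin (t0/2) * sin (t/2)"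
      using angle_over_sin_mono[of "t/2" "t0/2"] t t0 sint sin0 by (simp add: field_simps)
    have 3: "pi - t0 \<le> 2 * pi - 2 * d" using y2 t0 by (simp add: d_def)
    have "k * a = t / t0 * ((pi - t0) / (2 * pi - 2 * d))" by (simp add: k_def a_eq)
    also have "\<dots> \<le> t / t0 * 1" using 3 t0 t d by (intro mult_left_mono) auto
    also have "\<dots> \<le> sin (t/2) / sin (t0/2)" using 2 t0 by (simp add: field_simps)
    finally have "k * a \<le> sin (t/2) / sin (t0/2)" .
    moreover have "0 \<le> k * a" using d a t by (simp add: k_def)
    ultimately have "(1 - cos d) * (k * a) \<le> (1 - cos (y + t0/2)) * (sin (t/2) / sin (t0/2))"
      using 1 by (intro mult_mono) auto
    then show ?thesis by simp
  qed
  have "(Q - 1) / (2 * sin (t0/2)) * (2 * sin (t/2))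
     = (s * sin y + sin y - (1 - cos (y + t0/2)) / (2 * sin (t0/2))) * (2 * sin (t/2))"
  proof -
    have "Q - 1 = (s * sin y + sin y) * (2 * sin (t0/2)) - (1 - cos (y + t0/2))"
      unfolding Qy cos_diff cos_add by (simp add: algebra_simps)
    then have "(Q - 1) / (2 * sin (t0/2)) = s * sin y + sin y - (1 - cos (y + t0/2)) / (2 * sin (t0/2))"
      using sin0 by (simp only: diff_divide_distrib) simp
    then show ?thesis by simp
  qed
  also have "\<dots> \<le> (s + 1) * sin y * (2 * sin (t/2)) - (1 - cos d) * (k * a)"
    using ka by (simp add: algebra_simps)
  also have "\<dots> = Re (cis (y - t/2) * (1 + of_real s * (1 - cis t))) - cos d - (1 - cos d) * (k * a)"
  proof -
    have "cis (y - t/2) * cis t = cis d" by (simp add: cis_mult d_def add.commute)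
    then have e: "cis (y - t/2) * (1 + of_real s * (1 - cis t))
        = cis (y - t/2) + of_real s * (cis (y - t/2) - cis d)" by (simp add: algebra_simps)
    have "Re (cis (y - t/2) * (1 + of_real s * (1 - cis t)))
        = cos (y - t/2) + s * (cos (y - t/2) - cos d)"
      by (simp only: e) (simp add: algebra_simps)
    moreover have "cos (y - t/2) - cos d = 2 * sin (t/2) * sin y"
      unfolding d_def cos_diff cos_add by simp
    ultimately show ?thesis by (simp add: algebra_simps)
  qed
  also have "\<dots> \<le> Re (cis (y - t/2) * (1 + of_real s * (1 - cis t)))
       - Re (cis (y - t/2) * (\<Sum>n. of_real (p n) * cis t ^ n))"
    using key by simp
  also have "\<dots> = Re (cis (y - t/2) * (1 + of_real s * (1 - cis t) - (\<Sum>n. of_real (p n) * cis t ^ n)))"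
    by (simp add: algebra_simps)
  also have "\<dots> \<le> cmod (cis (y - t/2) * (1 + of_real s * (1 - cis t) - (\<Sum>n. of_real (p n) * cis t ^ n)))"
    by (rule complex_Re_le_cmod)
  also have "\<dots> = cmod (1 + of_real s * (1 - cis t) - (\<Sum>n. of_real (p n) * cis t ^ n))"
    by (simp add: norm_mult)
  finally show ?thesis by (simp add: Q_def)
qed

text \<open>
  Beyond the angle \<open>pi / (1 + a)\<close> the triangle inequality suffices, as the series has modulus at most
  \<open>1\<close>; \<open>D_fun\<close> is the bound it gives at that angle.
\<close>

lemma circle_bound:
  fixes p :: "nat \<Rightarrow> real" and b a t :: real
  assumes p0: "p 0 = 0" and p: "\<And>n. 0 \<le> p n" and p1: "p sums 1"
    and pm: "(\<lambda>n. real n * p n) sums (1 + a)"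
    and a: "0 < a" and b: "0 < b" "b < 1" and t: "0 < t" "t \<le> pi"
  shows "D_fun b a * cmod (1 - cis t)
    \<le> cmod (1 + of_real (b / (1 - b)) * (1 - cis t) - (\<Sum>n. of_real (p n) * cis t ^ n))"
proof -
  define s where "s = b / (1 - b)"
  define t0 where "t0 = pi / (1 + a)"
  have s: "0 < s" using b by (simp add: s_def)
  have t0: "0 < t0" "t0 < pi" using a by (auto simp: t0_def field_simps)
  have w: "cmod (1 - cis t) = 2 * sin (t/2)" using t by (intro cmod_one_minus_cis) auto
  have D: "D_fun b a = (sqrt (1 + s * (1 + s) * (2 * sin (t0/2))\<^sup>2) - 1) / (2 * sin (t0/2))"
    using a by (simp add: D_fun_eq Let_def s_def t0_def)
  have "D_fun b a * (2 * sin (t/2))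
    \<le> cmod (1 + of_real s * (1 - cis t) - (\<Sum>n. of_real (p n) * cis t ^ n))"
  proof (cases "t \<le> t0")
    case True
    then show ?thesis
      using circle_bound_small_angle[OF p0 p p1 pm a s t(1)] unfolding D by (simp add: t0_def)
  next
    case False
    have pos: "0 < sin (t0/2)" "0 < sin (t/2)" using t t0 by (auto intro!: sin_gt_zero)
    have mono: "sin (t0/2) \<le> sin (t/2)" using t t0 False by (intro sin_monotone_2pi_le) auto
    have "D_fun b a \<le> (sqrt (1 + s * (1 + s) * (2 * sin (t/2))\<^sup>2) - 1) / (2 * sin (t/2))"
      unfolding D using pos mono s by (intro circle_quotient_mono) auto
    then have "D_fun b a * (2 * sin (t/2)) \<le> sqrt (1 + s * (1 + s) * (2 * sin (t/2))\<^sup>2) - 1"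
      using pos by (simp add: pos_le_divide_eq)
    also have "\<dots> = cmod (1 + of_real s * (1 - cis t)) - 1"
      by (simp only: cmod_one_plus_smult_one_minus_cis)
    also have "\<dots> \<le> cmod (1 + of_real s * (1 - cis t)) - cmod (\<Sum>n. of_real (p n) * cis t ^ n)"
    proof -
      have "cmod (\<Sum>n. of_real (p n) * cis t ^ n) \<le> (\<Sum>n. p n)"
        using p p1 by (intro norm_suminf_le) (auto simp: norm_mult norm_power sums_iff)
      then show ?thesis using p1 by (simp add: sums_iff)
    qed
    also have "\<dots> \<le> cmod (1 + of_real s * (1 - cis t) - (\<Sum>n. of_real (p n) * cis t ^ n))"
      by (rule norm_triangle_ineq2)
    finally show ?thesis .
  qed
  then show ?thesis by (simp only: w s_def)
qed

lemma D_fun_le: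
  assumes "0 < b" "b < 1"
  shows "D_fun b a \<le> b / (1 - b)"
proof -
  define w where "w = 1 - exp (\<i> * complex_of_real (pi / (1 + a)))"
  have "cmod (1 + complex_of_real (b / (1 - b)) * w) \<le> 1 + b / (1 - b) * cmod w"
    using norm_triangle_ineq[of 1 "complex_of_real (b / (1 - b)) * w"] assms
    by (simp only: norm_mult norm_of_real) simp
  then show ?thesis
    unfolding D_fun_def Let_def w_def[symmetric] using assms
    by (cases "w = 0") (auto simp: pos_divide_le_eq)
qed

lemma D_fun_pos:
  assumes "0 \<le> a" "0 < b" "b < 1"
  shows "0 < D_fun b a"
proof -
  have "0 < pi / (1 + a) / 2" "pi / (1 + a) / 2 < pi"
    using assms by (auto simp: field_simps intro: add_pos_nonneg)
  then have t: "0 < 2 * sin (pi / (1 + a) / 2)" by (simp only: sin_gt_zero zero_less_mult_iff) simp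
  have "0 < b / (1 - b)" using assms by simp
  then have "0 < b / (1 - b) * (1 + b / (1 - b)) * (2 * sin (pi / (1 + a) / 2))\<^sup>2"
    using t by (intro mult_pos_pos zero_less_power add_pos_pos) auto
  then show ?thesis unfolding D_fun_eq[OF assms(1)] Let_def using t
    by (intro divide_pos_pos) auto
qed

lemma D_fun_antimono:
  assumes "0 \<le> a" "a \<le> a'" "0 < b" "b < 1"
  shows "D_fun b a' \<le> D_fun b a"
proof -
  define x where "x = pi / (1 + a)"
  define y where "y = pi / (1 + a')"
  have le: "y \<le> x" "x \<le> pi" "0 < y"
    using assms by (auto simp: x_def y_def field_simps intro!: mult_left_mono)
  have "0 < sin (y / 2)" using le by (intro sin_gt_zero) auto
  moreover have "sin (y / 2) \<le> sin (x / 2)"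
    using le by (intro sin_monotone_2pi_le) auto
  ultimately show ?thesis using assms
    unfolding D_fun_eq[OF assms(1)] D_fun_eq[OF order_trans[OF assms(1,2)]] Let_def
      x_def[symmetric] y_def[symmetric]
    by (intro circle_quotient_mono) auto
qed

section \<open>Tails of nonnegative series\<close>

definition tail :: "(nat \<Rightarrow> real) \<Rightarrow> nat \<Rightarrow> real" where
  "tail f n = (\<Sum>k. f (k + Suc n))"

lemma tail_rec: "summable f \<Longrightarrow> tail f n = f (Suc n) + tail f (Suc n)"
  unfolding tail_def using suminf_split_head[of "\<lambda>k. f (k + Suc n)"]
  by (simp add: summable_iff_shift[of f "Suc n", simplified])

lemma tail_0: "summable f \<Longrightarrow> suminf f = f 0 + tail f 0"
  unfolding tail_def using suminf_split_head[of f] by simp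

lemma tail_nonneg: "summable f \<Longrightarrow> (\<And>n. 0 \<le> f n) \<Longrightarrow> 0 \<le> tail f n"
  unfolding tail_def by (intro suminf_nonneg summable_ignore_initial_segment)

text \<open>
  Summation by parts. It is used twice: for the waiting-time law, whose tails are the survival
  probabilities, and for the survival probabilities themselves.
\<close>

lemma tail_partial_sum:
  fixes z :: "'a::real_normed_field"
  assumes "summable f"
  shows "(z - 1) * (\<Sum>k<n. of_real (tail f k) * z ^ k)
    = (\<Sum>k\<le>n. of_real (f k) * z ^ k) - of_real (suminf f) + of_real (tail f n) * z ^ n"
proof (induction n)
  case 0 then show ?case using tail_0[OF assms] by simp
next
  case (Suc n)
  have "of_real (tail f n) = (of_real (f (Suc n)) + of_real (tail f (Suc n)) :: 'a)"
    by (metis assms of_real_add tail_rec)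
  then show ?case using Suc.IH by (simp add: algebra_simps)
qed

lemma tail_power_le:
  assumes f: "\<And>n. 0 \<le> f n" and r: "1 \<le> r" and s: "summable (\<lambda>n. f n * r ^ n)"
  shows "tail f n * r ^ n \<le> tail (\<lambda>n. f n * r ^ n) n"
    and "summable f"
proof -
  show sf: "summable f"
  proof (rule summable_comparison_test'[OF s, of 0])
    fix n show "norm (f n) \<le> f n * r ^ n"
      using mult_left_mono[OF one_le_power[OF r, of n] f[of n]] f[of n] by simp
  qed
  have "tail f n * r ^ n = (\<Sum>k. f (k + Suc n) * r ^ n)"
    unfolding tail_def by (intro suminf_mult2 summable_ignore_initial_segment sf)
  also have "\<dots> \<le> (\<Sum>k. f (k + Suc n) * r ^ (k + Suc n))"
    using f r by (intro suminf_le mult_left_mono power_increasing summable_mult2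
        summable_ignore_initial_segment[OF s] summable_ignore_initial_segment[OF sf]) auto
  finally show "tail f n * r ^ n \<le> tail (\<lambda>n. f n * r ^ n) n" by (simp add: tail_def)
qed

lemma tail_tendsto_0: "summable f \<Longrightarrow> tail f \<longlonglongrightarrow> 0"
proof -
  assume s: "summable f"
  have "tail f n = suminf f - (\<Sum>k\<le>n. f k)" for n
    unfolding tail_def using suminf_minus_initial_segment[OF s, of "Suc n"] by (simp add: lessThan_Suc_atMost)
  moreover have "(\<lambda>n. suminf f - (\<Sum>k\<le>n. f k)) \<longlonglongrightarrow> suminf f - suminf f"
    by (intro tendsto_diff tendsto_const summable_LIMSEQ' s)
  ultimately show ?thesis by (metis (no_types, lifting) diff_self ext)
qed

lemma tail_power_tendsto_0:
  assumes f: "\<And>n. 0 \<le> f n" and r: "1 \<le> r" and s: "summable (\<lambda>n. f n * r ^ n)"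
  shows "(\<lambda>n. tail f n * r ^ n) \<longlonglongrightarrow> 0"
  by (rule tendsto_sandwich[OF always_eventually always_eventually tendsto_const tail_tendsto_0[OF s]])
    (use tail_power_le[OF assms] tail_nonneg[OF _ f] r in auto)

text \<open>
  The partial sums are bounded because the boundary term \<open>tail f n * r ^ n\<close> is dominated by the tail of
  the convergent series of \<open>f k * r ^ k\<close>; so the tails inherit the closed disc of convergence.
\<close>

lemma tail_power_sums:
  assumes f: "\<And>n. 0 \<le> f n" and r: "1 < r" and s: "summable (\<lambda>n. f n * r ^ n)"
  shows "(\<lambda>n. tail f n * r ^ n) sums (((\<Sum>n. f n * r ^ n) - suminf f) / (r - 1))"
proof -
  have "(\<Sum>k<n. tail f k * r ^ k) = ((\<Sum>k\<le>n. f k * r ^ k) - suminf f + tail f n * r ^ n) / (r - 1)" for n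
    using tail_partial_sum[of f r n] tail_power_le(2)[of f r] assms by (simp add: field_simps)
  moreover have "(\<lambda>n. ((\<Sum>k\<le>n. f k * r ^ k) - suminf f + tail f n * r ^ n) / (r - 1))
      \<longlonglongrightarrow> ((\<Sum>n. f n * r ^ n) - suminf f + 0) / (r - 1)"
    using assms by (intro tendsto_intros summable_LIMSEQ' tail_power_tendsto_0) auto
  ultimately show ?thesis by (simp add: sums_def)
qed

lemma tail_powser:
  fixes z :: complex
  assumes f: "\<And>n. 0 \<le> f n" and r: "1 < r" and s: "summable (\<lambda>n. f n * r ^ n)" and z: "cmod z \<le> r"
  shows "summable (\<lambda>n. of_real (f n) * z ^ n)"
    and "summable (\<lambda>n. of_real (tail f n) * z ^ n)"
    and "(z - 1) * (\<Sum>n. of_real (tail f n) * z ^ n) = (\<Sum>n. of_real (f n) * z ^ n) - of_real (suminf f)"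
proof -
  have sf: "summable f" using tail_power_le(2)[of f r] assms by simp
  note tp = tail_power_sums[OF f r s]
  show 1: "summable (\<lambda>n. of_real (f n) * z ^ n)"
    by (rule summable_comparison_test'[OF s, of 0])
      (use f z in \<open>auto simp: norm_mult norm_power intro!: mult_left_mono power_mono\<close>)
  show 2: "summable (\<lambda>n. of_real (tail f n) * z ^ n)"
    by (rule summable_comparison_test'[OF sums_summable[OF tp], of 0])
      (use tail_nonneg[OF sf f] z in \<open>auto simp: norm_mult norm_power intro!: mult_left_mono power_mono\<close>)
  have "(\<lambda>n. (z - 1) * (\<Sum>k<n. of_real (tail f k) * z ^ k))
        \<longlonglongrightarrow> (\<Sum>n. of_real (f n) * z ^ n) - of_real (suminf f) + 0"
    unfolding tail_partial_sum[OF sf]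
    by (intro tendsto_intros summable_LIMSEQ' 1 summable_LIMSEQ_zero 2)
  moreover have "(\<lambda>n. (z - 1) * (\<Sum>k<n. of_real (tail f k) * z ^ k))
        \<longlonglongrightarrow> (z - 1) * (\<Sum>n. of_real (tail f n) * z ^ n)"
    by (intro tendsto_intros summable_LIMSEQ 2)
  ultimately show "(z - 1) * (\<Sum>n. of_real (tail f n) * z ^ n) = (\<Sum>n. of_real (f n) * z ^ n) - of_real (suminf f)"
    using LIMSEQ_unique by fastforce
qed

fun renewal_seq :: "(nat \<Rightarrow> real) \<Rightarrow> nat \<Rightarrow> real" where
  "renewal_seq f 0 = 1"
| "renewal_seq f (Suc n) = (\<Sum>k\<le>n. f (Suc k) * renewal_seq f (n - k))"

text \<open>
  The coefficients are embedded into an arbitrary field because the identity serves over the reals for the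
  renewal sequence itself and over the complex numbers for its convolutions with chain expectations.
\<close>

lemma renewal_seq_fps:
  fixes f :: "nat \<Rightarrow> real"
  assumes "f 0 = 0"
  shows "(1 - Abs_fps (\<lambda>n. of_real (f n))) * Abs_fps (\<lambda>n. of_real (renewal_seq f n) :: 'a::real_normed_field) = 1"
proof (rule fps_ext)
  fix n
  let ?F = "Abs_fps (\<lambda>n. of_real (f n) :: 'a)" and ?U = "Abs_fps (\<lambda>n. of_real (renewal_seq f n) :: 'a)"
  have "fps_nth (?F * ?U) n = of_real (\<Sum>i=0..n. f i * renewal_seq f (n - i))"
    by (simp add: fps_mult_nth)
  also have "(\<Sum>i=0..n. f i * renewal_seq f (n - i)) = (if n = 0 then 0 else renewal_seq f n)"
  proof (cases n)
    case (Suc m)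
    have "(\<Sum>i=0..Suc m. f i * renewal_seq f (Suc m - i)) = (\<Sum>i=0..m. f (Suc i) * renewal_seq f (m - i))"
      using assms by (subst sum.atLeast0_atMost_Suc_shift) simp
    then show ?thesis using Suc by (simp add: atMost_atLeast0)
  qed (use assms in simp)
  finally show "fps_nth ((1 - ?F) * ?U) n = fps_nth 1 n"
    by (simp add: algebra_simps)
qed

section \<open>Renewal sequences\<close>

locale renewal =
  fixes f :: "nat \<Rightarrow> real" and b R :: real
  assumes f_nonneg: "\<And>n. 0 \<le> f n" and f0: "f 0 = 0" and f_sums: "f sums 1"
    and b_pos: "0 < b" and b_less: "b < 1" and b_le: "b \<le> f 1"
    and R_gt: "1 < R" and f_R: "summable (\<lambda>n. f n * R ^ n)"
begin

text \<open>
  The probability that a waiting time exceeds \<open>n\<close>.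
\<close>

definition surv :: "nat \<Rightarrow> real" where "surv = tail f"
definition mean_wait :: real where "mean_wait = suminf surv"
definition dev :: "nat \<Rightarrow> real" where "dev n = renewal_seq f n - 1 / mean_wait"
text \<open>
  The law \<open>f\<close> is a mixture of a unit mass at \<open>1\<close> with weight \<open>b\<close> and of another law with weight \<open>1 - b\<close>;
  the mean of that second law is \<open>1 + excess\<close>. This is the parameter \<open>\<alpha>\<close> of the rate formulas.
\<close>

definition excess :: real where "excess = (mean_wait - 1) / (1 - b)"

lemma f_summable: "summable f" and f_suminf: "suminf f = 1"
  using f_sums by (auto simp: sums_iff)

lemma surv_0: "surv 0 = 1"
  using tail_0[OF f_summable] f0 f_suminf by (simp add: surv_def)

lemma surv_nonneg: "0 \<le> surv n"
  unfolding surv_def by (intro tail_nonneg f_summable f_nonneg)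

lemma surv_R_sums: "(\<lambda>n. surv n * R ^ n) sums (((\<Sum>n. f n * R ^ n) - 1) / (R - 1))"
  using tail_power_sums[OF f_nonneg R_gt f_R] by (simp add: surv_def f_suminf)

lemma summable_surv_pow: assumes "0 \<le> r" "r \<le> R" shows "summable (\<lambda>n. surv n * r ^ n)"
  by (rule summable_comparison_test'[OF sums_summable[OF surv_R_sums], of 0])
    (use assms surv_nonneg in \<open>auto intro!: mult_left_mono power_mono\<close>)

lemma surv_summable: "summable surv"
  using summable_surv_pow[of 1] R_gt by simp

lemma surv_sum_ge_1: assumes "0 \<le> r" "r \<le> R" shows "1 \<le> (\<Sum>n. surv n * r ^ n)"
  using sum_le_suminf[OF summable_surv_pow[OF assms], of "{0}"] surv_nonneg assms surv_0 by simp

lemma mean_wait_ge_1: "1 \<le> mean_wait"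
  using surv_sum_ge_1[of 1] R_gt by (simp add: mean_wait_def)

lemma excess_nonneg: "0 \<le> excess" using mean_wait_ge_1 b_less by (simp add: excess_def)

lemma mean_wait_eq: "mean_wait = 1 + (1 - b) * excess" using b_less by (simp add: excess_def)

text \<open>
  The tail-sum formula for the mean; the boundary term \<open>n * surv n\<close> vanishes because the survival
  probabilities decay geometrically.
\<close>

lemma mean_sums: "(\<lambda>n. real n * f n) sums mean_wait"
proof -
  have "(\<Sum>k<n. surv k) = (\<Sum>k\<le>n. real k * f k) + real n * surv n" for n
  proof (induction n)
    case (Suc n)
    then show ?case using tail_rec[OF f_summable, of n] by (simp add: surv_def algebra_simps)
  qed simp
  then have eq: "(\<Sum>k\<le>n. real k * f k) = (\<Sum>k<n. surv k) - (real n * (1 / R) ^ n) * (surv n * R ^ n)" for n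
    using R_gt by (simp add: power_divide)
  have "(\<lambda>n. (\<Sum>k<n. surv k) - (real n * (1 / R) ^ n) * (surv n * R ^ n)) \<longlonglongrightarrow> mean_wait - 0 * 0"
    unfolding mean_wait_def using R_gt
    by (intro tendsto_intros summable_LIMSEQ surv_summable powser_times_n_limit_0
        summable_LIMSEQ_zero[OF sums_summable[OF surv_R_sums]]) auto
  then show ?thesis unfolding sums_def_le eq[symmetric] by simp
qed

text \<open>
  In generating functions: \<open>(1 - X) C = 1 - F\<close>, \<open>(1 - X) E = c(1) - C\<close> and \<open>(1 - F) U = 1\<close> for the
  survival probabilities \<open>C\<close> and their tails \<open>E\<close>. Subtracting the limit from \<open>U\<close> cancels the pole at
  \<open>1\<close>, which leaves \<open>V C = E / c(1)\<close> for the deviations \<open>V\<close>.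
\<close>

lemma dev_convolution: "(\<Sum>i=0..n. dev i * surv (n - i)) = tail surv n / mean_wait"
proof -
  define F where "F = Abs_fps f"
  define Cc where "Cc = Abs_fps surv"
  define E where "E = Abs_fps (tail surv)"
  define U where "U = Abs_fps (renewal_seq f)"
  define V where "V = Abs_fps dev"
  define G where "G = (Abs_fps (\<lambda>_. 1) :: real fps)"
  have C: "(1 - fps_X) * Cc = 1 - F"
  proof (rule fps_ext)
    fix n show "fps_nth ((1 - fps_X) * Cc) n = fps_nth (1 - F) n"
    proof (cases n)
      case (Suc k)
      then show ?thesis using tail_rec[OF f_summable, of k]
        by (simp add: algebra_simps Cc_def F_def surv_def)
    qed (simp add: algebra_simps Cc_def F_def surv_0 f0)
  qed
  have Eq: "(1 - fps_X) * E = fps_const mean_wait - Cc"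
  proof (rule fps_ext)
    fix n show "fps_nth ((1 - fps_X) * E) n = fps_nth (fps_const mean_wait - Cc) n"
    proof (cases n)
      case (Suc k)
      then show ?thesis using tail_rec[OF surv_summable, of k]
        by (simp add: algebra_simps Cc_def E_def)
    qed (use tail_0[OF surv_summable] in \<open>simp add: algebra_simps Cc_def E_def mean_wait_def\<close>)
  qed
  have G: "(1 - fps_X) * G = 1"
    by (rule fps_ext) (simp add: G_def algebra_simps)
  have U: "(1 - F) * U = 1" using renewal_seq_fps[of f, where 'a = real] f0 by (simp add: F_def U_def)
  have V: "V = U - fps_const (1 / mean_wait) * G"
    by (rule fps_ext) (simp add: V_def U_def G_def dev_def)
  have m1: "fps_const (1 / mean_wait) * fps_const mean_wait = 1"
    using mean_wait_ge_1 by simp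
  have "(1 - fps_X) * (V * Cc) = (1 - F) * U - fps_const (1 / mean_wait) * (((1 - fps_X) * G) * Cc)"
    unfolding V C[symmetric] by (simp add: algebra_simps)
  also have "\<dots> = fps_const (1 / mean_wait) * fps_const mean_wait - fps_const (1 / mean_wait) * Cc"
    unfolding U G m1 by simp
  also have "\<dots> = (1 - fps_X) * (fps_const (1 / mean_wait) * E)"
    by (metis Eq mult.left_commute right_diff_distrib)
  finally have "V * Cc = fps_const (1 / mean_wait) * E"
    by (metis G mult_cancel_left mult_zero_left zero_neq_one)
  then have "fps_nth (V * Cc) n = tail surv n / mean_wait" by (simp add: E_def)
  moreover have "fps_nth (V * Cc) n = (\<Sum>i=0..n. dev i * surv (n - i))"
    by (simp add: V_def Cc_def fps_mult_nth)
  ultimately show ?thesis by simp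
qed

definition surv_gf :: "complex \<Rightarrow> complex" where "surv_gf z = (\<Sum>n. of_real (surv n) * z ^ n)"

lemma one_minus_surv_gf:
  assumes "cmod z \<le> R"
  shows "(1 - z) * surv_gf z = 1 - (\<Sum>n. of_real (f n) * z ^ n)"
  using tail_powser(3)[OF f_nonneg R_gt f_R assms] by (simp add: surv_gf_def surv_def f_suminf algebra_simps)

text \<open>
  Inside the unit disc \<open>|F(z)| \<le> |z| < 1\<close>, because the waiting time is at least one step.
\<close>

lemma surv_gf_nonzero_disc:
  assumes z: "cmod z < 1"
  shows "surv_gf z \<noteq> 0"
proof
  assume "surv_gf z = 0"
  then have eq: "(\<Sum>n. of_real (f n) * z ^ n) = 1"
    using one_minus_surv_gf[of z] z R_gt by simp
  have le: "cmod (of_real (f n) * z ^ n) \<le> cmod z * f n" for n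
  proof (cases n)
    case (Suc k)
    have "cmod z ^ k \<le> 1" using z by (intro power_le_one) auto
    then have "f n * cmod z * cmod z ^ k \<le> f n * cmod z * 1"
      using f_nonneg by (intro mult_left_mono) auto
    then show ?thesis using Suc f_nonneg by (simp add: norm_mult norm_power algebra_simps)
  qed (simp add: f0)
  have "cmod (\<Sum>n. of_real (f n) * z ^ n) \<le> (\<Sum>n. cmod z * f n)"
    by (intro norm_suminf_le le summable_mult f_summable)
  also have "\<dots> = cmod z" by (simp add: suminf_mult[OF f_summable] f_suminf)
  finally show False using eq z by simp
qed

text \<open>
  The deviations are, up to the factor \<open>mean_wait\<close>, the Taylor coefficients of \<open>E / C\<close>, which is
  holomorphic on the disc of radius \<open>r\<close>. On its boundary the numerator is largest at the real point
  \<open>r\<close>, as its coefficients are nonnegative.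
\<close>

lemma renewal_cauchy_estimate:
  assumes r: "1 < r" "r < R" and d: "0 < d"
    and low: "\<And>z. 1 \<le> cmod z \<Longrightarrow> cmod z \<le> r \<Longrightarrow> d \<le> cmod (surv_gf z)"
  shows "\<bar>dev n\<bar> * r ^ n \<le> ((\<Sum>n. surv n * r ^ n) - mean_wait) / (r - 1) / mean_wait / d"
proof -
  define Cc where "Cc = Abs_fps (\<lambda>n. complex_of_real (surv n))"
  define E where "E = Abs_fps (\<lambda>n. complex_of_real (tail surv n))"
  have cR: "summable (\<lambda>n. surv n * R ^ n)" using surv_R_sums by (simp add: sums_iff)
  note eR = tail_power_sums[OF surv_nonneg R_gt cR]
  have radC: "fps_conv_radius Cc \<ge> R" and radE: "fps_conv_radius E \<ge> R"
    using conv_radius_geI[of "\<lambda>n. complex_of_real (surv n)" "of_real R"]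
      conv_radius_geI[of "\<lambda>n. complex_of_real (tail surv n)" "of_real R"] R_gt
      tail_powser(1)[OF surv_nonneg R_gt cR, of "of_real R"] tail_powser(2)[OF surv_nonneg R_gt cR, of "of_real R"]
    by (auto simp: fps_conv_radius_def Cc_def E_def)
  have evC: "eval_fps Cc = surv_gf" by (simp add: eval_fps_def Cc_def surv_gf_def fun_eq_iff)
  have nz: "surv_gf z \<noteq> 0" if "cmod z \<le> r" for z
    using low[OF _ that] d surv_gf_nonzero_disc[of z] by (cases "cmod z < 1") auto
  define h where "h z = eval_fps E z / eval_fps Cc z" for z
  have pos: "0 < fps_conv_radius Cc" "0 < fps_conv_radius E"
    using less_le_trans[OF _ radC, of 0] less_le_trans[OF _ radE, of 0] R_gt by auto
  have sub: "cball 0 r \<subseteq> eball 0 (fps_conv_radius Cc)" "cball 0 r \<subseteq> eball 0 (fps_conv_radius E)"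
  proof -
    have "z \<in> eball 0 (fps_conv_radius F)" if "z \<in> cball 0 r" "ereal R \<le> fps_conv_radius F"
      for z and F :: "complex fps"
    proof -
      have "ereal (dist 0 z) < ereal R" using that r by simp
      from less_le_trans[OF this that(2)] show ?thesis by (simp add: in_eball_iff)
    qed
    then show "cball 0 r \<subseteq> eball 0 (fps_conv_radius Cc)" "cball 0 r \<subseteq> eball 0 (fps_conv_radius E)"
      using radC radE by auto
  qed
  have hol: "h holomorphic_on (cball 0 r)"
    unfolding h_def using nz sub by (intro holomorphic_intros) (auto simp: evC)
  have exp: "h has_fps_expansion (E / Cc)"
    unfolding h_def using pos
    by (intro has_fps_expansion_divide' eval_fps_has_fps_expansion) (auto simp: Cc_def surv_0)
  have EC: "E / Cc = fps_const (of_real mean_wait) * Abs_fps (\<lambda>n. complex_of_real (dev n))"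
  proof -
    define V where "V = Abs_fps (\<lambda>n. complex_of_real (dev n))"
    have "E = fps_const (of_real mean_wait) * (V * Cc)"
    proof (rule fps_ext)
      fix n
      have "fps_nth (V * Cc) n = of_real (\<Sum>i=0..n. dev i * surv (n - i))"
        by (simp add: V_def Cc_def fps_mult_nth)
      then show "fps_nth E n = fps_nth (fps_const (of_real mean_wait) * (V * Cc)) n"
        unfolding dev_convolution using mean_wait_ge_1 by (simp add: E_def)
    qed
    then have "E = fps_const (of_real mean_wait) * Abs_fps (\<lambda>n. complex_of_real (dev n)) * Cc"
      by (simp add: V_def mult.assoc)
    moreover have "Cc \<noteq> 0" using surv_0 by (auto simp: Cc_def fps_eq_iff intro!: exI[of _ 0])
    ultimately show ?thesis by simp
  qed
  have "of_real mean_wait * of_real (dev n) = (deriv ^^ n) h 0 / fact n"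
    using fps_nth_fps_expansion[OF exp, of n] unfolding EC by simp
  then have coeff: "(deriv ^^ n) h 0 = fact n * (of_real mean_wait * of_real (dev n))"
    by (simp add: field_simps)
  define B where "B = ((\<Sum>n. surv n * r ^ n) - mean_wait) / (r - 1) / d"
  have bd: "cmod (h z) \<le> B" if z: "cmod (0 - z) = r" for z
  proof -
    have zr: "cmod z = r" using z by simp
    have cr: "summable (\<lambda>n. surv n * r ^ n)" using summable_surv_pow r by simp
    note er = tail_power_sums[OF surv_nonneg r(1) cr]
    have "cmod (eval_fps E z) \<le> (\<Sum>n. tail surv n * r ^ n)"
      unfolding eval_fps_def E_def using tail_nonneg[OF surv_summable surv_nonneg] sums_summable[OF er] zr
      by (intro norm_suminf_le) (auto simp: norm_mult norm_power)
    also have "\<dots> = ((\<Sum>n. surv n * r ^ n) - mean_wait) / (r - 1)" using er by (simp add: sums_iff mean_wait_def)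
    finally have "cmod (eval_fps E z) \<le> ((\<Sum>n. surv n * r ^ n) - mean_wait) / (r - 1)" .
    moreover have "d \<le> cmod (eval_fps Cc z)" unfolding evC using low zr r by simp
    ultimately show ?thesis
      unfolding h_def B_def norm_divide using d by (intro frac_le) (auto intro: order_trans[OF norm_ge_zero])
  qed
  have "cmod ((deriv ^^ n) h 0) \<le> fact n * B / r ^ n"
    using hol r bd by (intro Cauchy_inequality holomorphic_on_imp_continuous_on)
      (auto elim: holomorphic_on_subset)
  then have "fact n * (mean_wait * \<bar>dev n\<bar>) \<le> fact n * (B / r ^ n)"
    unfolding coeff norm_mult using mean_wait_ge_1 by (simp add: mult.assoc)
  then have "mean_wait * \<bar>dev n\<bar> \<le> B / r ^ n" by (rule mult_left_le_imp_le) simp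
  then show ?thesis using mean_wait_ge_1 r d by (simp add: B_def field_simps)
qed

section \<open>The generating function of the survival probabilities\<close>

lemma surv_gf_1: "surv_gf 1 = of_real mean_wait"
  unfolding surv_gf_def mean_wait_def using suminf_of_real[OF surv_summable, where 'a = complex] by simp

lemma surv_gf_summable: "cmod z \<le> R \<Longrightarrow> summable (\<lambda>n. of_real (surv n) * z ^ n)"
  unfolding surv_def using tail_powser(2)[OF f_nonneg R_gt f_R] by simp

lemma surv_gf_cnj: assumes "cmod z \<le> R" shows "surv_gf (cnj z) = cnj (surv_gf z)"
proof -
  have "(\<lambda>n. cnj (of_real (surv n) * z ^ n)) sums cnj (surv_gf z)"
    unfolding surv_gf_def using surv_gf_summable[OF assms] by (simp only: sums_cnj summable_sums)
  then show ?thesis by (simp add: surv_gf_def sums_iff)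
qed

text \<open>
  Here \<open>circle_bound\<close> is applied to the law \<open>p\<close> that remains after removing the mass \<open>b\<close> at \<open>1\<close> from \<open>f\<close>
  and renormalising.
\<close>

lemma surv_gf_cis_lower_bound:
  assumes excess: "0 < excess" and t: "0 < t" "t \<le> pi"
  shows "(1 - b) * D_fun b excess \<le> cmod (surv_gf (cis t))"
proof -
  define p where "p n = (f n - (if n = 1 then b else 0)) / (1 - b)" for n
  define w where "w = cis t"
  have w1: "cmod w = 1" by (simp add: w_def)
  have p_nonneg: "0 \<le> p n" for n using f_nonneg b_le b_less by (simp add: p_def)
  have p0: "p 0 = 0" by (simp add: p_def f0)
  have "(\<lambda>n. (f n - (if n = 1 then b else 0)) / (1 - b)) sums ((1 - b) / (1 - b))"
    by (intro sums_divide sums_diff f_sums sums_single)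
  then have p1: "p sums 1" using b_less unfolding p_def[abs_def] by simp
  have "(\<lambda>n. (real n * f n - (if n = 1 then real n * b else 0)) / (1 - b)) sums ((mean_wait - real 1 * b) / (1 - b))"
    by (intro sums_divide sums_diff mean_sums sums_single)
  moreover have "(real n * f n - (if n = 1 then real n * b else 0)) / (1 - b) = real n * p n" for n
    by (simp add: p_def)
  moreover have "(mean_wait - real 1 * b) / (1 - b) = 1 + excess" using b_less by (simp add: excess_def field_simps)
  ultimately have pm: "(\<lambda>n. real n * p n) sums (1 + excess)" by simp
  have fw: "summable (\<lambda>n. of_real (f n) * w ^ n)"
    using tail_powser(1)[OF f_nonneg R_gt f_R] w1 R_gt by simp
  have "(\<lambda>n. (of_real (f n) * w ^ n - (if n = 1 then of_real b * w ^ n else 0)) / of_real (1 - b))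
     sums (((\<Sum>n. of_real (f n) * w ^ n) - of_real b * w ^ 1) / of_real (1 - b))"
    by (intro sums_divide sums_diff summable_sums fw sums_single)
  moreover have "(of_real (f n) * w ^ n - (if n = 1 then of_real b * w ^ n else 0)) / of_real (1 - b)
     = of_real (p n) * w ^ n" for n
    by (simp add: p_def algebra_simps)
  ultimately have pw: "(\<Sum>n. of_real (p n) * w ^ n) = ((\<Sum>n. of_real (f n) * w ^ n) - of_real b * w) / of_real (1 - b)"
    by (simp add: sums_iff)
  have b1: "complex_of_real (1 - b) \<noteq> 0" using b_less by simp
  have "(1 - w) * surv_gf w = 1 - (\<Sum>n. of_real (f n) * w ^ n)" using one_minus_surv_gf[of w] w1 R_gt by simp
  also have "\<dots> = of_real (1 - b) * (1 + of_real (b / (1 - b)) * (1 - w) - (\<Sum>n. of_real (p n) * w ^ n))"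
    unfolding pw using b1 by (simp add: field_simps)
  finally have eq: "cmod (1 - w) * cmod (surv_gf w)
    = (1 - b) * cmod (1 + of_real (b / (1 - b)) * (1 - w) - (\<Sum>n. of_real (p n) * w ^ n))"
    using b_less by (metis abs_of_pos diff_gt_0_iff_gt norm_mult norm_of_real)
  have "cmod (1 - w) = 2 * sin (t/2)" unfolding w_def using t by (intro cmod_one_minus_cis) auto
  moreover have "0 < sin (t/2)" using t by (intro sin_gt_zero) auto
  ultimately have pos: "0 < cmod (1 - w)" by simp
  have "D_fun b excess * cmod (1 - w) \<le> cmod (1 + of_real (b / (1 - b)) * (1 - w) - (\<Sum>n. of_real (p n) * w ^ n))"
    unfolding w_def by (intro circle_bound p0 p_nonneg p1 pm excess b_pos b_less t)
  then have "cmod (1 - w) * ((1 - b) * D_fun b excess) \<le> cmod (1 - w) * cmod (surv_gf w)"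
    unfolding eq using b_less by (simp add: mult.left_commute mult.commute mult_left_mono)
  then show ?thesis using pos by (simp add: w_def)
qed

lemma surv_gf_circle_lower_bound:
  assumes excess: "0 < excess" and w: "cmod w = 1"
  shows "(1 - b) * D_fun b excess \<le> cmod (surv_gf w)"
proof (cases "w = 1")
  case True
  have "(1 - b) * D_fun b excess \<le> (1 - b) * (b / (1 - b))"
    using b_pos b_less by (intro mult_left_mono D_fun_le) auto
  also have "\<dots> \<le> mean_wait" using b_less mean_wait_ge_1 by simp
  finally show ?thesis using True mean_wait_ge_1 by (simp add: surv_gf_1)
next
  case False
  have w0: "w \<noteq> 0" using w by auto
  have wc: "w = cis (Arg w)" using w0 w by (metis cis_Arg div_by_1 of_real_1 sgn_div_norm sgn_eq scaleR_one inverse_1)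
  have "Arg w \<noteq> 0" using wc False by auto
  consider "0 < Arg w" | "0 < - Arg w" using \<open>Arg w \<noteq> 0\<close> by linarith
  then show ?thesis
  proof cases
    case 1
    then show ?thesis using surv_gf_cis_lower_bound[OF excess 1] wc Arg_bounded[of w] by simp
  next
    case 2
    have "cnj w = cis (- Arg w)" using wc by (metis cis_cnj)
    moreover have "cmod (surv_gf (cnj w)) = cmod (surv_gf w)" using surv_gf_cnj[of w] w R_gt by simp
    ultimately show ?thesis using surv_gf_cis_lower_bound[OF excess 2] Arg_bounded[of w] by simp
  qed
qed

text \<open>
  Moving radially from \<open>z / |z|\<close> to \<open>z\<close> changes each term by at most \<open>surv n * (r ^ n - 1)\<close>.
\<close>

lemma surv_gf_annulus_lower_bound:
  assumes excess: "0 < excess" and r: "r \<le> R" and z: "1 \<le> cmod z" "cmod z \<le> r"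
  shows "(1 - b) * D_fun b excess - ((\<Sum>n. surv n * r ^ n) - mean_wait) \<le> cmod (surv_gf z)"
proof -
  define w where "w = z / of_real (cmod z)"
  have w: "cmod w = 1" using z by (cases "z = 0") (auto simp: w_def norm_divide)
  have zw: "z = of_real (cmod z) * w" using z by (cases "z = 0") (auto simp: w_def)
  have r0: "1 \<le> r" using z by simp
  have cr: "summable (\<lambda>n. surv n * r ^ n)" using r r0 by (intro summable_surv_pow) auto
  have sz: "summable (\<lambda>n. of_real (surv n) * z ^ n)" "summable (\<lambda>n. of_real (surv n) * w ^ n)"
    using z w r R_gt by (auto intro!: surv_gf_summable)
  have "surv_gf z - surv_gf w = (\<Sum>n. of_real (surv n) * z ^ n - of_real (surv n) * w ^ n)"
    unfolding surv_gf_def using sz by (rule suminf_diff)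
  also have "cmod \<dots> \<le> (\<Sum>n. surv n * r ^ n - surv n)"
  proof (rule norm_suminf_le)
    fix n
    have "of_real (surv n) * z ^ n - of_real (surv n) * w ^ n = of_real (surv n * (cmod z ^ n - 1)) * w ^ n"
      by (subst zw) (simp add: power_mult_distrib algebra_simps)
    then have "cmod (of_real (surv n) * z ^ n - of_real (surv n) * w ^ n) = surv n * (cmod z ^ n - 1)"
      using surv_nonneg[of n] z(1) w by (simp add: norm_mult norm_power one_le_power del: of_real_mult of_real_diff)
    also have "\<dots> \<le> surv n * (r ^ n - 1)"
      using z surv_nonneg by (intro mult_left_mono diff_right_mono power_mono) auto
    finally show "cmod (of_real (surv n) * z ^ n - of_real (surv n) * w ^ n) \<le> surv n * r ^ n - surv n"
      by (simp add: algebra_simps)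
  qed (intro summable_diff cr surv_summable)
  also have "\<dots> = (\<Sum>n. surv n * r ^ n) - mean_wait"
    unfolding mean_wait_def by (rule suminf_diff[symmetric, OF cr surv_summable])
  finally have "cmod (surv_gf w) - ((\<Sum>n. surv n * r ^ n) - mean_wait) \<le> cmod (surv_gf z)"
    using norm_triangle_ineq2[of "surv_gf w" "surv_gf z"] by (simp add: norm_minus_commute)
  then show ?thesis using surv_gf_circle_lower_bound[OF excess w] by simp
qed

lemma surv_pow_split:
  assumes "0 \<le> x" "x \<le> R"
  shows "(\<Sum>n. surv n * x ^ n) = 1 + (\<Sum>n. surv (Suc n) * x ^ Suc n)" "summable (\<lambda>n. surv (Suc n) * x ^ Suc n)"
proof -
  show "(\<Sum>n. surv n * x ^ n) = 1 + (\<Sum>n. surv (Suc n) * x ^ Suc n)"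
    using suminf_split_head[OF summable_surv_pow[OF assms]] by (simp add: surv_0)
  show "summable (\<lambda>n. surv (Suc n) * x ^ Suc n)"
    using summable_ignore_initial_segment[OF summable_surv_pow[OF assms], of 1] by simp
qed

text \<open>
  Hoelder's inequality for \<open>r = R powr \<rho>\<close> between the radii \<open>1\<close> and \<open>R\<close>. It is obtained by summing
  Young's inequality, with the weight \<open>A / excess\<close> for which both endpoint terms have the same
  size.
\<close>

lemma interpolation:
  assumes A: "0 < A" "(\<Sum>n. surv n * R ^ n) \<le> 1 + (1 - b) * A" and excess: "0 < excess" and r: "1 \<le> r" "r \<le> R"
  shows "(\<Sum>n. surv n * r ^ n) \<le> 1 + (1 - b) * excess * r powr (ln (A / excess) / ln R)"
proof -
  define rho where "rho = ln r / ln R"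
  have rho: "0 \<le> rho" "rho \<le> 1" using r R_gt by (auto simp: rho_def divide_le_eq_1)
  have r_eq: "r = R powr rho" using r R_gt by (simp add: rho_def powr_def)
  have k_eq: "r powr (ln (A / excess) / ln R) = (A / excess) powr rho"
    using A excess r by (simp add: rho_def powr_def)
  define q where "q = A / excess"
  have q: "0 < q" using A excess by (simp add: q_def)
  have young: "r ^ n \<le> q powr rho * ((1 - rho) + rho * (R ^ n / q))" for n
  proof -
    have "(R ^ n / q) powr rho * 1 powr (1 - rho) \<le> rho * (R ^ n / q) + (1 - rho) * 1"
      using rho q R_gt by (intro Youngs_inequality_0) auto
    then have "(R ^ n / q) powr rho \<le> (1 - rho) + rho * (R ^ n / q)" by simp
    then have "q powr rho * (R ^ n / q) powr rho \<le> q powr rho * ((1 - rho) + rho * (R ^ n / q))"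
      by (intro mult_left_mono) auto
    moreover have "q powr rho * (R ^ n / q) powr rho = r ^ n"
    proof -
      have "q powr rho * (R ^ n / q) powr rho = (R ^ n) powr rho"
        using q R_gt by (simp add: powr_mult[symmetric])
      also have "\<dots> = r ^ n" unfolding r_eq using R_gt
        by (simp add: powr_realpow[symmetric] powr_powr mult.commute)
      finally show ?thesis .
    qed
    ultimately show ?thesis by simp
  qed
  note head = surv_pow_split
  have m1: "(\<Sum>n. surv (Suc n)) = (1 - b) * excess" "summable (\<lambda>n. surv (Suc n))"
    using head[of 1] R_gt mean_wait_eq by (auto simp: mean_wait_def)
  have "(\<Sum>n. surv (Suc n) * r ^ Suc n)
      \<le> (\<Sum>n. q powr rho * (1 - rho) * surv (Suc n) + q powr rho * (rho / q) * (surv (Suc n) * R ^ Suc n))"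
  proof (rule suminf_le)
    fix n
    have "surv (Suc n) * r ^ Suc n \<le> surv (Suc n) * (q powr rho * ((1 - rho) + rho * (R ^ Suc n / q)))"
      by (intro mult_left_mono young surv_nonneg)
    then show "surv (Suc n) * r ^ Suc n \<le> q powr rho * (1 - rho) * surv (Suc n) + q powr rho * (rho / q) * (surv (Suc n) * R ^ Suc n)"
      by (simp add: algebra_simps)
  qed (use head m1 r R_gt in \<open>auto intro!: summable_add summable_mult\<close>)
  also have "\<dots> = q powr rho * (1 - rho) * (\<Sum>n. surv (Suc n)) + q powr rho * (rho / q) * (\<Sum>n. surv (Suc n) * R ^ Suc n)"
  proof -
    have "summable (\<lambda>n. surv (Suc n) * R ^ Suc n)" using head[of R] R_gt by simp
    then show ?thesis using m1(2)
      by (simp only: suminf_add[symmetric] suminf_mult summable_mult)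
  qed
  also have "\<dots> \<le> q powr rho * (1 - rho) * ((1 - b) * excess) + q powr rho * (rho / q) * ((1 - b) * A)"
    using head[of R] m1 R_gt A rho q by (intro add_mono mult_left_mono) auto
  also have "\<dots> = (1 - b) * excess * q powr rho"
    using excess A by (simp add: q_def field_simps)
  finally show ?thesis using head[of r] r k_eq by (simp add: q_def)
qed

text \<open>
  All terms after the zeroth one carry at least one factor \<open>R\<close>. Below this guarantees that the
  exponent \<open>ln (A / excess) / ln R\<close> is positive.
\<close>

lemma excess_R_le: "1 + (1 - b) * excess * R \<le> (\<Sum>n. surv n * R ^ n)"
proof -
  have "(\<Sum>n. surv n * R ^ n) = 1 + (\<Sum>n. surv (Suc n) * R ^ Suc n)" "summable (\<lambda>n. surv (Suc n) * R ^ Suc n)"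
    using surv_pow_split[of R] R_gt by auto
  moreover have "mean_wait = 1 + (\<Sum>n. surv (Suc n))" "summable (\<lambda>n. surv (Suc n))"
    using suminf_split_head[OF surv_summable] surv_summable by (auto simp: surv_0 mean_wait_def summable_Suc_iff)
  moreover have "(\<Sum>n. surv (Suc n) * R) \<le> (\<Sum>n. surv (Suc n) * R ^ Suc n)"
    using calculation(2,4) surv_nonneg R_gt
    by (intro suminf_le summable_mult2 mult_left_mono) (auto simp: one_le_power)
  moreover have "(\<Sum>n. surv (Suc n)) * R = (\<Sum>n. surv (Suc n) * R)"
    using calculation(4) by (rule suminf_mult2)
  ultimately show ?thesis using mean_wait_eq by simp
qed

theorem renewal_rate:
  assumes A: "(\<Sum>n. surv n * R ^ n) \<le> 1 + (1 - b) * A" and excess: "0 < excess" and r: "1 < r" "r < R"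
  defines "k \<equiv> ln (A / excess) / ln R"
  assumes rk: "r powr k < 1 + D_fun b excess / excess"
  shows "\<bar>dev n\<bar> * r ^ n \<le> (1 / mean_wait) * (r powr k - 1) / ((r - 1) * (D_fun b excess / excess - r powr k + 1))"
proof -
  have "0 < (1 - b) * excess * R" using excess b_less R_gt by simp
  also have "\<dots> \<le> (1 - b) * A" using excess_R_le A by simp
  finally have A0: "0 < A" using b_less by (simp add: zero_less_mult_iff)
  have "(\<Sum>n. surv n * r ^ n) - mean_wait \<le> (1 - b) * excess * (r powr k - 1)"
    using interpolation[OF A0 A excess less_imp_le[OF r(1)] less_imp_le[OF r(2)]] mean_wait_eq
    by (simp add: k_def algebra_simps)
  note le = this
  define q where "q = (1 - b) * excess"
  have q: "0 < q" using b_less excess by (simp add: q_def)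
  define d where "d = q * (D_fun b excess / excess - r powr k + 1)"
  have dpos: "0 < D_fun b excess / excess - r powr k + 1" using rk by simp
  then have d: "0 < d" using q by (simp add: d_def)
  have "d = (1 - b) * D_fun b excess - q * (r powr k - 1)" using excess by (simp add: d_def q_def field_simps)
  then have "d \<le> (1 - b) * D_fun b excess - ((\<Sum>n. surv n * r ^ n) - mean_wait)" using le by (simp add: q_def)
  then have "d \<le> cmod (surv_gf z)" if "1 \<le> cmod z" "cmod z \<le> r" for z
    using surv_gf_annulus_lower_bound[OF excess _ that] r by simp
  from renewal_cauchy_estimate[OF r d this]
  have "\<bar>dev n\<bar> * r ^ n \<le> ((\<Sum>n. surv n * r ^ n) - mean_wait) / (r - 1) / mean_wait / d" by simp
  also have "\<dots> \<le> (q * (r powr k - 1)) / (r - 1) / mean_wait / d"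
    using le r mean_wait_ge_1 d by (intro divide_right_mono) (auto simp: q_def)
  also have "\<dots> = (1 / mean_wait) * (r powr k - 1) / ((r - 1) * (D_fun b excess / excess - r powr k + 1))"
    unfolding d_def using q by (simp add: mult.commute)
  finally show ?thesis .
qed

text \<open>
  If the coefficients of \<open>c(z) - 1\<close> sum at radius \<open>r\<close> to at most \<open>q < 1\<close>, then \<open>dev_convolution\<close>, solved for
  \<open>dev n\<close>, is a contraction for the norm \<open>sup |dev n| * r ^ n\<close>, and its inhomogeneous term
  is at most \<open>q / r\<close>.
\<close>

lemma renewal_rate_perturbative:
  assumes r: "1 < r" "r \<le> R" and q: "(\<Sum>n. surv n * r ^ n) \<le> 1 + q" "q < 1"
  shows "\<bar>dev n\<bar> * r ^ n \<le> q / r / (1 - q)"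
proof (induction n rule: less_induct)
  case (less n)
  have cr: "summable (\<lambda>n. surv n * r ^ n)" using r by (intro summable_surv_pow) auto
  have q0: "0 \<le> q" using surv_sum_ge_1[of r] r q by simp
  have "(\<Sum>n. surv (Suc n) * r ^ Suc n) \<le> q" and cs: "summable (\<lambda>n. surv (Suc n) * r ^ Suc n)"
    using surv_pow_split[of r] r q by auto
  note tl = this(1)
  have "tail surv n * r ^ n \<le> q / r"
  proof -
    have "tail surv n * r ^ Suc n = (\<Sum>k. surv (k + Suc n) * r ^ Suc n)"
      unfolding tail_def by (intro suminf_mult2 summable_ignore_initial_segment surv_summable)
    also have "\<dots> \<le> (\<Sum>k. surv (k + Suc n) * r ^ (k + Suc n))"
      using surv_nonneg r by (intro suminf_le mult_left_mono power_increasing summable_mult2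
          summable_ignore_initial_segment[OF cr] summable_ignore_initial_segment[OF surv_summable]) auto
    also have "\<dots> = (\<Sum>k. surv (Suc k) * r ^ Suc k) - (\<Sum>k<n. surv (Suc k) * r ^ Suc k)"
      using suminf_minus_initial_segment[OF cs, of n] by simp
    also have "\<dots> \<le> q" using tl sum_nonneg[of "{..<n}" "\<lambda>k. surv (Suc k) * r ^ Suc k"] surv_nonneg r by simp
    finally show ?thesis using r by (simp add: field_simps)
  qed
  moreover have "0 \<le> tail surv n * r ^ n" using tail_nonneg[OF surv_summable surv_nonneg] r by simp
  then have "tail surv n * r ^ n / mean_wait \<le> tail surv n * r ^ n" using mean_wait_ge_1 by (simp add: divide_le_eq mult_le_cancel_left1)
  ultimately have e: "tail surv n / mean_wait * r ^ n \<le> q / r" by simp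
  have "tail surv n / mean_wait = (\<Sum>i<n. dev i * surv (n - i)) + dev n"
    unfolding dev_convolution[symmetric] by (simp add: atLeast0AtMost lessThan_Suc_atMost[symmetric] surv_0)
  then have vn: "dev n = tail surv n / mean_wait - (\<Sum>i<n. dev i * surv (n - i))" by simp
  have "(\<Sum>i<n. dev i * surv (n - i)) * r ^ n = (\<Sum>i<n. (dev i * r ^ i) * (surv (n - i) * r ^ (n - i)))"
    unfolding sum_distrib_right
  proof (rule sum.cong)
    fix i assume "i \<in> {..<n}"
    then have "r ^ n = r ^ i * r ^ (n - i)" by (simp add: power_add[symmetric])
    then show "dev i * surv (n - i) * r ^ n = (dev i * r ^ i) * (surv (n - i) * r ^ (n - i))" by simp
  qed simp
  then have "dev n * r ^ n = tail surv n / mean_wait * r ^ n - (\<Sum>i<n. (dev i * r ^ i) * (surv (n - i) * r ^ (n - i)))"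
    unfolding vn left_diff_distrib by simp
  then have "\<bar>dev n\<bar> * r ^ n \<le> tail surv n / mean_wait * r ^ n + (\<Sum>i<n. \<bar>dev i\<bar> * r ^ i * (surv (n - i) * r ^ (n - i)))"
  proof -
    assume eq: "dev n * r ^ n = tail surv n / mean_wait * r ^ n - (\<Sum>i<n. (dev i * r ^ i) * (surv (n - i) * r ^ (n - i)))"
    have "\<bar>dev n\<bar> * r ^ n = \<bar>dev n * r ^ n\<bar>" using r by (simp add: abs_mult)
    also have "\<dots> \<le> \<bar>tail surv n / mean_wait * r ^ n\<bar> + \<bar>\<Sum>i<n. (dev i * r ^ i) * (surv (n - i) * r ^ (n - i))\<bar>"
      unfolding eq by linarith
    also have "\<bar>tail surv n / mean_wait * r ^ n\<bar> = tail surv n / mean_wait * r ^ n"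
      using tail_nonneg[OF surv_summable surv_nonneg, of n] mean_wait_ge_1 r by simp
    also have "\<bar>\<Sum>i<n. (dev i * r ^ i) * (surv (n - i) * r ^ (n - i))\<bar> \<le> (\<Sum>i<n. \<bar>dev i\<bar> * r ^ i * (surv (n - i) * r ^ (n - i)))"
      using surv_nonneg r by (intro order_trans[OF sum_abs] sum_mono) (simp add: abs_mult)
    finally show ?thesis by simp
  qed
  also have "\<dots> \<le> q / r + (\<Sum>i<n. (q / r / (1 - q)) * (surv (n - i) * r ^ (n - i)))"
    using e less surv_nonneg r by (intro add_mono sum_mono mult_right_mono) auto
  also have "(\<Sum>i<n. (q / r / (1 - q)) * (surv (n - i) * r ^ (n - i)))
      = (q / r / (1 - q)) * (\<Sum>i<n. surv (Suc i) * r ^ Suc i)"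
  proof -
    have "(\<Sum>i<n. surv (n - i) * r ^ (n - i)) = (\<Sum>i<n. surv (Suc i) * r ^ Suc i)"
      by (rule sum.reindex_bij_witness[of _ "\<lambda>i. n - Suc i" "\<lambda>i. n - Suc i"])
        (auto simp: Suc_diff_Suc simp del: power_Suc)
    then show ?thesis by (simp only: sum_distrib_left[symmetric])
  qed
  also have "\<dots> \<le> (q / r / (1 - q)) * q"
  proof (rule mult_left_mono)
    have "(\<Sum>i<n. surv (Suc i) * r ^ Suc i) \<le> (\<Sum>i. surv (Suc i) * r ^ Suc i)"
      using surv_nonneg r by (intro sum_le_suminf cs) auto
    then show "(\<Sum>i<n. surv (Suc i) * r ^ Suc i) \<le> q" using tl by simp
  qed (use q q0 r in auto)
  also have "q / r + (q / r / (1 - q)) * q = q / r / (1 - q)"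
    using q r by (simp add: field_simps)
  finally show ?case by simp
qed

lemma surv_sum_eq_1:
  assumes "excess = 0" shows "(\<Sum>n. surv n * r ^ n) = 1"
proof -
  have "surv (Suc n) = 0" for n
  proof -
    have "sum surv {0, Suc n} \<le> mean_wait" unfolding mean_wait_def by (intro sum_le_suminf surv_summable) (auto simp: surv_nonneg)
    then show ?thesis using assms mean_wait_eq surv_nonneg[of "Suc n"] by (simp add: surv_0)
  qed
  then have "surv n * r ^ n = (if n = 0 then 1 else 0)" for n using surv_0 by (cases n) auto
  then show ?thesis using sums_unique[OF sums_single[of 0 "\<lambda>_. 1 :: real"]] by simp
qed

text \<open>
  For \<open>excess \<le> 1\<close> the bound of \<open>interpolation\<close>, \<open>excess * (A / excess) powr \<rho>\<close>, is at most \<open>A powr \<rho>\<close>.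
  So the perturbative estimate applies with \<open>q = (1 - b) * r powr k\<close>, and
  \<open>D_fun b 1 \<le> b / (1 - b)\<close> turns its value into the formula at \<open>\<alpha> = 1\<close>. The Cauchy estimate would
  not do here, since it bounds the whole function \<open>E / C\<close>, and that may exceed the formula at
  \<open>\<alpha> = 1\<close> although its coefficients do not.
\<close>

theorem renewal_rate_small_mean:
  assumes A: "(\<Sum>n. surv n * R ^ n) \<le> 1 + (1 - b) * A" "R \<le> A" and excess: "excess \<le> 1" and r: "1 < r" "r < R"
  defines "k \<equiv> ln A / ln R"
  assumes rk: "r powr k < 1 + D_fun b 1"
  shows "\<bar>dev n\<bar> * r ^ n \<le> (r powr k - 1) / ((r - 1) * (D_fun b 1 - r powr k + 1))"
proof -
  have k1: "1 \<le> k" using A R_gt by (simp add: k_def)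
  define x where "x = r powr k"
  have xr: "r \<le> x" using powr_mono[OF k1, of r] r by (simp add: x_def)
  define q where "q = (1 - b) * x"
  have cq: "(\<Sum>n. surv n * r ^ n) \<le> 1 + q"
  proof (cases "excess = 0")
    case True
    have "(\<Sum>n. surv n * r ^ n) = 1" using surv_sum_eq_1[OF True] .
    moreover have "0 \<le> q" using xr r b_less by (simp add: q_def)
    ultimately show ?thesis by simp
  next
    case False
    then have al0: "0 < excess" using excess_nonneg by simp
    have "excess * r powr (ln (A / excess) / ln R) \<le> x"
    proof -
      have "excess * r powr (ln (A / excess) / ln R) = excess * (x / r powr (ln excess / ln R))"
        using al0 A R_gt by (simp add: x_def k_def ln_div diff_divide_distrib powr_diff)
      also have "r powr (ln excess / ln R) = excess powr (ln r / ln R)" using al0 r by (simp add: powr_def)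
      also have "excess * (x / excess powr (ln r / ln R)) = x * excess powr (1 - ln r / ln R)"
        using al0 by (simp add: powr_diff)
      also have "\<dots> \<le> x * 1"
        using excess al0 xr r R_gt by (intro mult_left_mono powr_le1) auto
      finally show ?thesis by simp
    qed
    then have "(1 - b) * excess * r powr (ln (A / excess) / ln R) \<le> q"
      unfolding q_def mult.assoc using b_less by (intro mult_left_mono) auto
    then show ?thesis using interpolation[OF _ A(1) al0, of r] r A(2) R_gt by simp
  qed
  have D: "D_fun b 1 \<le> b / (1 - b)" using b_pos b_less by (rule D_fun_le)
  have xD: "x < 1 + D_fun b 1" using rk by (simp add: x_def)
  have b1: "0 < 1 - b" using b_less by simp
  have one_q: "1 - q = (1 - b) * (1 + b / (1 - b) - x)" using b1 by (simp add: q_def field_simps)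
  have "0 < 1 - q" unfolding one_q using b1 xD D by (intro mult_pos_pos) auto
  then have "\<bar>dev n\<bar> * r ^ n \<le> q / r / (1 - q)"
    using renewal_rate_perturbative[of r q] r cq by simp
  also have "\<dots> = x / r / (1 + b / (1 - b) - x)"
    by (subst one_q) (use b1 in \<open>simp add: q_def\<close>)
  also have "\<dots> \<le> x / r / (1 + D_fun b 1 - x)"
    using D xD xr r by (intro divide_left_mono mult_pos_pos) auto
  also have "\<dots> \<le> (x - 1) / (r - 1) / (1 + D_fun b 1 - x)"
  proof (rule divide_right_mono)
    show "x / r \<le> (x - 1) / (r - 1)" using r xr by (simp add: field_simps)
  qed (use xD in auto)
  finally show ?thesis by (simp add: x_def algebra_simps)
qed

end

section \<open>Renewal rates in terms of the drift constants\<close>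

text \<open>
  Bernoulli's inequality for real exponents.
\<close>

lemma powr_ge_linear:
  fixes R a :: real
  assumes "1 \<le> a" "0 < R"
  shows "1 + a * (R - 1) \<le> R powr a"
proof -
  have "(R powr a) powr (1 / a) * 1 powr (1 - 1 / a) \<le> 1 / a * R powr a + (1 - 1 / a) * 1"
    using assms by (intro Youngs_inequality_0) auto
  then have "R \<le> 1 / a * R powr a + (1 - 1 / a)"
    using assms by (simp add: powr_powr)
  then have "a * R \<le> a * (1 / a * R powr a + (1 - 1 / a))" using assms by (intro mult_left_mono) auto
  then show ?thesis using assms by (simp add: algebra_simps)
qed

locale renewal_drift = renewal +
  fixes lam K :: real
  assumes R_eq: "R = R_par lam" and f_R_le: "(\<Sum>n. f n * R ^ n) \<le> L_par lam K"
begin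

abbreviation "L \<equiv> L_par lam K"
abbreviation "N \<equiv> N_par lam K"

text \<open>
  An upper bound for \<open>\<Sum> c\<^sub>n R\<^sup>n / (1 - b)\<close> over \<open>n \<ge> 1\<close>, in the scale in which the same sum at radius \<open>1\<close> is
  \<open>\<alpha>\<close>; so \<open>\<kappa>(\<alpha>)\<close> is the growth exponent between the two radii.
\<close>

definition A :: real where "A = (N - 1) / (1 - b)"

lemma kappa_eq: "kappa b lam K a = ln (A / a) / ln R"
  by (simp add: kappa_def A_def R_eq)

lemma surv_R_le: "(\<Sum>n. surv n * R ^ n) \<le> 1 + (1 - b) * A"
proof -
  have "(\<Sum>n. surv n * R ^ n) = ((\<Sum>n. f n * R ^ n) - 1) / (R - 1)" using surv_R_sums by (simp add: sums_iff)
  also have "\<dots> \<le> N" unfolding N_par_def R_eq[symmetric] using f_R_le R_gt by (intro divide_right_mono) auto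
  finally show ?thesis using b_less by (simp add: A_def)
qed

lemma excess_R_le_A: "excess * R \<le> A"
proof -
  have "(1 - b) * (excess * R) \<le> (1 - b) * A" using excess_R_le surv_R_le by simp
  then show ?thesis using b_less by simp
qed

lemma atom_rate:
  assumes excess: "0 < excess"
  shows "1 < r0_atom b lam K (1 / mean_wait)"
    and "\<And>r n. 1 < r \<Longrightarrow> r < r0_atom b lam K (1 / mean_wait) \<Longrightarrow> \<bar>dev n\<bar> * r ^ n \<le> K0_atom b lam K (1 / mean_wait) r"
proof -
  have at: "alpha_atom b (1 / mean_wait) = excess" by (simp add: alpha_atom_def excess_def)
  define k where "k = ln (A / excess) / ln R"
  have "excess * 1 < excess * R" using excess R_gt by (intro mult_strict_left_mono) auto
  then have "excess < A" using excess_R_le_A by simp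
  then have k: "0 < k" using excess R_gt by (simp add: k_def)
  have D: "0 < D_fun b excess / excess" using excess b_pos b_less D_fun_pos[of excess b] by simp
  have r0: "r0_atom b lam K (1 / mean_wait) = min R ((1 + D_fun b excess / excess) powr (1 / k))"
    unfolding r0_atom_def Let_def at kappa_eq k_def R_eq by simp
  have "1 < (1 + D_fun b excess / excess) powr (1 / k)"
    using k D powr_less_mono2[of "1 / k" 1 "1 + D_fun b excess / excess"] by simp
  then show "1 < r0_atom b lam K (1 / mean_wait)" unfolding r0 using R_gt by simp
  fix r n assume r: "1 < r" "r < r0_atom b lam K (1 / mean_wait)"
  then have rR: "r < R" and "r < (1 + D_fun b excess / excess) powr (1 / k)" by (auto simp: r0)
  then have "r powr k < ((1 + D_fun b excess / excess) powr (1 / k)) powr k"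
    using r k by (intro powr_less_mono2) auto
  then have rk: "r powr k < 1 + D_fun b excess / excess" using k D by (simp add: powr_powr)
  have "\<bar>dev n\<bar> * r ^ n \<le> (1 / mean_wait) * (r powr k - 1) / ((r - 1) * (D_fun b excess / excess - r powr k + 1))"
    unfolding k_def by (rule renewal_rate[OF surv_R_le excess r(1) rR rk[unfolded k_def]])
  then show "\<bar>dev n\<bar> * r ^ n \<le> K0_atom b lam K (1 / mean_wait) r"
    unfolding K0_atom_def Let_def at kappa_eq k_def by simp
qed

lemma R_le_f_R: "R \<le> (\<Sum>n. f n * R ^ n)"
proof -
  have "(\<Sum>n. f n * R) \<le> (\<Sum>n. f n * R ^ n)"
  proof (rule suminf_le)
    fix n show "f n * R \<le> f n * R ^ n"
    proof (cases n)
      case (Suc k)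
      have "R * 1 \<le> R * R ^ k" using R_gt by (intro mult_left_mono one_le_power) auto
      then show ?thesis using Suc f_nonneg by (intro mult_left_mono) auto
    qed (simp add: f0)
  qed (use f_R f_summable in \<open>auto intro: summable_mult2\<close>)
  then show ?thesis using suminf_mult2[OF f_summable, of R] f_suminf by simp
qed

text \<open>
  Jensen's inequality for \<open>n \<mapsto> R ^ n\<close> and the law without its mass \<open>b\<close> at \<open>1\<close>, whose mean is
  \<open>1 + excess\<close>; the tangent of the exponential at the mean is summed.
\<close>

lemma jensen: "(1 - b) * R powr (1 + excess) \<le> L - b * R"
proof -
  define X where "X = R powr (1 + excess)"
  define g where "g n = f n - (if n = 1 then b else 0)" for n
  have g: "0 \<le> g n" for n using f_nonneg b_le by (simp add: g_def)
  have tangent: "X * (1 - (1 + excess) * ln R) + X * ln R * real n \<le> R ^ n" for n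
  proof -
    have "1 + (real n - (1 + excess)) * ln R \<le> exp ((real n - (1 + excess)) * ln R)" by (rule exp_ge_add_one_self)
    also have "\<dots> = R ^ n / X"
    proof -
      have "exp ((real n - (1 + excess)) * ln R) = R powr (real n - (1 + excess))"
        using R_gt by (simp add: powr_def)
      also have "\<dots> = R ^ n / X" using R_gt by (simp only: powr_diff X_def) (simp add: powr_realpow)
      finally show ?thesis .
    qed
    finally show ?thesis using R_gt by (simp add: X_def field_simps)
  qed
  have "(\<lambda>n. X * (1 - (1 + excess) * ln R) * (f n - (if n = 1 then b else 0)) + X * ln R * (real n * f n - (if n = 1 then real n * b else 0)))
      sums (X * (1 - (1 + excess) * ln R) * (1 - b) + X * ln R * (mean_wait - real 1 * b))"
    by (intro sums_add sums_mult sums_diff f_sums sums_single mean_sums)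
  moreover have "(\<lambda>n. f n * R ^ n - (if n = 1 then b * R ^ n else 0)) sums ((\<Sum>n. f n * R ^ n) - b * R ^ 1)"
    by (intro sums_diff summable_sums f_R sums_single)
  ultimately have "X * (1 - (1 + excess) * ln R) * (1 - b) + X * ln R * (mean_wait - real 1 * b) \<le> (\<Sum>n. f n * R ^ n) - b * R ^ 1"
  proof (rule sums_le[rotated])
    fix n
    have "g n * (X * (1 - (1 + excess) * ln R) + X * ln R * real n) \<le> g n * R ^ n"
      by (intro mult_left_mono tangent g)
    then show "X * (1 - (1 + excess) * ln R) * (f n - (if n = 1 then b else 0)) + X * ln R * (real n * f n - (if n = 1 then real n * b else 0))
      \<le> f n * R ^ n - (if n = 1 then b * R ^ n else 0)"
      by (simp add: g_def algebra_simps split: if_splits)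
  qed
  then have "X * (1 - b) \<le> (\<Sum>n. f n * R ^ n) - b * R" using mean_wait_eq by (simp add: algebra_simps)
  then show ?thesis using f_R_le by (simp add: X_def mult.commute)
qed

lemma powr_alpha0: "R powr alpha0 b lam K = (L - b * R) / ((1 - b) * R)"
proof -
  have "b * R < 1 * R" using b_less R_gt by (intro mult_strict_right_mono) auto
  then have "0 < L - b * R" using R_le_f_R f_R_le by simp
  then have "0 < (L - b * R) / ((1 - b) * R)" using b_less R_gt by (intro divide_pos_pos mult_pos_pos) auto
  then show ?thesis unfolding alpha0_def R_eq[symmetric] using R_gt by (simp add: powr_def)
qed

lemma excess_le_alpha0: "excess \<le> alpha0 b lam K"
proof -
  have "R powr excess = R powr (1 + excess) / R" using R_gt by (simp add: powr_add)
  also have "\<dots> \<le> R powr alpha0 b lam K"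
  proof -
    have "R powr (1 + excess) \<le> (L - b * R) / (1 - b)" using jensen b_less by (simp add: pos_le_divide_eq mult.commute)
    then have "R powr (1 + excess) / R \<le> (L - b * R) / (1 - b) / R" using R_gt by (intro divide_right_mono) auto
    then show ?thesis unfolding powr_alpha0 by simp
  qed
  finally show ?thesis using R_gt by simp
qed

text \<open>
  \<open>A\<close> equals \<open>R * (R powr \<alpha>\<^sub>0 - 1) / (R - 1)\<close>, which for integral \<open>\<alpha>\<^sub>0\<close> is the geometric sum
  \<open>R + \<dots> + R ^ \<alpha>\<^sub>0\<close>. The lemma says that \<open>\<kappa>(a) \<ge> 1\<close> throughout the admissible range.
\<close>

lemma A_ge:
  assumes a: "1 \<le> alpha0 b lam K" "a \<le> alpha0 b lam K"
  shows "a * R \<le> A"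
proof -
  have "(1 - b) * R * (R powr alpha0 b lam K - 1) = L - R"
    unfolding powr_alpha0 using b_less R_gt by (simp add: field_simps)
  then have "A = R * (R powr alpha0 b lam K - 1) / (R - 1)"
  proof -
    assume P: "(1 - b) * R * (R powr alpha0 b lam K - 1) = L - R"
    have "N - 1 = (L - R) / (R - 1)" using R_gt by (simp add: N_par_def R_eq[symmetric] field_simps)
    then show ?thesis unfolding A_def P[symmetric] using b_less by simp
  qed
  moreover have "R * (alpha0 b lam K * (R - 1)) \<le> R * (R powr alpha0 b lam K - 1)"
    using powr_ge_linear[OF a(1), of R] R_gt by (intro mult_left_mono) auto
  ultimately have "R * alpha0 b lam K \<le> A" using R_gt by (simp add: pos_le_divide_eq mult.assoc)
  moreover have "R * a \<le> R * alpha0 b lam K" using a R_gt by (intro mult_left_mono) auto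
  ultimately show ?thesis by (simp add: mult.commute)
qed

text \<open>
  Both \<open>D_fun\<close> and \<open>\<kappa>\<close> decrease in \<open>a\<close>, so uniform bounds over the range of \<open>a\<close> come from its end
  points, and no continuity argument is involved.
\<close>

lemma free_rate:
  assumes a0: "1 \<le> alpha0 b lam K"
  shows "1 < r0_free b lam K"
    and "\<And>r n. 1 < r \<Longrightarrow> r < r0_free b lam K \<Longrightarrow> \<bar>dev n\<bar> * r ^ n \<le> K0_free b lam K r"
proof -
  let ?I = "{1..alpha0 b lam K}"
  let ?k = "kappa b lam K"
  define g where "g a = (1 + D_fun b a / a) powr (1 / ?k a)" for a
  have r0: "r0_free b lam K = min R (INF a\<in>?I. g a)" by (simp add: r0_free_def g_def R_eq)
  have k1: "1 \<le> ?k a" if "a \<in> ?I" for a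
  proof -
    have "R \<le> A / a" using A_ge[OF a0, of a] that by (simp add: pos_le_divide_eq mult.commute)
    then have "ln R \<le> ln (A / a)" using R_gt by simp
    then show ?thesis using R_gt by (simp add: kappa_eq)
  qed
  have kanti: "?k a \<le> ?k 1" if "a \<in> ?I" for a
  proof -
    have "0 < A" using A_ge[OF a0 a0] R_gt by simp
    then show ?thesis unfolding kappa_eq using that R_gt
      by (intro divide_right_mono) (auto simp: field_simps)
  qed
  have D: "0 < D_fun b a" if "a \<in> ?I" for a using that b_pos b_less by (intro D_fun_pos) auto
  have bdd: "bdd_below (g ` ?I)" by (rule bdd_belowI[of _ 0]) (auto simp: g_def)
  have ne: "?I \<noteq> {}" using a0 by simp
  show "1 < r0_free b lam K"
  proof -
    \<comment> \<open>The base is smallest at \<open>alpha0\<close>, and the exponent \<open>1 / \<kappa>\<close> at \<open>1\<close>.\<close>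
    define a1 where "a1 = alpha0 b lam K"
    define e where "e = D_fun b a1 / a1"
    have e: "0 < e" using D[of a1] a0 by (simp add: a1_def e_def)
    have "(1 + e) powr (1 / ?k 1) \<le> g a" if "a \<in> ?I" for a
    proof -
      have "D_fun b a1 \<le> D_fun b a" using that b_pos b_less by (intro D_fun_antimono) (auto simp: a1_def)
      then have "e \<le> D_fun b a / a" unfolding e_def using that D[of a1] a0
        by (intro frac_le) (auto simp: a1_def)
      then have "(1 + e) powr (1 / ?k 1) \<le> (1 + D_fun b a / a) powr (1 / ?k 1)"
        using e k1[of 1] a0 by (intro powr_mono2) auto
      also have "\<dots> \<le> g a"
        unfolding g_def using k1[OF that] kanti[OF that] e \<open>e \<le> _\<close>
        by (intro powr_mono divide_left_mono) auto
      finally show ?thesis .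
    qed
    then have "(1 + e) powr (1 / ?k 1) \<le> (INF a\<in>?I. g a)" using ne by (intro cINF_greatest)
    moreover have "1 < (1 + e) powr (1 / ?k 1)"
      using k1[of 1] a0 e powr_less_mono2[of "1 / ?k 1" 1 "1 + e"] by simp
    ultimately show ?thesis unfolding r0 using R_gt by simp
  qed
  fix r n assume r: "1 < r" "r < r0_free b lam K"
  \<comment> \<open>A rate \<open>r'\<close> strictly between \<open>r\<close> and \<open>r0_free\<close> keeps the denominators above \<open>r' - r\<close>,\<close>
  \<comment> \<open>so that the supremum is taken over a set that is bounded above.\<close>
  define r' where "r' = (r + r0_free b lam K) / 2"
  have r': "r < r'" "r' < r0_free b lam K" using r by (auto simp: r'_def)
  have rR: "r < R" using r by (simp add: r0)
  have below: "x powr ?k a < 1 + D_fun b a / a" if a: "a \<in> ?I" and x: "1 < x" "x < r0_free b lam K" for a x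
  proof -
    have "x < g a" using x cINF_lower[OF bdd a] by (auto simp: r0)
    then have "x powr ?k a < g a powr ?k a" using x k1[OF a] by (intro powr_less_mono2) auto
    also have "\<dots> = 1 + D_fun b a / a" unfolding g_def using k1[OF a] D[OF a] a by (simp add: powr_powr)
    finally show ?thesis .
  qed
  define q where "q a = (r powr ?k a - 1) / ((r - 1) * (D_fun b a / a - r powr ?k a + 1))" for a
  have K0: "K0_free b lam K r = (SUP a\<in>?I. q a)" by (simp add: K0_free_def q_def)
  have bddq: "bdd_above (q ` ?I)"
  proof (rule bdd_aboveI2)
    fix a assume a: "a \<in> ?I"
    have "r powr ?k a * (r' / r - 1) \<ge> r * (r' / r - 1)"
      using powr_mono[OF k1[OF a], of r] r r' by (intro mult_right_mono) auto
    moreover have "(r' / r) powr ?k a \<ge> r' / r"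
      using powr_mono[OF k1[OF a], of "r' / r"] r r' by simp
    then have "r powr ?k a * (r' / r) powr ?k a \<ge> r powr ?k a * (r' / r)" by (intro mult_left_mono) auto
    then have "r' powr ?k a \<ge> r powr ?k a * (r' / r)" using r r' by (simp add: powr_mult[symmetric])
    moreover have "r * (r' / r - 1) = r' - r" using r by (simp add: right_diff_distrib)
    moreover have "r powr ?k a * (r' / r - 1) = r powr ?k a * (r' / r) - r powr ?k a" by (simp only: right_diff_distrib mult_1_right)
    ultimately have "r' powr ?k a - r powr ?k a \<ge> r' - r" by linarith
    then have "r' - r \<le> D_fun b a / a - r powr ?k a + 1" using below[OF a _ r'(2)] r r' by simp
    moreover have "r powr ?k a \<le> r powr ?k 1" using kanti[OF a] r by (intro powr_mono) auto
    moreover have "1 \<le> r powr ?k a" using k1[OF a] r by (simp add: ge_one_powr_ge_zero)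
    ultimately have "1 \<le> r powr ?k 1" by linarith
    show "q a \<le> (r powr ?k 1 - 1) / ((r - 1) * (r' - r))"
      unfolding q_def using r r' \<open>1 \<le> r powr ?k 1\<close> \<open>r powr ?k a \<le> r powr ?k 1\<close>
        \<open>r' - r \<le> D_fun b a / a - r powr ?k a + 1\<close>
      by (intro frac_le mult_left_mono) (auto simp del: powr_le_cancel_iff)
  qed
  show "\<bar>dev n\<bar> * r ^ n \<le> K0_free b lam K r"
  proof (cases "1 \<le> excess")
    case True
    then have a: "excess \<in> ?I" using excess_le_alpha0 by simp
    have al0: "0 < excess" using True by simp
    note rk = below[OF a r]
    have "\<bar>dev n\<bar> * r ^ n \<le> (1 / mean_wait) * (r powr ?k excess - 1) / ((r - 1) * (D_fun b excess / excess - r powr ?k excess + 1))"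
      using renewal_rate[OF surv_R_le al0 r(1) rR] rk unfolding kappa_eq by simp
    also have "\<dots> = (1 / mean_wait) * q excess" by (simp add: q_def)
    also have "\<dots> \<le> 1 * q excess"
    proof (rule mult_right_mono)
      show "0 \<le> q excess" unfolding q_def using rk r k1[OF a] by (simp add: ge_one_powr_ge_zero)
    qed (use mean_wait_ge_1 in auto)
    also have "\<dots> \<le> K0_free b lam K r" unfolding K0 using cSUP_upper[OF a bddq] by simp
    finally show ?thesis .
  next
    case False
    have a: "1 \<in> ?I" using a0 by simp
    have RA: "R \<le> A" using A_ge[OF a0 a0] mult_right_mono[of 1 "alpha0 b lam K" R] a0 R_gt by simp
    have k: "?k 1 = ln A / ln R" by (simp add: kappa_eq)
    have "\<bar>dev n\<bar> * r ^ n \<le> q 1"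
      using renewal_rate_small_mean[OF surv_R_le RA _ r(1) rR] False below[OF a r] unfolding k q_def by simp
    also have "\<dots> \<le> K0_free b lam K r" unfolding K0 using cSUP_upper[OF a bddq] by simp
    finally show ?thesis .
  qed
qed

end

section \<open>Excursions from the atom\<close>

locale atomic_chain =
  fixes S :: "'a measure" and P :: "'a \<Rightarrow> 'a measure" and \<pi> \<nu> :: "'a measure"
    and C :: "'a set" and V :: "'a \<Rightarrow> real" and b lam K :: real
  assumes P_kernel [measurable]: "P \<in> S \<rightarrow>\<^sub>M prob_algebra S"
    and stat: "stationary S P \<pi>"
    and minor: "minorization_atom S P C \<nu>"
    and drift: "drift_condition S P C V lam K"
    and aper: "strong_aperiodicity \<nu> C b"
begin

lemma C_sets [measurable]: "C \<in> sets S" and V_meas [measurable]: "V \<in> borel_measurable S"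
  and V_ge: "\<And>x. x \<in> space S \<Longrightarrow> 1 \<le> V x" and lam_pos: "0 < lam" and lam_less: "lam < 1"
  and b_bounds: "0 < b" "b < 1" and b_le: "b \<le> measure \<nu> C"
  using minor drift aper by (auto simp: minorization_atom_def drift_condition_def strong_aperiodicity_def)

lemma P_sub [measurable]: "P \<in> S \<rightarrow>\<^sub>M subprob_algebra S"
  by (rule measurable_prob_algebraD[OF P_kernel])

lemma P_prob: "x \<in> space S \<Longrightarrow> prob_space (P x)" and P_sets [measurable_cong]: "x \<in> space S \<Longrightarrow> sets (P x) = sets S"
  using measurable_space[OF P_kernel, of x] by (auto simp: space_prob_algebra)

lemma nu_prob: "prob_space \<nu>" and nu_sets [measurable_cong]: "sets \<nu> = sets S"
  using minor by (auto simp: minorization_atom_def space_prob_algebra)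

lemma pi_prob: "prob_space \<pi>" and pi_sets [measurable_cong]: "sets \<pi> = sets S" and pi_bind: "\<pi> \<bind> P = \<pi>"
  using stat by (auto simp: stationary_def space_prob_algebra)

lemma space_P: "x \<in> space S \<Longrightarrow> space (P x) = space S" and space_nu: "space \<nu> = space S"
  and space_pi: "space \<pi> = space S"
  using P_sets nu_sets pi_sets sets_eq_imp_space_eq by blast+

lemma C_sub: "x \<in> C \<Longrightarrow> x \<in> space S" using sets.sets_into_space[OF C_sets] by auto

lemma P_atom: assumes "x \<in> C" shows "P x = \<nu>"
  by (rule measure_eqI) (use minor P_sets C_sub[OF assms] nu_sets assms in \<open>auto simp: minorization_atom_def\<close>)

lemma ex_atom: obtains x where "x \<in> C"
  using b_le b_bounds by (metis measure_empty not_less ex_in_conv)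

lemma space_ne: obtains x where "x \<in> space S" using ex_atom C_sub by metis

text \<open>
  The drift condition bounds nonnegative integrals; from here on Bochner integrals are used.
\<close>

lemma V_int_P:
  assumes x: "x \<in> space S"
  shows "integrable (P x) V" and "x \<notin> C \<Longrightarrow> (\<integral>y. V y \<partial>P x) \<le> lam * V x"
    and "x \<in> C \<Longrightarrow> (\<integral>y. V y \<partial>P x) \<le> K"
proof -
  have meas: "V \<in> borel_measurable (P x)" using x by (simp add: measurable_cong_sets[OF P_sets])
  have nn: "AE y in P x. 0 \<le> V y" using V_ge x by (intro AE_I2) (force simp: space_P)
  have le: "x \<notin> C \<Longrightarrow> (\<integral>\<^sup>+y. ennreal (V y) \<partial>P x) \<le> ennreal (lam * V x)"
    "x \<in> C \<Longrightarrow> (\<integral>\<^sup>+y. ennreal (V y) \<partial>P x) \<le> ennreal K"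
    using drift x by (auto simp: drift_condition_def)
  then have "(\<integral>\<^sup>+y. ennreal (V y) \<partial>P x) < \<infinity>" by (cases "x \<in> C") (auto simp: le_less_trans)
  then show int: "integrable (P x) V" using meas nn by (intro integrableI_nonneg) auto
  note eq = nn_integral_eq_integral[OF int nn]
  show "x \<notin> C \<Longrightarrow> (\<integral>y. V y \<partial>P x) \<le> lam * V x"
    using le(1) V_ge[OF x] lam_pos unfolding eq by (subst (asm) ennreal_le_iff) auto
  assume c: "x \<in> C"
  have "0 < (\<integral>y. V y \<partial>P x)"
  proof -
    have "(\<integral>y. 1 \<partial>P x) \<le> (\<integral>y. V y \<partial>P x)"
      using prob_space.finite_measure[OF P_prob[OF x]] int V_ge x
      by (intro integral_mono) (auto simp: space_P finite_measure.integrable_const)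
    then show ?thesis using prob_space.prob_space[OF P_prob[OF x]] by simp
  qed
  then show "(\<integral>y. V y \<partial>P x) \<le> K" using le(2)[OF c] unfolding eq
    by (metis ennreal_le_iff2 not_le)
qed

lemma V_int_nu: "integrable \<nu> V" "(\<integral>y. V y \<partial>\<nu>) \<le> K"
proof -
  obtain x where x: "x \<in> C" by (rule ex_atom)
  show "integrable \<nu> V" "(\<integral>y. V y \<partial>\<nu>) \<le> K" using V_int_P[OF C_sub[OF x]] x P_atom[OF x] by auto
qed

lemma K_ge: "1 \<le> K"
proof -
  have "(\<integral>y. 1 \<partial>\<nu>) \<le> (\<integral>y. V y \<partial>\<nu>)"
    using prob_space.finite_measure[OF nu_prob] V_int_nu V_ge
    by (intro integral_mono) (auto simp: space_nu finite_measure.integrable_const)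
  then show ?thesis using V_int_nu(2) prob_space.prob_space[OF nu_prob] by simp
qed

text \<open>
  Membership in the ball of radius \<open>B\<close> of the weighted space, for functions with values in any Banach
  space: real functions such as \<open>V\<close> itself and complex ones go through the same estimates.
\<close>

definition V_bounded :: "real \<Rightarrow> ('a \<Rightarrow> 'b::{banach, second_countable_topology}) \<Rightarrow> bool" where
  "V_bounded B g \<longleftrightarrow> g \<in> borel_measurable S \<and> (\<forall>x\<in>space S. norm (g x) \<le> B * V x)"

lemma V_boundedD: "V_bounded B g \<Longrightarrow> x \<in> space S \<Longrightarrow> norm (g x) \<le> B * V x"
  and V_bounded_meas: "V_bounded B g \<Longrightarrow> g \<in> borel_measurable S"
  by (auto simp: V_bounded_def)

lemma V_bounded_nonneg: assumes "V_bounded B g" shows "0 \<le> B"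
proof -
  obtain x where x: "x \<in> space S" by (rule space_ne)
  have "0 \<le> B * V x" using V_boundedD[OF assms x] by (rule order_trans[OF norm_ge_zero])
  then show ?thesis using V_ge[OF x] by (simp add: zero_le_mult_iff)
qed

lemma V_bounded_V: "V_bounded 1 V" using V_ge by (force simp: V_bounded_def)

lemma V_bounded_add:
  assumes "V_bounded B g" "V_bounded B' h" shows "V_bounded (B + B') (\<lambda>x. g x + h x)"
proof -
  have "norm (g x + h x) \<le> (B + B') * V x" if "x \<in> space S" for x
    using norm_triangle_ineq[of "g x" "h x"] V_boundedD[OF assms(1) that] V_boundedD[OF assms(2) that]
    by (simp add: distrib_right)
  then show ?thesis using assms by (auto simp: V_bounded_def)
qed

lemma V_bounded_diff:
  assumes "V_bounded B g" "V_bounded B' h" shows "V_bounded (B + B') (\<lambda>x. g x - h x)"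
proof -
  have "norm (g x - h x) \<le> (B + B') * V x" if "x \<in> space S" for x
    using norm_triangle_ineq4[of "g x" "h x"] V_boundedD[OF assms(1) that] V_boundedD[OF assms(2) that]
    by (simp add: distrib_right)
  then show ?thesis using assms by (auto simp: V_bounded_def)
qed

lemma V_bounded_integrable:
  fixes B :: real
  assumes "V_bounded B g" "sets N = sets S" "integrable N V"
  shows "integrable N g"
proof (rule Bochner_Integration.integrable_bound[where f = "\<lambda>x. B * V x"])
  show "integrable N (\<lambda>x. B * V x)" using assms by simp
  show "g \<in> borel_measurable N" using assms by (simp add: V_bounded_def measurable_cong_sets[OF assms(2)])
  show "AE x in N. norm (g x) \<le> norm (B * V x)"
    using V_boundedD[OF assms(1)] sets_eq_imp_space_eq[OF assms(2)] by (intro AE_I2) (force intro: order_trans)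
qed

lemma V_bounded_int_P: "V_bounded B g \<Longrightarrow> x \<in> space S \<Longrightarrow> integrable (P x) g"
  using V_bounded_integrable P_sets V_int_P(1) by blast

lemma V_bounded_int_nu: "V_bounded B g \<Longrightarrow> integrable \<nu> g"
  using V_bounded_integrable nu_sets V_int_nu(1) by blast

lemma V_bounded_norm_integral:
  assumes "V_bounded B g" "sets N = sets S" "integrable N V"
  shows "norm (\<integral>y. g y \<partial>N) \<le> B * (\<integral>y. V y \<partial>N)"
proof -
  have "norm (\<integral>y. g y \<partial>N) \<le> (\<integral>y. norm (g y) \<partial>N)" by (rule integral_norm_bound)
  also have "\<dots> \<le> (\<integral>y. B * V y \<partial>N)"
    using V_bounded_integrable[OF assms] assms V_boundedD[OF assms(1)] sets_eq_imp_space_eq[OF assms(2)]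
    by (intro integral_mono integrable_norm integrable_mult_right) auto
  finally show ?thesis by simp
qed

lemma measurable_kernel_integral:
  fixes g :: "'a \<Rightarrow> 'b::{banach, second_countable_topology}"
  assumes "g \<in> borel_measurable S"
  shows "(\<lambda>x. \<integral>y. g y \<partial>P x) \<in> borel_measurable S"
  by (rule measurable_compose[OF P_sub integral_measurable_subprob_algebra[OF assms]])

text \<open>
  The kernel killed on \<open>C\<close>: its \<open>n\<close>-th power integrates over paths of length \<open>n\<close> that have not been in
  \<open>C\<close> at times \<open>0, \<dots>, n - 1\<close>, while the last point is unrestricted.
\<close>

definition taboo :: "('a \<Rightarrow> 'b::{banach, second_countable_topology}) \<Rightarrow> 'a \<Rightarrow> 'b" where
  "taboo g x = (if x \<in> C then 0 else \<integral>y. g y \<partial>P x)"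

lemma V_bounded_taboo: assumes g: "V_bounded B g" shows "V_bounded (B * lam) (taboo g)"
proof -
  have "norm (taboo g x) \<le> B * lam * V x" if x: "x \<in> space S" for x
  proof (cases "x \<in> C")
    case True
    then show ?thesis using V_bounded_nonneg[OF g] lam_pos V_ge[OF x] by (simp add: taboo_def)
  next
    case False
    have "norm (taboo g x) \<le> B * (\<integral>y. V y \<partial>P x)"
      using False V_bounded_norm_integral[OF g P_sets[OF x] V_int_P(1)[OF x]] by (simp add: taboo_def)
    also have "\<dots> \<le> B * (lam * V x)" using V_int_P(2)[OF x False] V_bounded_nonneg[OF g] by (rule mult_left_mono)
    finally show ?thesis by (simp add: mult.assoc)
  qed
  moreover have "taboo g \<in> borel_measurable S"
    unfolding taboo_def[abs_def] using measurable_kernel_integral[OF V_bounded_meas[OF g]]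
    by (intro measurable_If_set) auto
  ultimately show ?thesis by (simp add: V_bounded_def)
qed

lemma V_bounded_taboo_pow: "V_bounded B g \<Longrightarrow> V_bounded (B * lam ^ n) ((taboo ^^ n) g)"
  by (induction n) (auto dest: V_bounded_taboo simp: algebra_simps)

lemma V_bounded_kernel: assumes g: "V_bounded B g" shows "V_bounded (B * K) (kernel_op P g)"
proof -
  have "norm (kernel_op P g x) \<le> B * K * V x" if x: "x \<in> space S" for x
  proof -
    have "(\<integral>y. V y \<partial>P x) \<le> K * V x"
    proof (cases "x \<in> C")
      case True then show ?thesis using V_int_P(3)[OF x True] V_ge[OF x] K_ge
        by (smt (verit) mult_le_cancel_left1)
    next
      case False
      have "lam * V x \<le> K * V x" using lam_less K_ge V_ge[OF x] by (intro mult_right_mono) auto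
      then show ?thesis using V_int_P(2)[OF x False] by simp
    qed
    then have "B * (\<integral>y. V y \<partial>P x) \<le> B * (K * V x)" using V_bounded_nonneg[OF g] by (rule mult_left_mono)
    then show ?thesis using V_bounded_norm_integral[OF g P_sets[OF x] V_int_P(1)[OF x]]
      by (simp add: kernel_op_def mult.assoc)
  qed
  then show ?thesis using measurable_kernel_integral[OF V_bounded_meas[OF g]] by (simp add: V_bounded_def kernel_op_def[abs_def])
qed

lemma V_bounded_kernel_pow: "V_bounded B g \<Longrightarrow> V_bounded (B * K ^ n) ((kernel_op P ^^ n) g)"
  by (induction n) (auto dest: V_bounded_kernel simp: algebra_simps)

lemma taboo_mono:
  fixes g h :: "'a \<Rightarrow> real"
  assumes "V_bounded B g" "V_bounded B' h" "\<And>x. x \<in> space S \<Longrightarrow> g x \<le> h x" "x \<in> space S"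
  shows "taboo g x \<le> taboo h x"
  using assms V_bounded_int_P by (auto simp: taboo_def space_P intro!: integral_mono)

lemma taboo_cong: "(\<And>x. x \<in> space S \<Longrightarrow> g x = h x) \<Longrightarrow> x \<in> space S \<Longrightarrow> taboo g x = taboo h x"
  by (auto simp: taboo_def space_P intro!: Bochner_Integration.integral_cong)

lemma taboo_norm:
  assumes "V_bounded B g" "x \<in> space S" shows "norm (taboo g x) \<le> taboo (\<lambda>y. norm (g y)) x"
  by (simp add: taboo_def integral_norm_bound)

lemma V_bounded_norm: "V_bounded B g \<Longrightarrow> V_bounded B (\<lambda>x. norm (g x))" by (auto simp: V_bounded_def)

lemma taboo_pow_norm:
  assumes g: "V_bounded B g" and x: "x \<in> space S" shows "norm ((taboo ^^ n) g x) \<le> B * (taboo ^^ n) V x"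
  using x
proof (induction n arbitrary: x)
  case 0 then show ?case using V_boundedD[OF g] by simp
next
  case (Suc n)
  have "norm ((taboo ^^ Suc n) g x) \<le> taboo (\<lambda>y. norm ((taboo ^^ n) g y)) x"
    using taboo_norm[OF V_bounded_taboo_pow[OF g] Suc.prems] by simp
  also have "\<dots> \<le> taboo (\<lambda>y. B * (taboo ^^ n) V y) x"
  proof (rule taboo_mono[OF V_bounded_norm[OF V_bounded_taboo_pow[OF g]] _ Suc.IH Suc.prems])
    show "V_bounded (B * (1 * lam ^ n)) (\<lambda>y. B * (taboo ^^ n) V y)"
      using V_bounded_taboo_pow[OF V_bounded_V, of n] V_bounded_nonneg[OF g]
      by (auto simp: V_bounded_def abs_mult mult.assoc intro!: mult_left_mono)
  qed
  also have "\<dots> = B * (taboo ^^ Suc n) V x" by (simp add: taboo_def)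
  finally show ?case .
qed

text \<open>
  \<open>hit k x\<close> is the probability that the chain started in \<open>x\<close> is in \<open>C\<close> for the first time at time \<open>k\<close>,
  with time \<open>0\<close> included.
\<close>

definition hit :: "nat \<Rightarrow> 'a \<Rightarrow> real" where "hit k = (taboo ^^ k) (indicator C)"

lemma V_bounded_ind: "V_bounded 1 (indicator C :: 'a \<Rightarrow> real)"
  using V_ge by (auto simp: V_bounded_def indicator_def) force+

lemma V_bounded_one: "V_bounded 1 (\<lambda>_. 1 :: real)" using V_ge by (auto simp: V_bounded_def)

lemma V_bounded_one_c: "V_bounded 1 (\<lambda>_. 1 :: complex)" using V_ge by (auto simp: V_bounded_def)

lemma V_bounded_hit: "V_bounded (lam ^ k) (hit k)" using V_bounded_taboo_pow[OF V_bounded_ind, of k] by (simp add: hit_def)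

lemma hit_0: "hit 0 x = indicator C x" by (simp add: hit_def)
lemma hit_Suc: "hit (Suc k) x = taboo (hit k) x" by (simp add: hit_def)

lemma taboo_pow_nonneg:
  fixes g :: "'a \<Rightarrow> real"
  assumes "\<And>x. x \<in> space S \<Longrightarrow> 0 \<le> g x" "x \<in> space S"
  shows "0 \<le> (taboo ^^ n) g x"
  using assms(2)
proof (induction n arbitrary: x)
  case (Suc n)
  then show ?case by (auto simp: taboo_def space_P intro!: Bochner_Integration.integral_nonneg)
qed (use assms in auto)

lemma hit_nonneg: "x \<in> space S \<Longrightarrow> 0 \<le> hit k x"
  unfolding hit_def by (rule taboo_pow_nonneg) auto

definition taboo_V :: "nat \<Rightarrow> 'a \<Rightarrow> real" where "taboo_V n = (taboo ^^ n) V"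

lemma V_bounded_taboo_V: "V_bounded (lam ^ n) (taboo_V n)" using V_bounded_taboo_pow[OF V_bounded_V, of n] by (simp add: taboo_V_def)

lemma taboo_V_nonneg: "x \<in> space S \<Longrightarrow> 0 \<le> taboo_V n x"
  unfolding taboo_V_def by (rule taboo_pow_nonneg) (auto dest: V_ge)

text \<open>
  The drift condition in a form valid on the whole space: on \<open>C\<close> the left-hand side vanishes and
  \<open>V \<ge> 1\<close>. Subtracting the hitting term is what makes the sums below telescope.
\<close>

lemma taboo_V_step: assumes "x \<in> space S" shows "taboo_V (Suc n) x \<le> lam * (taboo_V n x - hit n x)"
  using assms
proof (induction n arbitrary: x)
  case 0
  show ?case
  proof (cases "x \<in> C")
    case True then show ?thesis using V_ge[OF 0] lam_pos by (simp add: taboo_V_def taboo_def hit_0)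
  next
    case False then show ?thesis using V_int_P(2)[OF 0 False] by (simp add: taboo_V_def taboo_def hit_0)
  qed
next
  case (Suc n)
  have d: "V_bounded (lam ^ n + lam ^ n) (\<lambda>y. taboo_V n y - hit n y)" by (intro V_bounded_diff V_bounded_taboo_V V_bounded_hit)
  have d': "V_bounded (lam * (lam ^ n + lam ^ n)) (\<lambda>y. lam * (taboo_V n y - hit n y))"
    using d lam_pos by (auto simp: V_bounded_def abs_mult mult.assoc intro!: mult_left_mono)
  have "taboo_V (Suc (Suc n)) x = taboo (taboo_V (Suc n)) x" by (simp add: taboo_V_def)
  also have "\<dots> \<le> taboo (\<lambda>y. lam * (taboo_V n y - hit n y)) x"
    by (rule taboo_mono[OF V_bounded_taboo_V d' Suc.IH Suc.prems])
  also have "\<dots> = lam * (taboo (taboo_V n) x - taboo (hit n) x)"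
    using V_bounded_int_P[OF V_bounded_taboo_V Suc.prems, of n] V_bounded_int_P[OF V_bounded_hit Suc.prems, of n] by (simp add: taboo_def)
  finally show ?case by (simp add: taboo_V_def hit_Suc)
qed

text \<open>
  Since \<open>r * lam \<le> 1\<close>, \<open>taboo_V_step\<close> gives
  \<open>hit n x * r ^ n \<le> r ^ n * taboo_V n x - r ^ (n + 1) * taboo_V (n + 1) x\<close>, and this telescopes.
\<close>

lemma hit_gen_partial:
  assumes x: "x \<in> space S" and r: "0 \<le> r" "r * lam \<le> 1"
  shows "(\<Sum>k<n. hit k x * r ^ k) \<le> V x"
proof -
  have "(\<Sum>k<n. hit k x * r ^ k) + r ^ n * taboo_V n x \<le> V x"
  proof (induction n)
    case (Suc n)
    have d: "0 \<le> taboo_V n x - hit n x"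
      using taboo_V_step[OF x, of n] taboo_V_nonneg[OF x, of "Suc n"] lam_pos by (smt (verit) zero_le_mult_iff)
    have "r * taboo_V (Suc n) x \<le> r * (lam * (taboo_V n x - hit n x))" using taboo_V_step[OF x] r by (intro mult_left_mono) auto
    also have "\<dots> \<le> 1 * (taboo_V n x - hit n x)" unfolding mult.assoc[symmetric] using r d by (intro mult_right_mono) auto
    finally have "r ^ n * (r * taboo_V (Suc n) x) \<le> r ^ n * (taboo_V n x - hit n x)" using r by (intro mult_left_mono) auto
    then show ?case using Suc by (simp add: algebra_simps)
  qed (simp add: taboo_V_def)
  moreover have "0 \<le> r ^ n * taboo_V n x" using taboo_V_nonneg[OF x] r by simp
  ultimately show ?thesis by simp
qed

definition hit_nu :: "nat \<Rightarrow> real" where "hit_nu k = (\<integral>y. hit k y \<partial>\<nu>)"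
definition taboo_V_nu :: "nat \<Rightarrow> real" where "taboo_V_nu k = (\<integral>y. taboo_V k y \<partial>\<nu>)"

lemma hit_nu_nonneg: "0 \<le> hit_nu k" and taboo_V_nu_nonneg: "0 \<le> taboo_V_nu k"
  unfolding hit_nu_def taboo_V_nu_def using hit_nonneg taboo_V_nonneg space_nu
  by (auto intro!: Bochner_Integration.integral_nonneg)

lemma taboo_V_nu_0: "taboo_V_nu 0 \<le> K" using V_int_nu by (simp add: taboo_V_nu_def taboo_V_def)

lemma taboo_V_nu_step: "taboo_V_nu (Suc n) \<le> lam * (taboo_V_nu n - hit_nu n)"
proof -
  have "taboo_V_nu (Suc n) \<le> (\<integral>y. lam * (taboo_V n y - hit n y) \<partial>\<nu>)"
    unfolding taboo_V_nu_def using V_bounded_int_nu[OF V_bounded_taboo_V] V_bounded_int_nu[OF V_bounded_hit] taboo_V_step space_nu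
    by (intro integral_mono) auto
  then show ?thesis using V_bounded_int_nu[OF V_bounded_taboo_V] V_bounded_int_nu[OF V_bounded_hit] by (simp add: taboo_V_nu_def hit_nu_def)
qed

lemma hit_sum: assumes "x \<in> space S" shows "(\<Sum>k<n. hit k x) = 1 - (taboo ^^ n) (\<lambda>_. 1 :: real) x"
  using assms
proof (induction n arbitrary: x)
  case (Suc n)
  have one: "(\<integral>y. 1 \<partial>P x) = (1::real)" using prob_space.prob_space[OF P_prob[OF Suc.prems]] by simp
  have "(\<Sum>k<Suc n. hit k x) = indicator C x + (\<Sum>k<n. taboo (hit k) x)"
    by (subst sum.lessThan_Suc_shift) (simp add: hit_0 hit_Suc)
  also have "(\<Sum>k<n. taboo (hit k) x) = taboo (\<lambda>y. \<Sum>k<n. hit k y) x"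
    using V_bounded_int_P[OF V_bounded_hit Suc.prems] by (simp add: taboo_def)
  also have "\<dots> = taboo (\<lambda>y. 1 - (taboo ^^ n) (\<lambda>_. 1 :: real) y) x"
    by (rule taboo_cong[OF Suc.IH Suc.prems])
  also have "\<dots> = (if x \<in> C then 0 else 1) - taboo ((taboo ^^ n) (\<lambda>_. 1 :: real)) x"
    using V_bounded_int_P[OF V_bounded_taboo_pow[OF V_bounded_one] Suc.prems, of n] one
      prob_space.finite_measure[OF P_prob[OF Suc.prems]]
    by (simp add: taboo_def finite_measure.integrable_const)
  finally show ?case by (simp add: indicator_def)
qed simp

lemma hit_nu_sum: "(\<Sum>k<n. hit_nu k) = 1 - (\<integral>y. (taboo ^^ n) (\<lambda>_. 1 :: real) y \<partial>\<nu>)"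
proof -
  have "(\<Sum>k<n. hit_nu k) = (\<integral>y. (\<Sum>k<n. hit k y) \<partial>\<nu>)"
    using V_bounded_int_nu[OF V_bounded_hit] by (simp add: hit_nu_def)
  also have "\<dots> = (\<integral>y. 1 - (taboo ^^ n) (\<lambda>_. 1 :: real) y \<partial>\<nu>)"
    by (rule Bochner_Integration.integral_cong) (auto simp: space_nu hit_sum)
  also have "\<dots> = 1 - (\<integral>y. (taboo ^^ n) (\<lambda>_. 1 :: real) y \<partial>\<nu>)"
    using V_bounded_int_nu[OF V_bounded_taboo_pow[OF V_bounded_one]] prob_space.finite_measure[OF nu_prob] prob_space.prob_space[OF nu_prob]
    by (simp add: finite_measure.integrable_const)
  finally show ?thesis .
qed

lemma taboo_one_bounds:
  assumes "x \<in> space S" shows "0 \<le> (taboo ^^ n) (\<lambda>_. 1 :: real) x" "(taboo ^^ n) (\<lambda>_. 1 :: real) x \<le> lam ^ n * V x"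
  using taboo_pow_nonneg[of "\<lambda>_. 1" x n] V_boundedD[OF V_bounded_taboo_pow[OF V_bounded_one], of x n] assms by (auto simp: abs_le_iff)

text \<open>
  A chain started in \<open>C\<close> moves with law \<open>\<nu>\<close> in one step and then needs the hitting time of \<open>C\<close>; hence the
  shift by one.
\<close>

definition return_law :: "nat \<Rightarrow> real" where "return_law n = (case n of 0 \<Rightarrow> 0 | Suc k \<Rightarrow> hit_nu k)"

lemma hit_nu_sums: "hit_nu sums 1"
proof -
  have "(\<lambda>n. \<integral>y. (taboo ^^ n) (\<lambda>_. 1 :: real) y \<partial>\<nu>) \<longlonglongrightarrow> 0"
  proof (rule tendsto_sandwich[OF always_eventually always_eventually tendsto_const])
    show "\<forall>n. 0 \<le> (\<integral>y. (taboo ^^ n) (\<lambda>_. 1 :: real) y \<partial>\<nu>)"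
      using taboo_one_bounds(1) space_nu by (auto intro!: Bochner_Integration.integral_nonneg)
    show "\<forall>n. (\<integral>y. (taboo ^^ n) (\<lambda>_. 1 :: real) y \<partial>\<nu>) \<le> lam ^ n * (\<integral>y. V y \<partial>\<nu>)"
    proof
      fix n
      have "(\<integral>y. (taboo ^^ n) (\<lambda>_. 1 :: real) y \<partial>\<nu>) \<le> (\<integral>y. lam ^ n * V y \<partial>\<nu>)"
        using V_bounded_int_nu[OF V_bounded_taboo_pow[OF V_bounded_one]] V_int_nu taboo_one_bounds(2) space_nu
        by (intro integral_mono) auto
      then show "(\<integral>y. (taboo ^^ n) (\<lambda>_. 1 :: real) y \<partial>\<nu>) \<le> lam ^ n * (\<integral>y. V y \<partial>\<nu>)" by simp
    qed
    show "(\<lambda>n. lam ^ n * (\<integral>y. V y \<partial>\<nu>)) \<longlonglongrightarrow> 0"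
      using lam_pos lam_less by (intro tendsto_mult_left_zero LIMSEQ_realpow_zero) auto
  qed
  then have "(\<lambda>n. 1 - (\<integral>y. (taboo ^^ n) (\<lambda>_. 1 :: real) y \<partial>\<nu>)) \<longlonglongrightarrow> 1 - 0" by (intro tendsto_intros)
  then show ?thesis by (simp add: sums_def hit_nu_sum)
qed

lemma hit_nu_gen_partial: "(\<Sum>k<n. hit_nu k * (1 / lam) ^ k) \<le> K"
proof -
  have "(\<Sum>k<n. hit_nu k * (1 / lam) ^ k) = (\<integral>y. (\<Sum>k<n. hit k y * (1 / lam) ^ k) \<partial>\<nu>)"
    using V_bounded_int_nu[OF V_bounded_hit] by (simp add: hit_nu_def)
  also have "\<dots> \<le> (\<integral>y. V y \<partial>\<nu>)"
    using V_bounded_int_nu[OF V_bounded_hit] V_int_nu space_nu lam_pos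
    by (intro integral_mono Bochner_Integration.integrable_sum integrable_mult_left hit_gen_partial) auto
  finally show ?thesis using V_int_nu(2) by simp
qed

lemma hit_nu_R: "summable (\<lambda>k. hit_nu k * (1 / lam) ^ k)" "(\<Sum>k. hit_nu k * (1 / lam) ^ k) \<le> K"
proof -
  show s: "summable (\<lambda>k. hit_nu k * (1 / lam) ^ k)"
    using hit_nu_gen_partial hit_nu_nonneg lam_pos by (intro summableI_nonneg_bounded[of _ K]) auto
  show "(\<Sum>k. hit_nu k * (1 / lam) ^ k) \<le> K" using hit_nu_gen_partial by (intro suminf_le_const s) auto
qed

lemma return_law_Suc_sums: "(\<lambda>n. return_law n * x ^ n) sums (x * s)" if "(\<lambda>k. hit_nu k * x ^ k) sums s" for x s :: real
proof -
  have "(\<lambda>k. return_law (Suc k) * x ^ Suc k) sums (x * s)"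
    using sums_mult[OF that, of x] by (simp add: return_law_def algebra_simps)
  then show ?thesis by (subst (asm) sums_Suc_iff) (simp add: return_law_def)
qed

sublocale returns: renewal_drift return_law b "1 / lam" lam K
proof
  note s = return_law_Suc_sums[OF summable_sums[OF hit_nu_R(1)]]
  show "0 \<le> return_law n" for n using hit_nu_nonneg by (simp add: return_law_def split: nat.split)
  show "return_law 0 = 0" by (simp add: return_law_def)
  show "return_law sums 1" using return_law_Suc_sums[of 1 1] hit_nu_sums by simp
  show "0 < b" "b < 1" by (rule b_bounds)+
  show "b \<le> return_law 1" using b_le by (simp add: return_law_def hit_nu_def hit_0[abs_def] space_nu[symmetric] hit_def)
  show "1 < 1 / lam" using lam_pos lam_less by simp
  show "summable (\<lambda>n. return_law n * (1 / lam) ^ n)" using s by (simp add: sums_iff)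
  show "1 / lam = R_par lam" by (simp add: R_par_def)
  have "1 / lam * (\<Sum>k. hit_nu k * (1 / lam) ^ k) \<le> 1 / lam * K" using hit_nu_R(2) lam_pos by (intro mult_left_mono) auto
  then show "(\<Sum>n. return_law n * (1 / lam) ^ n) \<le> L_par lam K" using s by (simp add: sums_iff L_par_def)
qed

section \<open>Regeneration and the stationary law\<close>

definition taboo_nu :: "('a \<Rightarrow> complex) \<Rightarrow> nat \<Rightarrow> complex" where "taboo_nu g i = (\<integral>y. (taboo ^^ i) g y \<partial>\<nu>)"
definition kernel_nu :: "('a \<Rightarrow> complex) \<Rightarrow> nat \<Rightarrow> complex" where "kernel_nu g n = (\<integral>y. (kernel_op P ^^ n) g y \<partial>\<nu>)"

lemma kernel_pow_Suc: "(kernel_op P ^^ Suc n) g x = (\<integral>y. (kernel_op P ^^ n) g y \<partial>P x)"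
  by (simp add: kernel_op_def[of P "(kernel_op P ^^ n) g"])

text \<open>
  Decomposition at the first visit to \<open>C\<close>, at a time \<open>k < n\<close>. The next point has law \<open>\<nu>\<close> whatever the point of
  \<open>C\<close>, so the remaining \<open>n - k - 1\<close> steps start from \<open>\<nu>\<close>.
\<close>

lemma first_entrance:
  assumes g: "V_bounded B g" and x: "x \<in> space S"
  shows "(kernel_op P ^^ n) g x = (taboo ^^ n) g x + (\<Sum>k<n. hit k x *\<^sub>R kernel_nu g (n - Suc k))"
  using x
proof (induction n arbitrary: x)
  case (Suc n)
  show ?case
  proof (cases "x \<in> C")
    case True
    have "(\<Sum>k<Suc n. hit k x *\<^sub>R kernel_nu g (Suc n - Suc k)) = kernel_nu g n"
      unfolding sum.lessThan_Suc_shift using True by (simp add: hit_0 hit_Suc taboo_def)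
    moreover have "kernel_op P h x = (\<integral>y. h y \<partial>\<nu>)" for h by (simp add: kernel_op_def P_atom[OF True])
    then have "(kernel_op P ^^ Suc n) g x = kernel_nu g n" by (simp add: kernel_nu_def)
    ultimately show ?thesis using True by (simp add: taboo_def)
  next
    case False
    have "(kernel_op P ^^ Suc n) g x = (\<integral>y. (taboo ^^ n) g y + (\<Sum>k<n. hit k y *\<^sub>R kernel_nu g (n - Suc k)) \<partial>P x)"
      unfolding kernel_pow_Suc
      by (rule Bochner_Integration.integral_cong) (simp_all add: space_P[OF Suc.prems] Suc.IH)
    also have "\<dots> = (\<integral>y. (taboo ^^ n) g y \<partial>P x) + (\<Sum>k<n. (\<integral>y. hit k y \<partial>P x) *\<^sub>R kernel_nu g (n - Suc k))"
      using V_bounded_int_P[OF V_bounded_taboo_pow[OF g] Suc.prems] V_bounded_int_P[OF V_bounded_hit Suc.prems] by simp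
    also have "\<dots> = (taboo ^^ Suc n) g x + (\<Sum>k<Suc n. hit k x *\<^sub>R kernel_nu g (Suc n - Suc k))"
      unfolding sum.lessThan_Suc_shift using False by (simp add: hit_0 hit_Suc taboo_def)
    finally show ?thesis .
  qed
qed simp

lemma kernel_nu_renewal:
  assumes g: "V_bounded B g"
  shows "kernel_nu g n = taboo_nu g n + (\<Sum>k<n. hit_nu k *\<^sub>R kernel_nu g (n - Suc k))"
proof -
  have "kernel_nu g n = (\<integral>y. (taboo ^^ n) g y + (\<Sum>k<n. hit k y *\<^sub>R kernel_nu g (n - Suc k)) \<partial>\<nu>)"
    unfolding kernel_nu_def[of g n] using first_entrance[OF g]
    by (auto simp: space_nu intro!: Bochner_Integration.integral_cong)
  then show ?thesis
    using V_bounded_int_nu[OF V_bounded_taboo_pow[OF g]] V_bounded_int_nu[OF V_bounded_hit] by (simp add: taboo_nu_def hit_nu_def)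
qed

text \<open>
  Decomposition at the last regeneration. It is the solution of the renewal equation
  \<open>kernel_nu_renewal\<close>, obtained by multiplying generating functions with the renewal series.
\<close>

lemma kernel_nu_eq:
  assumes g: "V_bounded B g"
  shows "kernel_nu g n = (\<Sum>j=0..n. of_real (renewal_seq return_law j) * taboo_nu g (n - j))"
proof -
  define F where "F = Abs_fps (\<lambda>n. complex_of_real (return_law n))"
  define U where "U = Abs_fps (\<lambda>n. complex_of_real (renewal_seq return_law n))"
  have U: "(1 - F) * U = 1" unfolding F_def U_def by (rule renewal_seq_fps[of return_law, OF returns.f0])
  have "Abs_fps (kernel_nu g) = Abs_fps (taboo_nu g) + F * Abs_fps (kernel_nu g)"
  proof (rule fps_ext)
    fix n
    have "(\<Sum>i=0..n. of_real (return_law i) * kernel_nu g (n - i)) = (\<Sum>k<n. hit_nu k *\<^sub>R kernel_nu g (n - Suc k))"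
    proof (cases n)
      case (Suc l)
      show ?thesis unfolding Suc by (subst sum.atLeast0_atMost_Suc_shift)
          (simp add: return_law_def scaleR_conv_of_real lessThan_Suc_atMost atMost_atLeast0 comp_def)
    qed (simp add: return_law_def)
    then show "fps_nth (Abs_fps (kernel_nu g)) n = fps_nth (Abs_fps (taboo_nu g) + F * Abs_fps (kernel_nu g)) n"
      by (simp add: F_def fps_mult_nth kernel_nu_renewal[OF g, of n])
  qed
  then have "(1 - F) * Abs_fps (kernel_nu g) = Abs_fps (taboo_nu g)" by (simp add: algebra_simps)
  then have "Abs_fps (kernel_nu g) = U * Abs_fps (taboo_nu g)"
    by (metis U mult.left_commute mult.commute mult_1)
  then have "fps_nth (Abs_fps (kernel_nu g)) n = fps_nth (U * Abs_fps (taboo_nu g)) n" by simp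
  then show ?thesis by (simp add: U_def fps_mult_nth)
qed

lemma taboo_nu_bound: assumes g: "V_bounded B g" shows "norm (taboo_nu g i) \<le> B * taboo_V_nu i"
proof -
  have "norm (taboo_nu g i) \<le> (\<integral>y. norm ((taboo ^^ i) g y) \<partial>\<nu>)" unfolding taboo_nu_def by (rule integral_norm_bound)
  also have "\<dots> \<le> (\<integral>y. B * taboo_V i y \<partial>\<nu>)"
    using V_bounded_int_nu[OF V_bounded_taboo_pow[OF g]] V_bounded_int_nu[OF V_bounded_taboo_V] taboo_pow_norm[OF g] space_nu
    by (intro integral_mono) (auto simp: taboo_V_def)
  finally show ?thesis by (simp add: taboo_V_nu_def)
qed

lemma integral_le_kernel_bound:
  assumes x: "x \<in> space S" shows "(\<integral>y. V y \<partial>P x) \<le> lam * V x + K"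
  using V_int_P[OF x] V_ge[OF x] lam_pos K_ge by (cases "x \<in> C") (auto intro: order_trans)

text \<open>
  Formally, integrating \<open>P V \<le> \<lambda> V + K\<close> against \<open>\<pi>\<close> gives \<open>(1 - \<lambda>) \<pi>(V) \<le> K\<close>, but this presupposes
  that \<open>\<pi>(V)\<close> is finite. The argument is therefore carried out for \<open>min V n\<close>, where all integrals
  exist, and gives a bound that does not depend on \<open>n\<close>.
\<close>

lemma integrable_pi_V: "integrable \<pi> V"
proof -
  interpret pi: prob_space \<pi> by (rule pi_prob)
  have [measurable]: "V \<in> borel_measurable \<pi>" by measurable
  have trunc: "(1 - lam) * (\<integral>x. (if V x \<le> real n then V x else 0) \<partial>\<pi>) \<le> K" for n
  proof -
    define h where "h x = min (V x) (real n)" for x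
    have hm: "h \<in> borel_measurable S" unfolding h_def by measurable
    have hb: "\<bar>h x\<bar> \<le> real n" if "x \<in> space S" for x using V_ge[OF that] by (simp add: h_def)
    have fin: "AE x in \<pi>. emeasure (P x) (space (P x)) \<le> ennreal 1"
      using prob_space.emeasure_space_1[OF P_prob] by (intro AE_I2) (simp add: space_pi)
    have eq: "(\<integral>x. h x \<partial>\<pi>) = (\<integral>x. \<integral>y. h y \<partial>P x \<partial>\<pi>)"
      using integral_bind[OF hm hb _ pi.finite_measure_axioms fin] P_sub pi_bind
      by (simp add: measurable_cong_sets[OF pi_sets])
    have le: "(\<integral>y. h y \<partial>P x) \<le> min (lam * V x + K) (real n)" if x: "x \<in> space S" for x
    proof -
      interpret Px: prob_space "P x" by (rule P_prob[OF x])
      have hP: "h \<in> borel_measurable (P x)" using hm x by (simp add: measurable_cong_sets[OF P_sets])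
      have ih: "integrable (P x) h"
        by (rule Px.integrable_const_bound[of _ "real n"]) (use hb x hP in \<open>auto simp: space_P intro!: AE_I2\<close>)
      have "(\<integral>y. h y \<partial>P x) \<le> (\<integral>y. V y \<partial>P x)"
        by (rule integral_mono[OF ih V_int_P(1)[OF x]]) (simp add: h_def)
      moreover have "(\<integral>y. h y \<partial>P x) \<le> (\<integral>y. real n \<partial>P x)"
        by (rule integral_mono[OF ih]) (simp_all add: h_def)
      ultimately show ?thesis using integral_le_kernel_bound[OF x] by (simp add: Px.prob_space)
    qed
    have ih: "integrable \<pi> h"
      by (rule pi.integrable_const_bound[of _ "real n"]) (use hb hm in \<open>auto simp: space_pi measurable_cong_sets[OF pi_sets] intro!: AE_I2\<close>)
    have im: "integrable \<pi> (\<lambda>x. min (lam * V x + K) (real n))"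
    proof (rule pi.integrable_const_bound[of _ "real n"])
      have "0 \<le> lam * V x + K" if "x \<in> space S" for x using V_ge[OF that] lam_pos K_ge by simp
      then show "AE x in \<pi>. norm (min (lam * V x + K) (real n)) \<le> real n"
        by (intro AE_I2) (force simp: space_pi)
    qed measurable
    have iv: "integrable \<pi> (\<lambda>x. (if V x \<le> real n then V x else 0))"
      by (rule pi.integrable_const_bound[of _ "real n"]) (use V_ge in \<open>force simp: space_pi intro!: AE_I2\<close>, measurable)
    have "(\<integral>x. h x \<partial>\<pi>) \<le> (\<integral>x. min (lam * V x + K) (real n) \<partial>\<pi>)"
      unfolding eq
    proof (rule integral_mono)
      show "integrable \<pi> (\<lambda>x. \<integral>y. h y \<partial>P x)"
      proof (rule pi.integrable_const_bound[of _ "real n"])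
        show "AE x in \<pi>. norm (\<integral>y. h y \<partial>P x) \<le> real n"
        proof (rule AE_I2)
          fix x assume "x \<in> space \<pi>"
          then have x: "x \<in> space S" by (simp add: space_pi)
          have "0 \<le> (\<integral>y. h y \<partial>P x)"
            using V_ge x by (intro Bochner_Integration.integral_nonneg) (force simp: h_def space_P)
          then show "norm (\<integral>y. h y \<partial>P x) \<le> real n" using le[OF x] by simp
        qed
        show "(\<lambda>x. \<integral>y. h y \<partial>P x) \<in> borel_measurable \<pi>"
          using measurable_kernel_integral[OF hm] by (simp add: measurable_cong_sets[OF pi_sets])
      qed
    qed (use im le space_pi in auto)
    then have "0 \<le> (\<integral>x. min (lam * V x + K) (real n) - h x \<partial>\<pi>)" using im ih by simp
    also have "\<dots> \<le> (\<integral>x. K - (1 - lam) * (if V x \<le> real n then V x else 0) \<partial>\<pi>)"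
    proof (rule integral_mono)
      show "integrable \<pi> (\<lambda>x. min (lam * V x + K) (real n) - h x)"
        by (rule Bochner_Integration.integrable_diff[OF im ih])
      show "integrable \<pi> (\<lambda>x. K - (1 - lam) * (if V x \<le> real n then V x else 0))"
        by (intro Bochner_Integration.integrable_diff integrable_mult_right iv pi.integrable_const)
      fix x
      show "min (lam * V x + K) (real n) - h x \<le> K - (1 - lam) * (if V x \<le> real n then V x else 0)"
        using K_ge by (auto simp: h_def min_def algebra_simps)
    qed
    also have "\<dots> = K - (1 - lam) * (\<integral>x. (if V x \<le> real n then V x else 0) \<partial>\<pi>)"
      using iv by (simp add: pi.prob_space)
    finally show ?thesis by simp
  qed
  have "(\<lambda>n. \<integral>\<^sup>+x. ennreal (if V x \<le> real n then V x else 0) \<partial>\<pi>) \<longlonglongrightarrow> (\<integral>\<^sup>+x. ennreal (V x) \<partial>\<pi>)"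
  proof (rule nn_integral_LIMSEQ)
    show "incseq (\<lambda>n x. ennreal (if V x \<le> real n then V x else 0))"
      by (auto simp: incseq_def le_fun_def)
    fix x
    obtain N where N: "V x \<le> real N" using real_arch_simple by blast
    have "eventually (\<lambda>n. ennreal (if V x \<le> real n then V x else 0) = ennreal (V x)) sequentially"
      using N by (intro eventually_sequentiallyI[of N]) (auto dest: of_nat_mono[where 'a = real])
    then show "(\<lambda>n. ennreal (if V x \<le> real n then V x else 0)) \<longlonglongrightarrow> ennreal (V x)"
      by (rule tendsto_eventually)
  qed measurable
  moreover have "(\<integral>\<^sup>+x. ennreal (if V x \<le> real n then V x else 0) \<partial>\<pi>) \<le> ennreal (K / (1 - lam))" for n
  proof -
    have iv: "integrable \<pi> (\<lambda>x. (if V x \<le> real n then V x else 0))"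
      by (rule pi.integrable_const_bound[of _ "real n"]) (use V_ge in \<open>force simp: space_pi intro!: AE_I2\<close>, measurable)
    have "(\<integral>\<^sup>+x. ennreal (if V x \<le> real n then V x else 0) \<partial>\<pi>) = ennreal (\<integral>x. (if V x \<le> real n then V x else 0) \<partial>\<pi>)"
      using V_ge by (intro nn_integral_eq_integral iv AE_I2) (force simp: space_pi)
    then show ?thesis using trunc[of n] lam_less by (simp add: pos_le_divide_eq mult.commute ennreal_leI)
  qed
  ultimately have "(\<integral>\<^sup>+x. ennreal (V x) \<partial>\<pi>) \<le> ennreal (K / (1 - lam))" by (blast intro: LIMSEQ_le_const2)
  then have "(\<integral>\<^sup>+x. ennreal (V x) \<partial>\<pi>) < \<infinity>" by (auto simp: le_less_trans)
  then show ?thesis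
    using V_ge by (intro integrableI_nonneg AE_I2) (force simp: space_pi)+
qed

lemma V_bounded_int_pi: "V_bounded B g \<Longrightarrow> integrable \<pi> g"
  using V_bounded_integrable pi_sets integrable_pi_V by blast

text \<open>
  For nonnegative functions this is the integral formula for \<open>\<pi> \<bind> P\<close>; a function \<open>g\<close> with
  \<open>|g| \<le> B V\<close> is the difference of the nonnegative functions \<open>g + B V\<close> and \<open>B V\<close>.
\<close>

lemma stationary_integral_real:
  fixes g :: "'a \<Rightarrow> real"
  assumes g: "V_bounded B g"
  shows "(\<integral>x. g x \<partial>\<pi>) = (\<integral>x. \<integral>y. g y \<partial>P x \<partial>\<pi>)"
proof -
  have dk: "V_bounded (B' * (lam + K)) (\<lambda>x. \<integral>y. h y \<partial>P x)" if h: "V_bounded B' h" for h :: "'a \<Rightarrow> real" and B'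
  proof -
    have "norm (\<integral>y. h y \<partial>P x) \<le> B' * (lam + K) * V x" if x: "x \<in> space S" for x
    proof -
      have "K * 1 \<le> K * V x" using V_ge[OF x] K_ge by (intro mult_left_mono) auto
      then have "(\<integral>y. V y \<partial>P x) \<le> (lam + K) * V x"
        using integral_le_kernel_bound[OF x] by (simp add: distrib_right)
      then have "B' * (\<integral>y. V y \<partial>P x) \<le> B' * ((lam + K) * V x)" using V_bounded_nonneg[OF h] by (rule mult_left_mono)
      then show ?thesis using V_bounded_norm_integral[OF h P_sets[OF x] V_int_P(1)[OF x]] by (simp add: mult.assoc)
    qed
    then show ?thesis using measurable_kernel_integral[OF V_bounded_meas[OF h]] by (simp add: V_bounded_def)
  qed
  have nonneg: "(\<integral>x. h x \<partial>\<pi>) = (\<integral>x. \<integral>y. h y \<partial>P x \<partial>\<pi>)"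
    if h: "V_bounded B' h" and h0: "\<And>x. x \<in> space S \<Longrightarrow> 0 \<le> h x" for h :: "'a \<Rightarrow> real" and B'
  proof -
    have hm: "(\<lambda>x. ennreal (h x)) \<in> borel_measurable S" using V_bounded_meas[OF h] by measurable
    have Psub: "P \<in> \<pi> \<rightarrow>\<^sub>M subprob_algebra S" using P_sub by (simp add: measurable_cong_sets[OF pi_sets])
    have i0: "0 \<le> (\<integral>y. h y \<partial>P x)" if "x \<in> space S" for x
      using h0 that by (intro Bochner_Integration.integral_nonneg) (simp add: space_P)
    have "ennreal (\<integral>x. h x \<partial>\<pi>) = (\<integral>\<^sup>+x. ennreal (h x) \<partial>\<pi>)"
      using V_bounded_int_pi[OF h] h0 by (intro nn_integral_eq_integral[symmetric] AE_I2) (simp_all add: space_pi)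
    also have "\<dots> = (\<integral>\<^sup>+x. \<integral>\<^sup>+y. ennreal (h y) \<partial>P x \<partial>\<pi>)"
      using nn_integral_bind[OF hm Psub] by (simp add: pi_bind)
    also have "\<dots> = (\<integral>\<^sup>+x. ennreal (\<integral>y. h y \<partial>P x) \<partial>\<pi>)"
      using V_bounded_int_P[OF h] h0
      by (intro nn_integral_cong nn_integral_eq_integral AE_I2) (simp_all add: space_pi space_P)
    also have "\<dots> = ennreal (\<integral>x. \<integral>y. h y \<partial>P x \<partial>\<pi>)"
      using V_bounded_int_pi[OF dk[OF h]] i0 by (intro nn_integral_eq_integral AE_I2) (simp_all add: space_pi)
    finally show ?thesis using h0 i0
      by (subst (asm) ennreal_inj) (auto intro!: Bochner_Integration.integral_nonneg simp: space_pi space_P)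
  qed
  have dBV: "V_bounded B (\<lambda>x. B * V x)" using V_bounded_nonneg[OF g] V_ge by (force simp: V_bounded_def abs_mult)
  have s: "V_bounded (B + B) (\<lambda>x. g x + B * V x)" by (rule V_bounded_add[OF g dBV])
  have "(\<integral>x. g x + B * V x \<partial>\<pi>) = (\<integral>x. \<integral>y. g y + B * V y \<partial>P x \<partial>\<pi>)"
    by (rule nonneg[OF s]) (use V_boundedD[OF g] in \<open>force simp: abs_le_iff\<close>)
  also have "\<dots> = (\<integral>x. (\<integral>y. g y \<partial>P x) + (\<integral>y. B * V y \<partial>P x) \<partial>\<pi>)"
    by (rule Bochner_Integration.integral_cong)
      (simp_all only: space_pi Bochner_Integration.integral_add V_bounded_int_P[OF g] V_bounded_int_P[OF dBV])
  also have "\<dots> = (\<integral>x. (\<integral>y. g y \<partial>P x) \<partial>\<pi>) + (\<integral>x. (\<integral>y. B * V y \<partial>P x) \<partial>\<pi>)"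
    by (rule Bochner_Integration.integral_add[OF V_bounded_int_pi[OF dk[OF g]] V_bounded_int_pi[OF dk[OF dBV]]])
  also have "(\<integral>x. (\<integral>y. B * V y \<partial>P x) \<partial>\<pi>) = (\<integral>x. B * V x \<partial>\<pi>)"
    by (rule nonneg[OF dBV, symmetric]) (use V_bounded_nonneg[OF g] V_ge in force)
  also have "(\<integral>x. g x + B * V x \<partial>\<pi>) = (\<integral>x. g x \<partial>\<pi>) + (\<integral>x. B * V x \<partial>\<pi>)"
    by (rule Bochner_Integration.integral_add[OF V_bounded_int_pi[OF g] V_bounded_int_pi[OF dBV]])
  finally show ?thesis by simp
qed

lemma stationary_integral:
  fixes g :: "'a \<Rightarrow> complex"
  assumes g: "V_bounded B g"
  shows "(\<integral>x. kernel_op P g x \<partial>\<pi>) = (\<integral>x. g x \<partial>\<pi>)"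
proof -
  have re: "V_bounded B (\<lambda>x. Re (g x))" and im: "V_bounded B (\<lambda>x. Im (g x))"
    using g abs_Re_le_cmod abs_Im_le_cmod by (force simp: V_bounded_def intro: order_trans)+
  have ik: "integrable \<pi> (kernel_op P g)" by (rule V_bounded_int_pi[OF V_bounded_kernel[OF g]])
  show ?thesis
  proof (rule complex_eqI)
    have "Re (\<integral>x. kernel_op P g x \<partial>\<pi>) = (\<integral>x. \<integral>y. Re (g y) \<partial>P x \<partial>\<pi>)"
      unfolding integral_Re[OF ik, symmetric]
      by (rule Bochner_Integration.integral_cong) (simp_all add: space_pi V_bounded_int_P[OF g] kernel_op_def)
    then show "Re (\<integral>x. kernel_op P g x \<partial>\<pi>) = Re (\<integral>x. g x \<partial>\<pi>)"
      unfolding integral_Re[OF V_bounded_int_pi[OF g], symmetric] stationary_integral_real[OF re] .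
    have "Im (\<integral>x. kernel_op P g x \<partial>\<pi>) = (\<integral>x. \<integral>y. Im (g y) \<partial>P x \<partial>\<pi>)"
      unfolding integral_Im[OF ik, symmetric]
      by (rule Bochner_Integration.integral_cong) (simp_all add: space_pi V_bounded_int_P[OF g] kernel_op_def)
    then show "Im (\<integral>x. kernel_op P g x \<partial>\<pi>) = Im (\<integral>x. g x \<partial>\<pi>)"
      unfolding integral_Im[OF V_bounded_int_pi[OF g], symmetric] stationary_integral_real[OF im] .
  qed
qed

abbreviation "p \<equiv> measure \<pi> C"

lemma pi_split:
  fixes g :: "'a \<Rightarrow> complex"
  assumes g: "V_bounded B g"
  shows "(\<integral>x. g x \<partial>\<pi>) = (\<integral>x. taboo g x \<partial>\<pi>) + p *\<^sub>R (\<integral>x. g x \<partial>\<nu>)"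
proof -
  interpret pi: prob_space \<pi> by (rule pi_prob)
  have "(\<integral>x. g x \<partial>\<pi>) = (\<integral>x. taboo g x + indicator C x *\<^sub>R (\<integral>x. g x \<partial>\<nu>) \<partial>\<pi>)"
    unfolding stationary_integral[OF g, symmetric] kernel_op_def
    by (rule Bochner_Integration.integral_cong) (auto simp: taboo_def P_atom)
  also have "\<dots> = (\<integral>x. taboo g x \<partial>\<pi>) + (\<integral>x. indicator C x *\<^sub>R (\<integral>x. g x \<partial>\<nu>) \<partial>\<pi>)"
    by (intro Bochner_Integration.integral_add V_bounded_int_pi[OF V_bounded_taboo[OF g]] integrable_scaleR_left)
      (simp add: pi.integrable_const_bound[of _ 1])
  also have "(\<integral>x. indicator C x *\<^sub>R (\<integral>x. g x \<partial>\<nu>) \<partial>\<pi>) = p *\<^sub>R (\<integral>x. g x \<partial>\<nu>)"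
  proof -
    have "C \<inter> space \<pi> = C" using C_sub by (auto simp: space_pi)
    moreover have "integrable \<pi> (indicator C :: 'a \<Rightarrow> real)" by (simp add: pi.integrable_const_bound[of _ 1])
    ultimately show ?thesis by simp
  qed
  finally show ?thesis .
qed

text \<open>
  Iterating \<open>pi_split\<close> leaves the remainder \<open>\<pi>(Q\<^sup>n g)\<close>, which is at most \<open>B \<lambda>\<^sup>n \<pi>(V)\<close>.
\<close>

lemma pi_sums:
  fixes g :: "'a \<Rightarrow> complex"
  assumes g: "V_bounded B g"
  shows "(\<lambda>j. p *\<^sub>R taboo_nu g j) sums (\<integral>x. g x \<partial>\<pi>)"
proof -
  have it: "(\<integral>x. g x \<partial>\<pi>) = (\<integral>x. (taboo ^^ n) g x \<partial>\<pi>) + (\<Sum>j<n. p *\<^sub>R taboo_nu g j)" for n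
  proof (induction n)
    case (Suc n)
    then show ?case using pi_split[OF V_bounded_taboo_pow[OF g], of n] by (simp add: taboo_nu_def)
  qed simp
  have "(\<lambda>n. \<integral>x. (taboo ^^ n) g x \<partial>\<pi>) \<longlonglongrightarrow> 0"
  proof (rule Lim_null_comparison[OF always_eventually])
    show "\<forall>n. norm (\<integral>x. (taboo ^^ n) g x \<partial>\<pi>) \<le> B * lam ^ n * (\<integral>x. V x \<partial>\<pi>)"
      using V_bounded_norm_integral[OF V_bounded_taboo_pow[OF g] pi_sets integrable_pi_V] by simp
    show "(\<lambda>n. B * lam ^ n * (\<integral>x. V x \<partial>\<pi>)) \<longlonglongrightarrow> 0"
      using lam_pos lam_less by (intro tendsto_mult_left_zero tendsto_mult_right_zero LIMSEQ_realpow_zero) auto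
  qed
  then have "(\<lambda>n. (\<integral>x. g x \<partial>\<pi>) - (\<integral>x. (taboo ^^ n) g x \<partial>\<pi>)) \<longlonglongrightarrow> (\<integral>x. g x \<partial>\<pi>) - 0"
    by (intro tendsto_intros)
  moreover have "(\<integral>x. g x \<partial>\<pi>) - (\<integral>x. (taboo ^^ n) g x \<partial>\<pi>) = (\<Sum>j<n. p *\<^sub>R taboo_nu g j)" for n
    using it[of n] by simp
  ultimately show ?thesis by (simp add: sums_def)
qed

lemma taboo_pow_of_real: "(taboo ^^ n) (\<lambda>x. complex_of_real (h x)) = (\<lambda>x. of_real ((taboo ^^ n) h x))"
proof (induction n)
  case (Suc n)
  have "taboo (\<lambda>x. complex_of_real (h' x)) = (\<lambda>x. of_real (taboo h' x))" for h'
    by (auto simp: taboo_def fun_eq_iff)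
  then show ?case using Suc by simp
qed simp

lemma tail_return_law: "tail return_law n = (\<integral>y. (taboo ^^ n) (\<lambda>_. 1 :: real) y \<partial>\<nu>)"
proof -
  have "tail return_law n = (\<Sum>k. hit_nu (k + n))" by (simp add: tail_def return_law_def)
  also have "\<dots> = 1 - (\<Sum>k<n. hit_nu k)"
    using suminf_minus_initial_segment[of hit_nu n] hit_nu_sums by (simp add: sums_iff)
  finally show ?thesis by (simp add: hit_nu_sum)
qed

text \<open>
  Kac's formula: \<open>pi_sums\<close> for the constant function \<open>1\<close>.
\<close>

lemma kac: "p = 1 / returns.mean_wait"
proof -
  have "(\<integral>x. 1 \<partial>\<pi>) = (1 :: complex)" using prob_space.prob_space[OF pi_prob] by simp
  moreover have "taboo_nu (\<lambda>_. 1) j = of_real (tail return_law j)" for j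
    using taboo_pow_of_real[of j "\<lambda>_. 1"] by (simp add: taboo_nu_def tail_return_law)
  ultimately have "(\<lambda>j. complex_of_real (p * tail return_law j)) sums of_real 1"
    using pi_sums[OF V_bounded_one_c] by (simp add: scaleR_conv_of_real)
  then have "(\<lambda>j. p * tail return_law j) sums 1" by (simp only: sums_of_real_iff)
  moreover have "(\<lambda>j. p * tail return_law j) sums (p * returns.mean_wait)"
    using returns.surv_summable unfolding returns.mean_wait_def returns.surv_def by (intro sums_mult summable_sums)
  ultimately have "p * returns.mean_wait = 1" by (rule sums_unique2[symmetric])
  then show ?thesis using returns.mean_wait_ge_1 by (simp add: field_simps)
qed

section \<open>Convergence of the iterates\<close>

lemma taboo_V_nu_pow_le: "taboo_V_nu (n + k) \<le> lam ^ n * taboo_V_nu k"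
proof (induction n)
  case (Suc n)
  have "taboo_V_nu (Suc n + k) \<le> lam * (taboo_V_nu (n + k) - hit_nu (n + k))" using taboo_V_nu_step[of "n + k"] by simp
  also have "\<dots> \<le> lam * (lam ^ n * taboo_V_nu k)" using Suc hit_nu_nonneg[of "n + k"] lam_pos by (intro mult_left_mono) auto
  finally show ?case by simp
qed simp

lemma taboo_V_nu_summable: assumes "0 \<le> r" "r * lam < 1" shows "summable (\<lambda>i. taboo_V_nu i * r ^ i)"
proof (rule summable_comparison_test')
  show "summable (\<lambda>i. K * (r * lam) ^ i)" using assms lam_pos by (intro summable_mult summable_geometric) auto
  fix i
  have "taboo_V_nu i \<le> lam ^ i * K" using taboo_V_nu_pow_le[of i 0] taboo_V_nu_0 lam_pos by (auto intro: order_trans mult_left_mono)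
  then have "taboo_V_nu i * r ^ i \<le> lam ^ i * K * r ^ i" using assms by (intro mult_right_mono) auto
  then show "norm (taboo_V_nu i * r ^ i) \<le> K * (r * lam) ^ i"
    using taboo_V_nu_nonneg assms by (simp add: power_mult_distrib mult_ac)
qed

text \<open>
  Sum \<open>taboo_V_nu_step\<close> against \<open>r ^ (n + 1)\<close>. The hitting term contributes \<open>r \<lambda> \<Sum> hit_nu k r\<^sup>k \<ge> r \<lambda>\<close>,
  because \<open>C\<close> is reached almost surely.
\<close>

lemma taboo_V_nu_gen: assumes r: "1 \<le> r" "r * lam < 1" shows "(\<Sum>i. taboo_V_nu i * r ^ i) \<le> (K - r * lam) / (1 - r * lam)"
proof -
  have sM: "summable (\<lambda>i. taboo_V_nu i * r ^ i)" using r by (intro taboo_V_nu_summable) auto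
  have sq: "summable (\<lambda>i. hit_nu i * r ^ i)"
  proof (rule summable_comparison_test'[OF hit_nu_R(1)])
    fix i
    have "r \<le> 1 / lam" using r lam_pos by (simp add: field_simps)
    then have "hit_nu i * r ^ i \<le> hit_nu i * (1 / lam) ^ i" using r hit_nu_nonneg by (intro mult_left_mono power_mono) auto
    then show "norm (hit_nu i * r ^ i) \<le> hit_nu i * (1 / lam) ^ i" using hit_nu_nonneg r by simp
  qed
  have "(\<Sum>i. hit_nu i) \<le> (\<Sum>i. hit_nu i * r ^ i)"
  proof (rule suminf_le[OF _ sums_summable[OF hit_nu_sums] sq])
    fix i show "hit_nu i \<le> hit_nu i * r ^ i" using mult_left_mono[OF one_le_power[OF r(1)] hit_nu_nonneg, of i i] by simp
  qed
  then have q1: "1 \<le> (\<Sum>i. hit_nu i * r ^ i)" using hit_nu_sums by (simp add: sums_iff)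
  have s': "summable (\<lambda>i. r * lam * (taboo_V_nu i * r ^ i - hit_nu i * r ^ i))" by (intro summable_mult summable_diff sM sq)
  have "(\<Sum>i. taboo_V_nu (Suc i) * r ^ Suc i) \<le> (\<Sum>i. r * lam * (taboo_V_nu i * r ^ i - hit_nu i * r ^ i))"
  proof (rule suminf_le)
    fix i
    have "taboo_V_nu (Suc i) * r ^ Suc i \<le> lam * (taboo_V_nu i - hit_nu i) * r ^ Suc i" using taboo_V_nu_step r by (intro mult_right_mono) auto
    then show "taboo_V_nu (Suc i) * r ^ Suc i \<le> r * lam * (taboo_V_nu i * r ^ i - hit_nu i * r ^ i)" by (simp add: algebra_simps)
  qed (use sM s' summable_ignore_initial_segment[OF sM, of 1] in auto)
  also have "\<dots> = r * lam * ((\<Sum>i. taboo_V_nu i * r ^ i) - (\<Sum>i. hit_nu i * r ^ i))"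
    by (simp add: suminf_mult[OF summable_diff[OF sM sq]] suminf_diff[OF sM sq])
  also have "\<dots> \<le> r * lam * ((\<Sum>i. taboo_V_nu i * r ^ i) - 1)" using q1 r lam_pos by (intro mult_left_mono) auto
  finally have "(\<Sum>i. taboo_V_nu i * r ^ i) \<le> K + r * lam * ((\<Sum>i. taboo_V_nu i * r ^ i) - 1)"
    using suminf_split_head[OF sM] taboo_V_nu_0 by simp
  then have "(\<Sum>i. taboo_V_nu i * r ^ i) * (1 - r * lam) \<le> K - r * lam" by (simp add: algebra_simps)
  then show ?thesis using r by (simp add: pos_le_divide_eq)
qed

lemma taboo_V_nu_sum: "summable taboo_V_nu" "(\<Sum>i. taboo_V_nu i) \<le> (K - lam) / (1 - lam)"
  using taboo_V_nu_summable[of 1] taboo_V_nu_gen[of 1] lam_less by auto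

text \<open>
  The first step uses the hitting term, which produces \<open>K - 1\<close> instead of \<open>K - \<lambda>\<close>; the later ones only
  the factor \<open>\<lambda>\<close>.
\<close>

lemma taboo_V_nu_tail: "(\<Sum>i. taboo_V_nu (i + Suc n)) \<le> lam ^ n * (lam * (K - 1) / (1 - lam))"
proof -
  have s1: "summable (\<lambda>i. taboo_V_nu (Suc i))" using summable_ignore_initial_segment[OF taboo_V_nu_sum(1), of 1] by simp
  have "(\<Sum>i. taboo_V_nu (i + Suc n)) \<le> (\<Sum>i. lam ^ n * taboo_V_nu (Suc i))"
  proof (rule suminf_le)
    fix i show "taboo_V_nu (i + Suc n) \<le> lam ^ n * taboo_V_nu (Suc i)" using taboo_V_nu_pow_le[of n "Suc i"] by (simp add: add_ac)
  qed (intro summable_ignore_initial_segment taboo_V_nu_sum summable_mult s1)+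
  also have "\<dots> = lam ^ n * (\<Sum>i. taboo_V_nu (Suc i))" by (rule suminf_mult[OF s1])
  also have "\<dots> \<le> lam ^ n * (lam * (K - 1) / (1 - lam))"
  proof (rule mult_left_mono)
    have sq: "summable hit_nu" using hit_nu_sums by (rule sums_summable)
    have "(\<Sum>i. taboo_V_nu (Suc i)) \<le> (\<Sum>i. lam * (taboo_V_nu i - hit_nu i))"
      by (intro suminf_le taboo_V_nu_step s1 summable_mult summable_diff taboo_V_nu_sum sq)
    also have "\<dots> = lam * ((\<Sum>i. taboo_V_nu i) - 1)"
      using hit_nu_sums by (simp add: suminf_mult[OF summable_diff[OF taboo_V_nu_sum(1) sq]] suminf_diff[OF taboo_V_nu_sum(1) sq, symmetric] sums_iff)
    also have "\<dots> \<le> lam * ((K - lam) / (1 - lam) - 1)" using taboo_V_nu_sum(2) lam_pos by (intro mult_left_mono) auto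
    also have "\<dots> = lam * (K - 1) / (1 - lam)" using lam_less by (simp add: field_simps)
    finally show "(\<Sum>i. taboo_V_nu (Suc i)) \<le> lam * (K - 1) / (1 - lam)" .
  qed (use lam_pos in auto)
  finally show ?thesis .
qed

lemma p_bounds: "0 < p" "p \<le> 1"
  using returns.mean_wait_ge_1 by (auto simp: kac)

lemma pi_norm: assumes g: "V_bounded B g" shows "norm (\<integral>x. g x \<partial>\<pi> :: complex) \<le> B * ((K - lam) / (1 - lam))"
proof -
  have "norm (\<integral>x. g x \<partial>\<pi>) \<le> (\<Sum>j. B * taboo_V_nu j)"
    unfolding sums_unique[OF pi_sums[OF g]]
  proof (rule norm_suminf_le)
    fix j
    have "p * norm (taboo_nu g j) \<le> 1 * (B * taboo_V_nu j)" using taboo_nu_bound[OF g] p_bounds by (intro mult_mono) auto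
    then show "norm (p *\<^sub>R taboo_nu g j) \<le> B * taboo_V_nu j" using p_bounds by simp
  qed (intro summable_mult taboo_V_nu_sum)
  also have "\<dots> = B * (\<Sum>j. taboo_V_nu j)" by (rule suminf_mult[OF taboo_V_nu_sum(1)])
  also have "\<dots> \<le> B * ((K - lam) / (1 - lam))" using taboo_V_nu_sum(2) V_bounded_nonneg[OF g] by (rule mult_left_mono)
  finally show ?thesis .
qed

text \<open>
  In the difference of \<open>kernel_nu_eq\<close> and \<open>pi_sums\<close>, the first \<open>n + 1\<close> excursion terms are multiplied by
  deviations of the renewal sequence, and the others form a tail that decays like \<open>\<lambda>\<^sup>n\<close>.
\<close>

lemma kernel_nu_rate:
  assumes g: "V_bounded B g" and r: "1 \<le> r" "r * lam < 1" and K0: "\<And>n. \<bar>returns.dev n\<bar> * r ^ n \<le> K0"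
  shows "norm (kernel_nu g n - (\<integral>x. g x \<partial>\<pi>)) * r ^ n
    \<le> B * (K0 * ((K - r * lam) / (1 - r * lam)) + lam * (K - 1) / (1 - lam))"
proof -
  have K00: "0 \<le> K0" using K0[of 0] by (rule order_trans[rotated]) simp
  note B = V_bounded_nonneg[OF g]
  have sp: "summable (\<lambda>j. p *\<^sub>R taboo_nu g j)" using pi_sums[OF g] by (rule sums_summable)
  have "(\<integral>x. g x \<partial>\<pi>) = (\<Sum>j. p *\<^sub>R taboo_nu g (j + Suc n)) + (\<Sum>j<Suc n. p *\<^sub>R taboo_nu g j)"
    unfolding sums_unique[OF pi_sums[OF g]] by (rule suminf_split_initial_segment[OF sp])
  also have "(\<Sum>j<Suc n. p *\<^sub>R taboo_nu g j) = (\<Sum>j=0..n. p *\<^sub>R taboo_nu g (n - j))"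
    by (subst sum.atLeastAtMost_rev) (simp add: lessThan_Suc_atMost atMost_atLeast0)
  finally have eq: "kernel_nu g n - (\<integral>x. g x \<partial>\<pi>)
     = (\<Sum>j=0..n. of_real (returns.dev j) * taboo_nu g (n - j)) - (\<Sum>j. p *\<^sub>R taboo_nu g (j + Suc n))"
    by (simp add: kernel_nu_eq[OF g] returns.dev_def kac[symmetric] scaleR_conv_of_real sum_subtractf[symmetric] algebra_simps)
  have sM: "summable (\<lambda>i. taboo_V_nu i * r ^ i)" using r by (intro taboo_V_nu_summable) auto
  have "norm (\<Sum>j=0..n. of_real (returns.dev j) * taboo_nu g (n - j)) * r ^ n
      \<le> (\<Sum>j=0..n. \<bar>returns.dev j\<bar> * norm (taboo_nu g (n - j))) * r ^ n"
    using r by (intro mult_right_mono order_trans[OF norm_sum]) (auto simp: norm_mult)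
  also have "\<dots> = (\<Sum>j=0..n. (\<bar>returns.dev j\<bar> * r ^ j) * (norm (taboo_nu g (n - j)) * r ^ (n - j)))"
    unfolding sum_distrib_right by (intro sum.cong) (auto simp: power_add[symmetric] mult_ac)
  also have "\<dots> \<le> (\<Sum>j=0..n. K0 * (B * taboo_V_nu (n - j) * r ^ (n - j)))"
    using K0 taboo_nu_bound[OF g] r K00 by (intro sum_mono mult_mono mult_right_mono) auto
  also have "\<dots> = (\<Sum>j=0..n. K0 * (B * taboo_V_nu j * r ^ j))"
    by (subst sum.atLeastAtMost_rev) simp
  also have "\<dots> = K0 * B * (\<Sum>j=0..n. taboo_V_nu j * r ^ j)" by (simp add: sum_distrib_left mult_ac)
  also have "\<dots> \<le> K0 * B * ((K - r * lam) / (1 - r * lam))"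
  proof (rule mult_left_mono)
    have "(\<Sum>j=0..n. taboo_V_nu j * r ^ j) \<le> (\<Sum>i. taboo_V_nu i * r ^ i)"
      using taboo_V_nu_nonneg r by (intro sum_le_suminf sM) auto
    then show "(\<Sum>j=0..n. taboo_V_nu j * r ^ j) \<le> (K - r * lam) / (1 - r * lam)" using taboo_V_nu_gen[OF r] by simp
  qed (use K00 B in auto)
  finally have 1: "norm (\<Sum>j=0..n. of_real (returns.dev j) * taboo_nu g (n - j)) * r ^ n \<le> K0 * B * ((K - r * lam) / (1 - r * lam))" .
  have "norm (\<Sum>j. p *\<^sub>R taboo_nu g (j + Suc n)) \<le> (\<Sum>j. B * taboo_V_nu (j + Suc n))"
  proof (rule norm_suminf_le)
    fix j
    have "p * norm (taboo_nu g (j + Suc n)) \<le> 1 * (B * taboo_V_nu (j + Suc n))" using taboo_nu_bound[OF g] p_bounds by (intro mult_mono) auto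
    then show "norm (p *\<^sub>R taboo_nu g (j + Suc n)) \<le> B * taboo_V_nu (j + Suc n)" using p_bounds by simp
  qed (intro summable_mult summable_ignore_initial_segment taboo_V_nu_sum)
  also have "\<dots> = B * (\<Sum>j. taboo_V_nu (j + Suc n))" by (intro suminf_mult summable_ignore_initial_segment taboo_V_nu_sum)
  also have "\<dots> \<le> B * (lam ^ n * (lam * (K - 1) / (1 - lam)))" using taboo_V_nu_tail B by (intro mult_left_mono) auto
  finally have "norm (\<Sum>j. p *\<^sub>R taboo_nu g (j + Suc n)) * r ^ n \<le> B * (lam ^ n * (lam * (K - 1) / (1 - lam))) * r ^ n"
    using r by (intro mult_right_mono) auto
  also have "\<dots> = B * (lam * (K - 1) / (1 - lam)) * (r * lam) ^ n" by (simp add: power_mult_distrib)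
  also have "\<dots> \<le> B * (lam * (K - 1) / (1 - lam)) * 1"
    using r B lam_pos lam_less K_ge by (intro mult_left_mono power_le_one mult_nonneg_nonneg divide_nonneg_nonneg) auto
  finally have 2: "norm (\<Sum>j. p *\<^sub>R taboo_nu g (j + Suc n)) * r ^ n \<le> B * (lam * (K - 1) / (1 - lam))" by simp
  have "norm (kernel_nu g n - (\<integral>x. g x \<partial>\<pi>)) * r ^ n
     \<le> (norm (\<Sum>j=0..n. of_real (returns.dev j) * taboo_nu g (n - j)) + norm (\<Sum>j. p *\<^sub>R taboo_nu g (j + Suc n))) * r ^ n"
    unfolding eq using r by (intro mult_right_mono norm_triangle_ineq4) auto
  then show ?thesis using 1 2 by (simp add: algebra_simps)
qed

text \<open>
  In \<open>first_entrance\<close>, \<open>\<pi>(g)\<close> is distributed over the possible hitting times: a fraction \<open>hit k x\<close> to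
  each \<open>k < n\<close> and the rest, \<open>(taboo ^^ n) 1\<close>, to paths that have not reached \<open>C\<close> yet. The middle
  terms are covered by \<open>kernel_nu_rate\<close>, the others are geometrically small.
\<close>

lemma kernel_rate:
  assumes g: "V_bounded B g" and x: "x \<in> space S" and n: "1 \<le> n"
    and r: "1 \<le> r" "r * lam < 1" and K0: "\<And>n. \<bar>returns.dev n\<bar> * r ^ n \<le> K0"
  shows "norm ((kernel_op P ^^ n) g x - (\<integral>y. g y \<partial>\<pi>)) * r ^ n \<le> M_bound lam K K0 r * B * V x"
proof -
  note B = V_bounded_nonneg[OF g]
  have K00: "0 \<le> K0" using K0[of 0] by (rule order_trans[rotated]) simp
  have Vx: "1 \<le> V x" by (rule V_ge[OF x])
  define G where "G = (\<integral>y. g y \<partial>\<pi>)"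
  define t where "t = (taboo ^^ n) (\<lambda>_. 1 :: real) x"
  define E where "E = K0 * ((K - r * lam) / (1 - r * lam)) + lam * (K - 1) / (1 - lam)"
  have E0: "0 \<le> E" unfolding E_def using K00 K_ge r lam_pos lam_less
    by (intro add_nonneg_nonneg mult_nonneg_nonneg divide_nonneg_nonneg) auto
  have rl: "(r * lam) ^ n \<le> r * lam"
    using power_decreasing[OF n, of "r * lam"] r lam_pos by simp
  have "(\<Sum>k<n. hit k x) + t = 1" using hit_sum[OF x] by (simp add: t_def)
  then have "(\<Sum>k<n. hit k x *\<^sub>R G) + t *\<^sub>R G = G"
    by (metis scaleR_left.sum scaleR_add_left scaleR_one)
  then have Gt: "(\<Sum>k<n. hit k x *\<^sub>R G) = G - t *\<^sub>R G" by (simp add: eq_diff_eq)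
  then have eq: "(kernel_op P ^^ n) g x - G
      = (taboo ^^ n) g x + (\<Sum>k<n. hit k x *\<^sub>R (kernel_nu g (n - Suc k) - G)) - t *\<^sub>R G"
    by (simp add: first_entrance[OF g x, of n] scaleR_diff_right sum_subtractf Gt)
  have "norm ((taboo ^^ n) g x) \<le> B * lam ^ n * V x" by (rule V_boundedD[OF V_bounded_taboo_pow[OF g] x])
  then have "norm ((taboo ^^ n) g x) * r ^ n \<le> B * lam ^ n * V x * r ^ n" using r by (intro mult_right_mono) auto
  also have "\<dots> = B * V x * (r * lam) ^ n" by (simp add: power_mult_distrib)
  also have "\<dots> \<le> B * V x * (r * lam)" using rl B Vx by (intro mult_left_mono) auto
  finally have 1: "norm ((taboo ^^ n) g x) * r ^ n \<le> B * V x * (r * lam)" .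
  have "norm (t *\<^sub>R G) * r ^ n \<le> lam ^ n * V x * (B * ((K - lam) / (1 - lam))) * r ^ n"
    unfolding norm_scaleR G_def t_def using taboo_one_bounds[OF x, of n] pi_norm[OF g] r B Vx lam_pos
    by (intro mult_right_mono mult_mono) auto
  also have "\<dots> = B * V x * ((K - lam) / (1 - lam)) * (r * lam) ^ n" by (simp add: power_mult_distrib)
  also have "\<dots> \<le> B * V x * ((K - lam) / (1 - lam)) * (r * lam)"
    using rl B Vx K_ge lam_less by (intro mult_left_mono mult_nonneg_nonneg divide_nonneg_nonneg) auto
  finally have 2: "norm (t *\<^sub>R G) * r ^ n \<le> B * V x * ((K - lam) / (1 - lam)) * (r * lam)" .
  have "norm (\<Sum>k<n. hit k x *\<^sub>R (kernel_nu g (n - Suc k) - G)) * r ^ n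
     \<le> (\<Sum>k<n. hit k x * norm (kernel_nu g (n - Suc k) - G)) * r ^ n"
    using r hit_nonneg[OF x] by (intro mult_right_mono order_trans[OF norm_sum]) auto
  also have "\<dots> = (\<Sum>k<n. (hit k x * r ^ k) * (r * (norm (kernel_nu g (n - Suc k) - G) * r ^ (n - Suc k))))"
    unfolding sum_distrib_right
  proof (intro sum.cong refl)
    fix k assume "k \<in> {..<n}"
    then have "r ^ n = r ^ k * (r * r ^ (n - Suc k))"
      by (metis Suc_diff_Suc lessThan_iff less_imp_le power_Suc power_add le_add_diff_inverse)
    then show "hit k x * norm (kernel_nu g (n - Suc k) - G) * r ^ n
      = (hit k x * r ^ k) * (r * (norm (kernel_nu g (n - Suc k) - G) * r ^ (n - Suc k)))" by simp
  qed
  also have "\<dots> \<le> (\<Sum>k<n. (hit k x * r ^ k) * (r * (B * E)))"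
    using kernel_nu_rate[OF g r K0] hit_nonneg[OF x] r unfolding E_def G_def
    by (intro sum_mono mult_left_mono) auto
  also have "\<dots> = (\<Sum>k<n. hit k x * r ^ k) * (r * (B * E))" by (simp add: sum_distrib_right)
  also have "\<dots> \<le> V x * (r * (B * E))"
    using hit_gen_partial[OF x, of r n] r B E0 by (intro mult_right_mono) auto
  finally have 3: "norm (\<Sum>k<n. hit k x *\<^sub>R (kernel_nu g (n - Suc k) - G)) * r ^ n \<le> V x * (r * (B * E))" .
  have "norm ((kernel_op P ^^ n) g x - G) \<le> norm ((taboo ^^ n) g x)
      + norm (\<Sum>k<n. hit k x *\<^sub>R (kernel_nu g (n - Suc k) - G)) + norm (t *\<^sub>R G)"
    unfolding eq by (rule order_trans[OF norm_triangle_ineq4 add_right_mono[OF norm_triangle_ineq]])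
  then have "norm ((kernel_op P ^^ n) g x - G) * r ^ n \<le> (norm ((taboo ^^ n) g x)
      + norm (\<Sum>k<n. hit k x *\<^sub>R (kernel_nu g (n - Suc k) - G)) + norm (t *\<^sub>R G)) * r ^ n"
    using r by (intro mult_right_mono) auto
  also have "\<dots> \<le> B * V x * (r * lam) + V x * (r * (B * E)) + B * V x * ((K - lam) / (1 - lam)) * (r * lam)"
    unfolding distrib_right using 1 2 3 by (intro add_mono)
  also have "\<dots> = B * V x * (r * lam + r * E + (K - lam) / (1 - lam) * (r * lam))"
    by (simp add: algebra_simps)
  also have "\<dots> \<le> B * V x * M_bound lam K K0 r"
  proof (rule mult_left_mono)
    \<comment> \<open>The left-hand side is what the estimates above give; the bound is obtained by enlarging\<close>
    \<comment> \<open>three of its terms by factors \<open>1 / (1 - s)\<close> or \<open>1 / (1 - lam)\<close>.\<close>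
    define s where "s = r * lam"
    have s: "0 < s" "s < 1" using r lam_pos by (auto simp: s_def)
    have "s \<le> s / (1 - s)" using s by (simp add: field_simps)
    moreover have "(K - lam) / (1 - lam) * s \<le> s * (K - lam) / (1 - lam)\<^sup>2"
    proof -
      have "(K - lam) / (1 - lam) * s * 1 \<le> (K - lam) / (1 - lam) * s * (1 / (1 - lam))"
        using s K_ge lam_pos lam_less
        by (intro mult_left_mono mult_nonneg_nonneg divide_nonneg_nonneg) (auto simp: field_simps)
      then show ?thesis by (simp add: power2_eq_square mult_ac)
    qed
    moreover have "s * (K - 1) / (1 - lam) \<le> s * (K - 1) / ((1 - lam) * (1 - s))"
      using s K_ge lam_less
      by (intro divide_left_mono mult_nonneg_nonneg mult_pos_pos) (auto simp: mult_le_cancel_left1)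
    moreover have "r * E = r * (K - s) / (1 - s) * K0 + s * (K - 1) / (1 - lam)"
      by (simp add: E_def s_def algebra_simps)
    ultimately show "r * lam + r * E + (K - lam) / (1 - lam) * (r * lam) \<le> M_bound lam K K0 r"
      unfolding M_bound_def s_def[symmetric] by linarith
  qed (use B Vx in auto)
  finally show ?thesis by (simp add: G_def mult_ac)
qed

section \<open>Resolvent, spectral radius and optimal constants\<close>

lemma V_norm_le_iff: "V_norm S V g \<le> ereal B \<longleftrightarrow> (\<forall>x\<in>space S. cmod (g x) \<le> B * V x)"
proof -
  have "cmod (g x) / V x \<le> B \<longleftrightarrow> cmod (g x) \<le> B * V x" if "x \<in> space S" for x
    using V_ge[OF that] by (simp add: pos_divide_le_eq)
  then show ?thesis by (simp add: V_norm_def SUP_le_iff)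
qed

lemma V_bounded_iff: "V_bounded B g \<longleftrightarrow> g \<in> borel_measurable S \<and> V_norm S V g \<le> ereal B"
  by (simp add: V_bounded_def V_norm_le_iff)

lemma V_bounded_B_V: "V_bounded B g \<Longrightarrow> g \<in> B_V S V"
  unfolding V_bounded_iff B_V_def by auto

lemma B_V_norm: assumes "g \<in> B_V S V" obtains B where "V_norm S V g = ereal B" "V_bounded B g"
proof -
  obtain x where x: "x \<in> space S" by (rule space_ne)
  have "0 \<le> ereal (cmod (g x) / V x)" using V_ge[OF x] by simp
  also have "\<dots> \<le> V_norm S V g" unfolding V_norm_def using x by (rule SUP_upper)
  finally have "V_norm S V g \<noteq> - \<infinity>" by auto
  moreover have "V_norm S V g < \<infinity>" "g \<in> borel_measurable S" using assms by (auto simp: B_V_def)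
  ultimately obtain B where "V_norm S V g = ereal B" by (cases "V_norm S V g") auto
  then show ?thesis using that[of B] \<open>g \<in> borel_measurable S\<close> by (simp add: V_bounded_iff)
qed

text \<open>
  The powers of \<open>P - 1 \<otimes> \<pi>\<close>, in closed form: for \<open>n \<ge> 1\<close> the \<open>n\<close>-th power is \<open>P\<^sup>n - 1 \<otimes> \<pi>\<close>, while for
  \<open>n = 0\<close> it is the identity.
\<close>

definition centred_pow :: "nat \<Rightarrow> ('a \<Rightarrow> complex) \<Rightarrow> 'a \<Rightarrow> complex" where
  "centred_pow n g x = (if n = 0 then g x else (kernel_op P ^^ n) g x - (\<integral>y. g y \<partial>\<pi>))"

lemma V_bounded_lincomb:
  fixes g h :: "'a \<Rightarrow> complex"
  assumes "V_bounded B g" "V_bounded B' h" shows "V_bounded (cmod c * B + cmod d * B') (\<lambda>x. c * g x + d * h x)"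
proof -
  have "V_bounded (cmod c * B) (\<lambda>x. c * g x)" "V_bounded (cmod d * B') (\<lambda>x. d * h x)"
    using assms by (auto simp: V_bounded_def norm_mult mult.assoc intro!: mult_left_mono)
  then show ?thesis by (rule V_bounded_add)
qed

lemma kernel_pow_lincomb:
  assumes g: "V_bounded B g" and h: "V_bounded B' h" and x: "x \<in> space S"
  shows "(kernel_op P ^^ n) (\<lambda>y. c * g y + d * h y) x = c * (kernel_op P ^^ n) g x + d * (kernel_op P ^^ n) h x"
  using x
proof (induction n arbitrary: x)
  case (Suc n)
  have "(kernel_op P ^^ Suc n) (\<lambda>y. c * g y + d * h y) x
      = (\<integral>y. c * (kernel_op P ^^ n) g y + d * (kernel_op P ^^ n) h y \<partial>P x)"
    unfolding kernel_pow_Suc by (rule Bochner_Integration.integral_cong) (simp_all add: space_P[OF Suc.prems] Suc.IH)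
  also have "\<dots> = c * (kernel_op P ^^ Suc n) g x + d * (kernel_op P ^^ Suc n) h x"
    unfolding kernel_pow_Suc
    using V_bounded_int_P[OF V_bounded_kernel_pow[OF g] Suc.prems, of n] V_bounded_int_P[OF V_bounded_kernel_pow[OF h] Suc.prems, of n]
    by simp
  finally show ?case .
qed simp

lemma kernel_pow_const: assumes "x \<in> space S" shows "(kernel_op P ^^ n) (\<lambda>_. 1) x = 1"
  using assms
proof (induction n arbitrary: x)
  case (Suc n)
  have "(kernel_op P ^^ Suc n) (\<lambda>_. 1) x = (\<integral>y. 1 \<partial>P x)"
    unfolding kernel_pow_Suc by (rule Bochner_Integration.integral_cong) (simp_all add: space_P[OF Suc.prems] Suc.IH)
  then show ?case using prob_space.prob_space[OF P_prob[OF Suc.prems]] by simp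
qed simp

lemma pi_kernel_pow: assumes g: "V_bounded B g" shows "(\<integral>x. (kernel_op P ^^ n) g x \<partial>\<pi>) = (\<integral>x. g x \<partial>\<pi>)"
  by (induction n) (use stationary_integral[OF V_bounded_kernel_pow[OF g]] in auto)

lemma pi_const: "(\<integral>x. c \<partial>\<pi>) = (c :: complex)"
  using prob_space.prob_space[OF pi_prob] by simp

lemma P_const: "x \<in> space S \<Longrightarrow> (\<integral>y. c \<partial>P x) = (c :: complex)"
  using prob_space.prob_space[OF P_prob] by simp

lemma centred_pow_lincomb:
  assumes g: "V_bounded B g" and h: "V_bounded B' h" and x: "x \<in> space S"
  shows "centred_pow n (\<lambda>y. c * g y + d * h y) x = c * centred_pow n g x + d * centred_pow n h x"
  using kernel_pow_lincomb[OF assms, of n c d] V_bounded_int_pi[OF g] V_bounded_int_pi[OF h]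
  by (simp add: centred_pow_def algebra_simps)

lemma centred_pow_Suc_right:
  assumes g: "V_bounded B g" and x: "x \<in> space S"
  shows "centred_pow n (centred_pow 1 g) x = centred_pow (Suc n) g x"
proof (cases n)
  case (Suc k)
  define G where "G = (\<integral>y. g y \<partial>\<pi>)"
  have T1: "centred_pow 1 g = (\<lambda>y. 1 * kernel_op P g y + (- G) * 1)" by (simp add: centred_pow_def G_def fun_eq_iff)
  have "(kernel_op P ^^ n) (centred_pow 1 g) x = (kernel_op P ^^ n) (kernel_op P g) x - G"
    unfolding T1 kernel_pow_lincomb[OF V_bounded_kernel[OF g] V_bounded_one_c x] by (simp add: kernel_pow_const[OF x])
  also have "(kernel_op P ^^ n) (kernel_op P g) x = (kernel_op P ^^ Suc n) g x"
    by (simp only: funpow_Suc_right comp_def)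
  finally have 1: "(kernel_op P ^^ n) (centred_pow 1 g) x = (kernel_op P ^^ Suc n) g x - G" .
  have "(\<integral>y. centred_pow 1 g y \<partial>\<pi>) = (\<integral>y. kernel_op P g y \<partial>\<pi>) - (\<integral>y. G \<partial>\<pi>)"
    unfolding T1 using V_bounded_int_pi[OF V_bounded_kernel[OF g]] prob_space.finite_measure[OF pi_prob]
    by (simp add: finite_measure.integrable_const)
  also have "\<dots> = 0" using stationary_integral[OF g] pi_const[of G] by (simp add: G_def)
  finally have 2: "(\<integral>y. centred_pow 1 g y \<partial>\<pi>) = 0" .
  have "centred_pow n h x = (kernel_op P ^^ n) h x - (\<integral>y. h y \<partial>\<pi>)" for h using Suc by (simp add: centred_pow_def)
  then have "centred_pow n (centred_pow 1 g) x = (kernel_op P ^^ Suc n) g x - G" by (simp only: 1 2) simp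
  then show ?thesis by (simp add: centred_pow_def[of "Suc n"] G_def)
qed (simp add: centred_pow_def)

lemma V_bounded_centred_pow:
  assumes g: "V_bounded B g" and n: "1 \<le> n" shows "\<exists>B'. V_bounded B' (centred_pow n g)"
proof -
  have "V_bounded (cmod 1 * (B * K ^ n) + cmod (- (\<integral>y. g y \<partial>\<pi>)) * 1) (\<lambda>x. 1 * (kernel_op P ^^ n) g x + (- (\<integral>y. g y \<partial>\<pi>)) * 1)"
    by (rule V_bounded_lincomb[OF V_bounded_kernel_pow[OF g] V_bounded_one_c])
  moreover have "(\<lambda>x. 1 * (kernel_op P ^^ n) g x + (- (\<integral>y. g y \<partial>\<pi>)) * 1) = centred_pow n g"
    using n by (simp add: centred_pow_def fun_eq_iff)
  ultimately show ?thesis by (intro exI) simp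
qed

lemma centred_pow_Suc_left:
  assumes g: "V_bounded B g" and x: "x \<in> space S"
  shows "(\<integral>y. centred_pow n g y \<partial>P x) - (\<integral>y. centred_pow n g y \<partial>\<pi>) = centred_pow (Suc n) g x"
proof (cases "n = 0")
  case True then show ?thesis by (simp add: centred_pow_def kernel_op_def)
next
  case False
  have "(\<integral>y. centred_pow n g y \<partial>P x) = (kernel_op P ^^ Suc n) g x - (\<integral>y. g y \<partial>\<pi>)"
    unfolding kernel_pow_Suc using False V_bounded_int_P[OF V_bounded_kernel_pow[OF g] x, of n]
      prob_space.finite_measure[OF P_prob[OF x]] P_const[OF x]
    by (simp add: centred_pow_def finite_measure.integrable_const)
  moreover have "(\<integral>y. centred_pow n g y \<partial>\<pi>) = 0"
    using False V_bounded_int_pi[OF V_bounded_kernel_pow[OF g], of n] pi_kernel_pow[OF g, of n]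
      prob_space.finite_measure[OF pi_prob] pi_const
    by (simp add: centred_pow_def finite_measure.integrable_const)
  ultimately show ?thesis by (simp add: centred_pow_def)
qed

text \<open>
  The Neumann series of the resolvent. It converges pointwise with a geometric bound in terms of \<open>V\<close>; to apply
  the operator to its sum, the series is integrated term by term against \<open>P x\<close> and against \<open>\<pi>\<close>.
\<close>

lemma resolvent:
  assumes rho: "0 < rho" "rho < cmod z" and Mb: "1 \<le> Mb"
    and bd: "\<And>B g x n. V_bounded B g \<Longrightarrow> x \<in> space S \<Longrightarrow> cmod (centred_pow n g x) \<le> Mb * rho ^ n * B * V x"
  shows "in_resolvent_set S V (\<lambda>g x. kernel_op P g x - (\<integral>y. g y \<partial>\<pi>)) z"
proof -
  define t where "t n g x = centred_pow n g x / z ^ Suc n" for n g x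
  define A where "A g x = (\<Sum>n. t n g x)" for g x
  have T1: "(\<lambda>x. kernel_op P g x - (\<integral>y. g y \<partial>\<pi>)) = centred_pow 1 g" for g by (simp add: centred_pow_def fun_eq_iff)
  have z: "0 < cmod z" using rho by linarith
  define w where "w = rho / cmod z"
  have w: "0 \<le> w" "w < 1" using rho z by (auto simp: w_def)
  have tb: "cmod (t n g x) \<le> Mb * B * V x / cmod z * w ^ n" if "V_bounded B g" "x \<in> space S" for B g x n
  proof -
    have "cmod (t n g x) \<le> Mb * rho ^ n * B * V x / cmod z ^ Suc n"
      unfolding t_def norm_divide norm_power using bd[OF that] by (intro divide_right_mono) auto
    also have "\<dots> = Mb * B * V x / cmod z * w ^ n" by (simp add: w_def power_divide)
    finally show ?thesis .
  qed
  have sw: "summable (\<lambda>n. C * w ^ n)" for C :: real using w by (intro summable_mult summable_geometric) auto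
  have st: "summable (\<lambda>n. cmod (t n g x))" if "V_bounded B g" "x \<in> space S" for B g x
  proof (rule summable_comparison_test'[OF sw, of 0])
    show "norm (cmod (t n g x)) \<le> Mb * B * V x / cmod z * w ^ n" for n using tb[OF that] by simp
  qed
  note st' = st[THEN summable_norm_cancel]
  have Tm: "centred_pow n g \<in> borel_measurable S" if "V_bounded B g" for B g n
  proof (cases "n = 0")
    case True then show ?thesis using V_bounded_meas[OF that] by (simp add: centred_pow_def[abs_def])
  next
    case False
    with V_bounded_centred_pow[OF that, of n] obtain B' where "V_bounded B' (centred_pow n g)" by auto
    then show ?thesis by (rule V_bounded_meas)
  qed
  have tdom: "V_bounded (Mb * B / cmod z * w ^ n) (t n g)" if g: "V_bounded B g" for B g n
  proof -
    have "t n g \<in> borel_measurable S" unfolding t_def[abs_def] using Tm[OF g, of n] by measurable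
    moreover have "cmod (t n g x) \<le> Mb * B / cmod z * w ^ n * V x" if "x \<in> space S" for x
      using tb[OF g that, of n] by (simp add: mult_ac)
    ultimately show ?thesis by (auto simp: V_bounded_def)
  qed
  define C' where "C' = Mb / cmod z * (1 / (1 - w))"
  have boundedA: "V_bounded (C' * B) (A g)" if g: "V_bounded B g" for B g
  proof -
    have "A g \<in> borel_measurable S"
      unfolding A_def[abs_def] using V_bounded_meas[OF tdom[OF g]] by (rule borel_measurable_suminf)
    moreover have "cmod (A g x) \<le> C' * B * V x" if x: "x \<in> space S" for x
    proof -
      have "cmod (A g x) \<le> (\<Sum>n. Mb * B * V x / cmod z * w ^ n)"
        unfolding A_def by (rule norm_suminf_le[OF tb[OF g x] sw])
      also have "\<dots> = Mb * B * V x / cmod z * (1 / (1 - w))"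
        using w by (subst suminf_mult) (auto intro: summable_geometric simp: suminf_geometric)
      finally show ?thesis by (simp add: C'_def mult_ac)
    qed
    ultimately show ?thesis by (simp add: V_bounded_def)
  qed
  have sT: "(\<lambda>n. centred_pow (Suc n) g x / z ^ Suc n) sums (z * A g x - g x)" if g: "V_bounded B g" and x: "x \<in> space S" for B g x
  proof -
    have "(\<lambda>n. z * t n g x) sums (z * A g x)" unfolding A_def by (intro sums_mult summable_sums st'[OF g x])
    moreover have "z * t n g x = centred_pow n g x / z ^ n" for n using z by (simp add: t_def)
    ultimately have "(\<lambda>n. centred_pow n g x / z ^ n) sums (z * A g x)" by simp
    then show ?thesis by (subst sums_Suc_iff) (simp add: centred_pow_def)
  qed
  have intA: "(\<lambda>n. (\<integral>y. centred_pow n g y \<partial>Mm) / z ^ Suc n) sums (\<integral>y. A g y \<partial>Mm)"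
    if g: "V_bounded B g" and Mm: "sets Mm = sets S" "integrable Mm V" for B g Mm
  proof -
    have "(\<lambda>n. \<integral>y. t n g y \<partial>Mm) sums (\<integral>y. (\<Sum>n. t n g y) \<partial>Mm)"
    proof (rule sums_integral)
      show "integrable Mm (t n g)" for n by (rule V_bounded_integrable[OF tdom[OF g] Mm])
      show "AE y in Mm. summable (\<lambda>n. norm (t n g y))"
        using st[OF g] by (intro AE_I2) (simp add: sets_eq_imp_space_eq[OF Mm(1)])
      show "summable (\<lambda>n. \<integral>y. norm (t n g y) \<partial>Mm)"
      proof (rule summable_comparison_test'[OF sw])
        fix n
        have "norm (\<integral>y. norm (t n g y) \<partial>Mm) \<le> Mb * B / cmod z * w ^ n * (\<integral>y. V y \<partial>Mm)"
          using V_bounded_norm_integral[OF V_bounded_norm[OF tdom[OF g]] Mm, of n] .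
        then show "norm (\<integral>y. norm (t n g y) \<partial>Mm) \<le> Mb * B / cmod z * (\<integral>y. V y \<partial>Mm) * w ^ n"
          by (simp add: mult_ac)
      qed
    qed
    then show ?thesis by (simp add: A_def t_def)
  qed
  have left: "z * A g x - centred_pow 1 (A g) x = g x" if g: "V_bounded B g" and x: "x \<in> space S" for B g x
  proof -
    have "(\<lambda>n. (\<integral>y. centred_pow n g y \<partial>P x) / z ^ Suc n - (\<integral>y. centred_pow n g y \<partial>\<pi>) / z ^ Suc n)
        sums ((\<integral>y. A g y \<partial>P x) - (\<integral>y. A g y \<partial>\<pi>))"
      by (intro sums_diff intA[OF g] P_sets V_int_P(1) x pi_sets integrable_pi_V)
    moreover have "(\<integral>y. centred_pow n g y \<partial>P x) / z ^ Suc n - (\<integral>y. centred_pow n g y \<partial>\<pi>) / z ^ Suc n = centred_pow (Suc n) g x / z ^ Suc n" for n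
      unfolding centred_pow_Suc_left[OF g x, symmetric] by (simp only: diff_divide_distrib)
    ultimately have "(\<lambda>n. centred_pow (Suc n) g x / z ^ Suc n) sums ((\<integral>y. A g y \<partial>P x) - (\<integral>y. A g y \<partial>\<pi>))" by simp
    then have "z * A g x - g x = (\<integral>y. A g y \<partial>P x) - (\<integral>y. A g y \<partial>\<pi>)"
      by (rule sums_unique2[OF sT[OF g x]])
    moreover have "centred_pow 1 (A g) x = (\<integral>y. A g y \<partial>P x) - (\<integral>y. A g y \<partial>\<pi>)" by (simp add: centred_pow_def kernel_op_def)
    ultimately show ?thesis by (metis diff_diff_eq2 add_diff_cancel_left' diff_add_cancel)
  qed
  have right: "A (\<lambda>y. z * g y - centred_pow 1 g y) x = g x" if g: "V_bounded B g" and x: "x \<in> space S" for B g x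
  proof -
    obtain B' where B': "V_bounded B' (centred_pow 1 g)" using V_bounded_centred_pow[OF g, of 1] by auto
    have "t n (\<lambda>y. z * g y - centred_pow 1 g y) x = z * t n g x - centred_pow (Suc n) g x / z ^ Suc n" for n
      using centred_pow_lincomb[OF g B' x, of n z "-1"] centred_pow_Suc_right[OF g x, of n]
      by (simp add: t_def diff_divide_distrib)
    moreover have "(\<lambda>n. z * t n g x - centred_pow (Suc n) g x / z ^ Suc n) sums (z * A g x - (z * A g x - g x))"
      unfolding A_def[of g x] by (intro sums_diff sums_mult summable_sums st'[OF g x] sT[OF g x, unfolded A_def])
    ultimately show ?thesis by (simp add: A_def sums_iff)
  qed
  have "bounded_operator S V A"
    unfolding bounded_operator_def
  proof (intro conjI ballI allI)
    fix g assume "g \<in> B_V S V"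
    then show "A g \<in> B_V S V" by (elim B_V_norm) (rule V_bounded_B_V[OF boundedA])
  next
    fix g h c d x assume g: "g \<in> B_V S V" and h: "h \<in> B_V S V" and x: "x \<in> space S"
    show "A (\<lambda>y. c * g y + d * h y) x = c * A g x + d * A h x"
    proof -
      obtain B B' where B: "V_bounded B g" "V_bounded B' h" using g h by (meson B_V_norm)
      have "t n (\<lambda>y. c * g y + d * h y) x = c * t n g x + d * t n h x" for n
        unfolding t_def centred_pow_lincomb[OF B x] by (simp add: add_divide_distrib)
      moreover have "(\<lambda>n. c * t n g x + d * t n h x) sums (c * A g x + d * A h x)"
        unfolding A_def by (intro sums_add sums_mult summable_sums st'[OF B(1) x] st'[OF B(2) x])
      ultimately show ?thesis by (simp add: A_def sums_iff)
    qed
  next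
    show "\<exists>B::real. \<forall>g\<in>B_V S V. V_norm S V (A g) \<le> ereal B * V_norm S V g"
    proof (intro exI[of _ C'] ballI)
      fix g assume "g \<in> B_V S V"
      then obtain B where B: "V_norm S V g = ereal B" "V_bounded B g" by (rule B_V_norm)
      show "V_norm S V (A g) \<le> ereal C' * V_norm S V g"
        using boundedA[OF B(2)] unfolding B(1) by (simp add: V_bounded_iff)
    qed
  qed
  then show ?thesis
    unfolding in_resolvent_set_def T1
  proof (intro exI[of _ A] conjI ballI)
    fix g x assume "g \<in> B_V S V" and x: "x \<in> space S"
    then obtain B where B: "V_bounded B g" by (meson B_V_norm)
    show "z * A g x - centred_pow 1 (A g) x = g x" by (rule left[OF B x])
    show "A (\<lambda>y. z * g y - centred_pow 1 g y) x = g x" by (rule right[OF B x])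
  qed
qed

lemma rate_consequences:
  assumes r: "1 < r" "r * lam < 1" and K0: "\<And>n. \<bar>returns.dev n\<bar> * r ^ n \<le> K0"
  shows "\<And>g n. g \<in> B_V S V \<Longrightarrow> 1 \<le> n \<Longrightarrow>
      V_norm S V (\<lambda>x. (kernel_op P ^^ n) g x - (\<integral>y. g y \<partial>\<pi>)) \<le> ereal (M_bound lam K K0 r * (1 / r) ^ n) * V_norm S V g"
    and "M_V S P \<pi> V r \<le> ereal (M_bound lam K K0 r)"
    and "\<And>z. 1 / r < cmod z \<Longrightarrow> in_resolvent_set S V (\<lambda>g x. kernel_op P g x - (\<integral>y. g y \<partial>\<pi>)) z"
proof -
  define Mb where "Mb = M_bound lam K K0 r"
  have bd: "cmod ((kernel_op P ^^ n) g x - (\<integral>y. g y \<partial>\<pi>)) \<le> Mb * (1 / r) ^ n * B * V x"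
    if "V_bounded B g" "x \<in> space S" "1 \<le> n" for B g x n
    using kernel_rate[OF that less_imp_le[OF r(1)] r(2) K0] r(1)
    by (simp add: Mb_def power_one_over field_simps)
  show est: "V_norm S V (\<lambda>x. (kernel_op P ^^ n) g x - (\<integral>y. g y \<partial>\<pi>)) \<le> ereal (M_bound lam K K0 r * (1 / r) ^ n) * V_norm S V g"
    if "g \<in> B_V S V" "1 \<le> n" for g n
  proof -
    from that(1) obtain B where B: "V_norm S V g = ereal B" "V_bounded B g" by (rule B_V_norm)
    show ?thesis unfolding B(1) times_ereal.simps V_norm_le_iff using bd[OF B(2) _ that(2)] by (simp add: Mb_def)
  qed
  have "(1 / r) ^ n = r powi (- int n)" for n using r by (simp add: power_int_minus power_one_over divide_inverse power_inverse)
  then show "M_V S P \<pi> V r \<le> ereal (M_bound lam K K0 r)"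
    unfolding M_V_def using est by (intro Inf_lower CollectI exI[of _ "M_bound lam K K0 r"]) simp
  fix z assume z: "1 / r < cmod z"
  show "in_resolvent_set S V (\<lambda>g x. kernel_op P g x - (\<integral>y. g y \<partial>\<pi>)) z"
  proof (rule resolvent[of "1 / r" z "max 1 Mb"])
    fix B x n and g :: "'a \<Rightarrow> complex" assume g: "V_bounded B g" and x: "x \<in> space S"
    show "cmod (centred_pow n g x) \<le> max 1 Mb * (1 / r) ^ n * B * V x"
    proof (cases "n = 0")
      case True
      have "0 \<le> B * V x" using V_bounded_nonneg[OF g] V_ge[OF x] by simp
      then have "1 * (B * V x) \<le> max 1 Mb * (B * V x)" by (intro mult_right_mono) auto
      then show ?thesis using True V_boundedD[OF g x] by (simp add: centred_pow_def mult_ac)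
    next
      case False
      have "Mb * ((1 / r) ^ n * B * V x) \<le> max 1 Mb * ((1 / r) ^ n * B * V x)"
        using V_bounded_nonneg[OF g] V_ge[OF x] r by (intro mult_right_mono) auto
      then show ?thesis using False bd[OF g x, of n] by (simp add: centred_pow_def mult_ac)
    qed
  qed (use z r in auto)
qed

text \<open>
  Outside the closed disc of radius \<open>1 / r0\<close> every point has modulus greater than \<open>1 / r\<close> for some \<open>r < r0\<close>,
  so it belongs to the resolvent set.
\<close>

lemma rho_V_le:
  assumes r0: "1 < r0" and K0: "\<And>r. 1 < r \<Longrightarrow> r < r0 \<Longrightarrow> r * lam < 1 \<and> (\<forall>n. \<bar>returns.dev n\<bar> * r ^ n \<le> K0 r)"
  shows "rho_V S P \<pi> V \<le> ereal (1 / r0)"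
  unfolding rho_V_def spectral_radius_def
proof (rule SUP_least)
  fix z assume z: "z \<in> {z. \<not> in_resolvent_set S V (\<lambda>g x. kernel_op P g x - (\<integral>y. g y \<partial>\<pi>)) z}"
  show "ereal (cmod z) \<le> ereal (1 / r0)"
  proof (rule ccontr)
    assume "\<not> ereal (cmod z) \<le> ereal (1 / r0)"
    then have cz: "1 / r0 < cmod z" by simp
    then have "0 < cmod z" using r0 by (smt (verit) divide_pos_pos)
    then have "1 / cmod z < r0" using cz r0 by (simp add: field_simps)
    then obtain r where r: "max 1 (1 / cmod z) < r" "r < r0" using r0 dense[of "max 1 (1 / cmod z)" r0] by auto
    then have "1 / r < cmod z" using \<open>0 < cmod z\<close> by (simp add: field_simps)
    then show False using z K0[of r] r rate_consequences(3)[of r "K0 r" z] by auto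
  qed
qed

theorem ergodic_bounds:
  "geometrically_ergodic S P \<pi> V
    \<and> (p < 1 \<longrightarrow>
         rho_V S P \<pi> V \<le> ereal (1 / r0_atom b lam K p)
         \<and> (\<forall>r. 1 < r \<and> r < r0_atom b lam K p \<longrightarrow>
              M_V S P \<pi> V r \<le> ereal (M_bound lam K (K0_atom b lam K p r) r)))
    \<and> (1 \<le> alpha0 b lam K \<longrightarrow>
         rho_V S P \<pi> V \<le> ereal (1 / r0_free b lam K)
         \<and> (\<forall>r. 1 < r \<and> r < r0_free b lam K \<longrightarrow>
              M_V S P \<pi> V r \<le> ereal (M_bound lam K (K0_free b lam K r) r)))"
proof -
  have rR: "r * lam < 1" if "r < R_par lam" for r using that lam_pos by (simp add: R_par_def field_simps)
  have al: "0 < returns.excess" if "p < 1"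
  proof -
    have "1 < returns.mean_wait" using that returns.mean_wait_ge_1 by (simp add: kac)
    then show ?thesis using b_bounds by (simp add: returns.excess_def)
  qed
  have atom: "1 < r0_atom b lam K p"
    "\<And>r. 1 < r \<Longrightarrow> r < r0_atom b lam K p \<Longrightarrow> r * lam < 1 \<and> (\<forall>n. \<bar>returns.dev n\<bar> * r ^ n \<le> K0_atom b lam K p r)" if "p < 1"
    using returns.atom_rate[OF al[OF that]] rR unfolding kac[symmetric] by (auto simp: r0_atom_def Let_def)
  have free: "1 < r0_free b lam K"
    "\<And>r. 1 < r \<Longrightarrow> r < r0_free b lam K \<Longrightarrow> r * lam < 1 \<and> (\<forall>n. \<bar>returns.dev n\<bar> * r ^ n \<le> K0_free b lam K r)" if "1 \<le> alpha0 b lam K"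
    using returns.free_rate[OF that] rR by (auto simp: r0_free_def)
  have "\<exists>r K0. 1 < r \<and> r * lam < 1 \<and> (\<forall>n. \<bar>returns.dev n\<bar> * r ^ n \<le> K0)"
  proof (cases "p < 1")
    case True
    then obtain r where "1 < r" "r < r0_atom b lam K p" using dense[OF atom(1)] by auto
    then show ?thesis using atom(2)[OF True] by blast
  next
    case False
    then have "returns.mean_wait = 1" using p_bounds kac returns.mean_wait_ge_1 by (simp add: divide_less_eq)
    \<comment> \<open>If \<open>\<pi>(C) = 1\<close>, every return takes one step and the renewal sequence is constant.\<close>
    then have excess0: "returns.excess = 0" by (simp add: returns.excess_def)
    define r where "r = (1 + 1 / lam) / 2"
    have r: "1 < r" "r < 1 / lam" using lam_pos lam_less by (auto simp: r_def field_simps)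
    have "\<bar>returns.dev n\<bar> * r ^ n \<le> 0 / r / (1 - 0)" for n
      using r returns.surv_sum_eq_1[OF excess0, of r] by (intro returns.renewal_rate_perturbative) auto
    then show ?thesis using r lam_pos by (intro exI[of _ r] exI[of _ 0]) (auto simp: field_simps)
  qed
  then obtain r K0 where r: "1 < r" "r * lam < 1" and K0: "\<And>n. \<bar>returns.dev n\<bar> * r ^ n \<le> K0" by auto
  have "geometrically_ergodic S P \<pi> V"
    unfolding geometrically_ergodic_def
    by (rule exI[of _ "1 / r"], rule exI[of _ "M_bound lam K K0 r"]) (use rate_consequences(1)[OF r K0] r in auto)
  moreover have "rho_V S P \<pi> V \<le> ereal (1 / r0_atom b lam K p)" if "p < 1"
    using rho_V_le[OF atom[OF that]] .
  moreover have "M_V S P \<pi> V r \<le> ereal (M_bound lam K (K0_atom b lam K p r) r)"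
    if "p < 1" "1 < r" "r < r0_atom b lam K p" for r
    using rate_consequences(2)[OF that(2)] atom(2)[OF that] by blast
  moreover have "rho_V S P \<pi> V \<le> ereal (1 / r0_free b lam K)" if "1 \<le> alpha0 b lam K"
    using rho_V_le[OF free[OF that]] .
  moreover have "M_V S P \<pi> V r \<le> ereal (M_bound lam K (K0_free b lam K r) r)"
    if "1 \<le> alpha0 b lam K" "1 < r" "r < r0_free b lam K" for r
    using rate_consequences(2)[OF that(2)] free(2)[OF that] by blast
  ultimately show ?thesis by blast
qed

end

theorem theorem2p6:
  fixes S :: "'a measure" and P :: "'a \<Rightarrow> 'a measure" and \<pi> \<nu> :: "'a measure"
    and C :: "'a set" and V :: "'a \<Rightarrow> real" and b lam K :: real
  assumes "P \<in> S \<rightarrow>\<^sub>M prob_algebra S"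
    and "unique_stationary S P \<pi>"
    and "minorization_atom S P C \<nu>"
    and "drift_condition S P C V lam K"
    and "strong_aperiodicity \<nu> C b"
  shows "geometrically_ergodic S P \<pi> V
    \<and> (measure \<pi> C < 1 \<longrightarrow>
         rho_V S P \<pi> V \<le> ereal (1 / r0_atom b lam K (measure \<pi> C))
         \<and> (\<forall>r. 1 < r \<and> r < r0_atom b lam K (measure \<pi> C) \<longrightarrow>
              M_V S P \<pi> V r \<le> ereal (M_bound lam K (K0_atom b lam K (measure \<pi> C) r) r)))
    \<and> (1 \<le> alpha0 b lam K \<longrightarrow>
         rho_V S P \<pi> V \<le> ereal (1 / r0_free b lam K)
         \<and> (\<forall>r. 1 < r \<and> r < r0_free b lam K \<longrightarrow>
              M_V S P \<pi> V r \<le> ereal (M_bound lam K (K0_free b lam K r) r)))"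
proof -
  interpret atomic_chain S P \<pi> \<nu> C V b lam K
    using assms by unfold_locales (auto simp: unique_stationary_def)
  show ?thesis by (rule ergodic_bounds)
qed

end
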